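(* Let $K\geq 2$ be an integer and $\boldsymbol{a}=(a_1,\dots,a_{K-1}),\boldsymbol{b}=(b_1,\dots,b_{K-1})\in\mathbb{Z}^{K-1}$ such that \[ E_K = \prod_{i=1}^{K-1}a_ib_i\prod_{1\le i<j\le K-1}(a_ib_j-a_jb_i)\neq 0.\] Let $\rho_K(p)$ denote the number of solutions modulo $p$ of the congruence $m\prod_{i=1}^{K-1}(a_im+b_i)\equiv 0\pmod p$, and assume $\rho_K(p)<p$ for every prime $p$. Then \[ \pi_K(\boldsymbol{a},\boldsymbol{b};X) <2^K K!\prod_p\left(1-\frac{\rho_K(p)}{p}\right)\left(1-\frac{1}{p}\right)^{-K}\frac{X}{\log^KX}\cdot\frac{\log X}{\log X - 2r_K} \] for all $X>\exp(2r_K)$, where $r_K=5.961\cdot 10^{14}K^2\log K$. Moreover, for $K=3$ and $X\geq 437400$, \[\pi_3(\boldsymbol{a},\boldsymbol{b};X) \leq 48\prod_p\left(1-\frac{\rho_3(p)}{p}\right)\left(1-\frac{1}{p}\right)^{-3}\frac{X}{\log^3X}\left(1 + \frac{34.549\log^2X}{P(\log X)}\right),\] where $P(t) = t^3 - 34.549t^2 + 379.423t -553.222$.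
   Context: For $K\in\mathbb{N}$, $\boldsymbol{a},\boldsymbol{b}\in\mathbb{Z}^{K-1}$ and $x>0$, $\pi_K(\boldsymbol{a},\boldsymbol{b};x)$ denotes the number of primes $p\leq x$ such that $a_ip+b_i$ is prime for every $1\leq i<K$. Products $\prod_p$ run over all primes. *)

theory Defs
  imports "HOL-Analysis.Analysis" "HOL-Number_Theory.Number_Theory"
begin

definition pi_K :: "nat \<Rightarrow> (nat \<Rightarrow> int) \<Rightarrow> (nat \<Rightarrow> int) \<Rightarrow> real \<Rightarrow> nat" where
  "pi_K K a b x = card {p::nat. prime p \<and> real p \<le> x \<and>
       (\<forall>i\<in>{1..K-1}. prime (a i * int p + b i))}"

definition E_K :: "nat \<Rightarrow> (nat \<Rightarrow> int) \<Rightarrow> (nat \<Rightarrow> int) \<Rightarrow> int" where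
  "E_K K a b = (\<Prod>i\<in>{1..K-1}. a i * b i) *
      (\<Prod>(i,j)\<in>{(i,j). 1 \<le> i \<and> i < j \<and> j \<le> K-1}. a i * b j - a j * b i)"

definition rho_K :: "nat \<Rightarrow> (nat \<Rightarrow> int) \<Rightarrow> (nat \<Rightarrow> int) \<Rightarrow> nat \<Rightarrow> nat" where
  "rho_K K a b p = card {m::nat. m < p \<and>
       [int m * (\<Prod>i\<in>{1..K-1}. a i * int m + b i) = 0] (mod int p)}"

definition sing_prod :: "nat \<Rightarrow> (nat \<Rightarrow> int) \<Rightarrow> (nat \<Rightarrow> int) \<Rightarrow> real" where
  "sing_prod K a b = (\<Prod>p. if prime p then
       (1 - real (rho_K K a b p) / real p) * (1 - 1 / real p) powi (- int K) else 1)"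

definition r_K :: "nat \<Rightarrow> real" where
  "r_K K = 5.961 * 10^14 * (real K)^2 * ln (real K)"

definition P3 :: "real \<Rightarrow> real" where
  "P3 t = t^3 - 34.549 * t^2 + 379.423 * t - 553.222"

end

theory Submission
  imports Defs "HOL-Computational_Algebra.Squarefree"
begin

text \<open>
  Put \<open>z = sqrt X / 2\<close>, \<open>f p = (1 - \<rho> p / p) / (1 - 1 / p) ^ K\<close>, \<open>h q = (\<Prod>p dvd q. \<rho> p / (p - \<rho> p))\<close>.
  Apart from at most \<open>K z\<close> exceptions, the primes that are counted avoid \<open>\<rho> p\<close> residue classes modulo every
  prime \<open>p \<le> z\<close>, so a large sieve with weights \<open>N + 4 q z\<close>, which depend on the denominator and therefore lose no
  \<open>ln ln X\<close>, bounds their number by \<open>X / J\<close>, where \<open>J = (\<Sum>q\<le>z. h q (1 - q / z))\<close> is taken over squarefree \<open>q\<close>.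

  It remains to bound \<open>J\<close> from below. Up to the factor \<open>\<Prod>p. 1 - \<rho> p / p\<close> it is the expectation of a monotone function
  of a sum of independent variables \<open>Y p\<close> with values \<open>0\<close> and \<open>ln p\<close>. The variable \<open>Y p\<close> is stochastically
  dominated by a sum of \<open>K\<close> geometric variables and one variable that equals \<open>ln p\<close> with probability
  \<open>max 0 (1 - f p)\<close>. The geometric variables produce a \<open>K\<close>-fold sum over \<open>1 / m\<close>, hence \<open>(ln z - 1) ^ K / K!\<close>, and the
  remaining ones only shift \<open>ln z\<close> by their mean \<open>\<mu>\<close>, by Jensen's inequality. Hence
  \<open>J \<Prod>p. f p \<ge> (ln z - 1 - \<mu>) ^ K / K!\<close> uniformly in the linear forms, where \<open>\<mu> \<le> 6 K ln K\<close> in general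
  and \<open>\<mu> \<le> 6/5\<close> for \<open>K = 3\<close>.
\<close>

section \<open>The weighted large sieve\<close>

text \<open>The obstacle is uniformity in the coefficients. A prime dividing \<open>E_K\<close> can
  have few forbidden classes, and then \<open>f p\<close> may be well above 1. Such a prime costs
  nothing: \<open>Y p\<close> vanishes with probability \<open>1 - rho p / p\<close>, the
  \<open>K\<close> geometric variables vanish together with probability
  \<open>(1 - 1 / p) ^ K\<close>, and if \<open>f p >= 1\<close> they dominate \<open>Y p\<close>
  unaided. Only a deficit \<open>f p < 1\<close> needs the extra variable, and since
  \<open>rho p <= K\<close> that deficit is \<open>O(K^2 / p^2)\<close> for \<open>p >= 2 K\<close>;
  this is why \<mu> depends on \<open>K\<close> alone. The exceptional primes, up to
  \<open>K z\<close> of them, must be absorbed by a main term proportional to the singular product.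
  So the product itself needs a lower bound free of the coefficients. For general \<open>K\<close>
  it comes from the same inequality for \<open>J\<close> at one fixed \<open>z\<close>, played
  against a trivial upper bound for \<open>J\<close>. Additive losses in \<open>ln z\<close> are
  affordable: in total they amount to at most \<open>20 K^2 ln K\<close>, far below
  \<open>r_K\<close>. A constant factor in the main term is not affordable, hence the weights that
  tend to \<open>X\<close> for small denominators.\<close>

lemma geometric_sums_from_1:
  fixes c :: complex
  assumes "norm c < 1"
  shows "(\<lambda>u. c ^ Suc u) sums (c / (1 - c))"
  using sums_mult[OF geometric_sums[OF assms], of c] by simp

text \<open>Expanding the geometric series writes the form as the sum over \<open>u >= 1\<close> of
  the squared moduli of \<open>\<Sum>r. d r * c r ^ u\<close>. It is the device that allows damped
  tails to be added to a quadratic form.\<close>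

lemma psd_geometric_kernel:
  fixes c d :: "'a \<Rightarrow> complex"
  assumes "finite I" and c: "\<And>r. r \<in> I \<Longrightarrow> norm (c r) < 1"
  shows "Re (\<Sum>r\<in>I. \<Sum>s\<in>I. d r * cnj (d s) * (c r * cnj (c s) / (1 - c r * cnj (c s)))) \<ge> 0"
proof -
  have lt: "norm (c r * cnj (c s)) < 1" if "r \<in> I" "s \<in> I" for r s
  proof -
    have "norm (c r) * norm (c s) < 1 * 1"
      by (rule mult_strict_mono) (use c that in auto)
    then show ?thesis by (simp add: norm_mult)
  qed
  have "(\<lambda>u. \<Sum>r\<in>I. \<Sum>s\<in>I. d r * cnj (d s) * (c r * cnj (c s)) ^ Suc u) sums
        (\<Sum>r\<in>I. \<Sum>s\<in>I. d r * cnj (d s) * (c r * cnj (c s) / (1 - c r * cnj (c s))))"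
    by (intro sums_sum sums_mult geometric_sums_from_1 lt)
  moreover have "(\<Sum>r\<in>I. \<Sum>s\<in>I. d r * cnj (d s) * (c r * cnj (c s)) ^ Suc u)
      = of_real ((norm (\<Sum>r\<in>I. d r * c r ^ Suc u))\<^sup>2)" for u
    unfolding complex_norm_square cnj_sum sum_product
    by (intro sum.cong refl) (simp add: power_mult_distrib mult_ac)
  ultimately have "(\<lambda>u. complex_of_real ((norm (\<Sum>r\<in>I. d r * c r ^ Suc u))\<^sup>2)) sums
        (\<Sum>r\<in>I. \<Sum>s\<in>I. d r * cnj (d s) * (c r * cnj (c s) / (1 - c r * cnj (c s))))" (is "?f sums ?S")
    by simp
  then have "(\<lambda>u. Re (?f u)) sums Re ?S" by (rule sums_Re)
  then show ?thesis by (metis (no_types, lifting) Re_complex_of_real sums_le sums_zero zero_le_power2)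
qed

text \<open>For \<open>W\<close> on the unit circle this is the sum of \<open>W ^ n\<close> over all
  integers \<open>n\<close>, with weight 1 on \<open>{1..N}\<close> and weight \<open>l ^ u\<close>
  at distance \<open>u\<close> outside. The tails \<open>n = N + u\<close> and
  \<open>n = 1 - u\<close> are already summed, with \<open>cnj W\<close> in place of
  \<open>1 / W\<close>.\<close>

definition tail_kernel :: "nat \<Rightarrow> real \<Rightarrow> complex \<Rightarrow> complex" where
  "tail_kernel N l W = (\<Sum>n=1..N. W ^ n) + W ^ N * (l * W / (1 - l * W)) + W * (l * cnj W / (1 - l * cnj W))"

text \<open>Because the damping is a product \<open>l r * l s\<close>, each tail is a positive
  semidefinite form in the scaled frequencies \<open>l r * w r\<close> or their conjugates, so
  adding both tails only enlarges the sum. The damping may differ from frequency to frequency, which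
  is the source of weights depending on the denominator.\<close>

lemma sum_norm_square_le_tail_kernel:
  fixes b w :: "'a \<Rightarrow> complex" and l :: "'a \<Rightarrow> real"
  assumes I: "finite I" and w: "\<And>r. r \<in> I \<Longrightarrow> norm (w r) = 1"
    and l: "\<And>r. r \<in> I \<Longrightarrow> 0 < l r \<and> l r < 1"
  shows "(\<Sum>n=1..N. (norm (\<Sum>r\<in>I. b r * w r ^ n))\<^sup>2)
     \<le> Re (\<Sum>r\<in>I. \<Sum>s\<in>I. b r * cnj (b s) * tail_kernel N (l r * l s) (w r * cnj (w s)))"
proof -
  have nl: "norm (of_real (l r) * w r) < 1" "norm (of_real (l r) * cnj (w r)) < 1" if "r \<in> I" for r
    using w[OF that] l[OF that] by (auto simp: norm_mult)
  have a: "complex_of_real (\<Sum>n=1..N. (norm (\<Sum>r\<in>I. b r * w r ^ n))\<^sup>2)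
      = (\<Sum>r\<in>I. \<Sum>s\<in>I. b r * cnj (b s) * (\<Sum>n=1..N. (w r * cnj (w s)) ^ n))"
  proof -
    have "complex_of_real (\<Sum>n=1..N. (norm (\<Sum>r\<in>I. b r * w r ^ n))\<^sup>2)
      = (\<Sum>n=1..N. \<Sum>r\<in>I. \<Sum>s\<in>I. b r * cnj (b s) * (w r * cnj (w s)) ^ n)"
      unfolding of_real_sum complex_norm_square cnj_sum sum_product
      by (intro sum.cong refl) (simp add: power_mult_distrib mult_ac)
    also have "\<dots> = (\<Sum>r\<in>I. \<Sum>n=1..N. \<Sum>s\<in>I. b r * cnj (b s) * (w r * cnj (w s)) ^ n)"
      by (rule sum.swap)
    also have "\<dots> = (\<Sum>r\<in>I. \<Sum>s\<in>I. \<Sum>n=1..N. b r * cnj (b s) * (w r * cnj (w s)) ^ n)"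
      by (intro sum.cong refl sum.swap)
    finally show ?thesis by (simp add: sum_distrib_left)
  qed
  have b: "0 \<le> Re (\<Sum>r\<in>I. \<Sum>s\<in>I. (b r * w r ^ N) * cnj (b s * w s ^ N) *
     ((l r * w r) * cnj (l s * w s) / (1 - (l r * w r) * cnj (l s * w s))))"
    by (rule psd_geometric_kernel[OF I nl(1)])
  have c: "0 \<le> Re (\<Sum>r\<in>I. \<Sum>s\<in>I. (b r * w r) * cnj (b s * w s) *
     ((l r * cnj (w r)) * cnj (l s * cnj (w s)) / (1 - (l r * cnj (w r)) * cnj (l s * cnj (w s)))))"
    by (rule psd_geometric_kernel[OF I nl(2)])
  have "(\<Sum>r\<in>I. \<Sum>s\<in>I. b r * cnj (b s) * tail_kernel N (l r * l s) (w r * cnj (w s)))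
     = complex_of_real (\<Sum>n=1..N. (norm (\<Sum>r\<in>I. b r * w r ^ n))\<^sup>2) +
       (\<Sum>r\<in>I. \<Sum>s\<in>I. (b r * w r ^ N) * cnj (b s * w s ^ N) *
     ((l r * w r) * cnj (l s * w s) / (1 - (l r * w r) * cnj (l s * w s)))) +
      (\<Sum>r\<in>I. \<Sum>s\<in>I. (b r * w r) * cnj (b s * w s) *
     ((l r * cnj (w r)) * cnj (l s * cnj (w s)) / (1 - (l r * cnj (w r)) * cnj (l s * cnj (w s)))))"
    unfolding a sum.distrib[symmetric]
    by (intro sum.cong refl) (simp add: tail_kernel_def power_mult_distrib algebra_simps)
  with b c show ?thesis by (simp del: of_real_sum)
qed

lemma Re_tail_kernel_diag:
  assumes "0 < l" "l < 1"
  shows "Re (tail_kernel N l 1) = N + 2 * l / (1 - l)"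
proof -
  have "tail_kernel N l 1 = complex_of_real (N + 2 * l / (1 - l))"
    unfolding tail_kernel_def by simp
  then show ?thesis by simp
qed

lemma norm_one_minus_mult_ge:
  assumes "norm W = 1" "0 < l" "l < 1"
  shows "norm (1 - W) \<le> 2 * norm (1 - complex_of_real l * W)"
proof -
  have "1 - l \<le> norm (1 - complex_of_real l * W)"
    using norm_triangle_ineq2[of 1 "complex_of_real l * W"] assms by (simp add: norm_mult)
  moreover have "norm (1 - W) \<le> norm (1 - complex_of_real l * W) + norm ((complex_of_real l - 1) * W)"
    using norm_triangle_ineq[of "1 - complex_of_real l * W" "(complex_of_real l - 1) * W"]
    by (simp add: algebra_simps)
  moreover have "norm ((complex_of_real l - 1) * W) = 1 - l"
    using assms by (metis abs_minus_commute abs_of_pos diff_gt_0_iff_gt mult.right_neutral norm_mult norm_of_real of_real_1 of_real_diff)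
  ultimately show ?thesis by linarith
qed

text \<open>Each end of the geometric sum is paired with the tail beyond it. The boundary term of
  size \<open>1 / norm (1 - W)\<close> then shrinks by the factor
  \<open>(1 - l) / norm (1 - l * W)\<close>, so the kernel decays quadratically in the spacing and
  the off-diagonal sum produces no logarithm.\<close>

lemma norm_tail_kernel_le:
  assumes W: "norm W = 1" "W \<noteq> 1" and l: "0 < l" "l < 1"
  shows "norm (tail_kernel N l W) \<le> 4 * (1 - l) / (norm (1 - W))\<^sup>2"
proof -
  have W0: "W \<noteq> 0" using W by auto
  have cW: "cnj W = 1 / W" using W by (metis complex_norm_square divide_eq_eq mult.commute norm_zero of_real_1 power_one zero_neq_one)
  have p: "norm (1 - W) > 0" using W by simp
  have n1: "norm (1 - W) \<le> 2 * norm (1 - complex_of_real l * W)"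
    using norm_one_minus_mult_ge W l by blast
  have n2: "norm (1 - W) \<le> 2 * norm (1 - complex_of_real l * cnj W)"
    using norm_one_minus_mult_ge[of "cnj W" l] W l by (metis complex_cnj_diff complex_cnj_one complex_mod_cnj)
  have q1: "1 - complex_of_real l * W \<noteq> 0" using n1 p by auto
  have q2: "1 - complex_of_real l * cnj W \<noteq> 0" using n2 p by auto
  have g: "(\<Sum>n=1..N. W ^ n) = (W - W ^ Suc N) / (1 - W)"
  proof (cases "N = 0")
    case False
    then show ?thesis using sum_gp[of W 1 N] W by auto
  qed simp
  have w1: "1 - W \<noteq> 0" using W by simp
  have "tail_kernel N l W = - (W ^ Suc N * (1 - l)) / ((1 - W) * (1 - l * W)) + W * (1 - l) / ((1 - W) * (1 - l * cnj W))"
  proof -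
    have A: "- (W ^ Suc N) / (1 - W) + W ^ N * (l * W / (1 - l * W)) = - (W ^ Suc N * (1 - l)) / ((1 - W) * (1 - l * W))"
      using w1 q1 by (simp add: divide_simps) (simp add: algebra_simps)
    have B: "W / (1 - W) + W * (l * cnj W / (1 - l * cnj W)) = W * (1 - l) / ((1 - W) * (1 - l * cnj W))"
    proof -
      have "W * (l * cnj W) = l" using cW W0 by simp
      then show ?thesis using w1 q2 W0
        by (simp add: divide_simps) (simp add: algebra_simps)
    qed
    have "tail_kernel N l W = (- (W ^ Suc N) / (1 - W) + W ^ N * (l * W / (1 - l * W))) + (W / (1 - W) + W * (l * cnj W / (1 - l * cnj W)))"
      unfolding tail_kernel_def g by (simp add: diff_divide_distrib)
    then show ?thesis using A B by simp
  qed
  also have "norm \<dots> \<le> norm (- (W ^ Suc N * complex_of_real (1 - l)) / ((1 - W) * (1 - l * W))) + norm (W * complex_of_real (1 - l) / ((1 - W) * (1 - l * cnj W)))"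
    by (rule norm_triangle_ineq)
  also have "\<dots> = (1 - l) / (norm (1 - W) * norm (1 - l * W)) + (1 - l) / (norm (1 - W) * norm (1 - l * cnj W))"
  proof -
    have "norm (complex_of_real (1 - l)) = 1 - l" using l by (simp only: norm_of_real)
    then show ?thesis using W by (simp only: norm_mult norm_divide norm_power norm_minus_cancel) simp
  qed
  also have "\<dots> \<le> (1 - l) / (norm (1 - W) * (norm (1 - W) / 2)) + (1 - l) / (norm (1 - W) * (norm (1 - W) / 2))"
    using n1 n2 p l q1 q2 by (intro add_mono divide_left_mono mult_left_mono) (auto intro!: mult_pos_pos)
  also have "\<dots> = 4 * (1 - l) / (norm (1 - W))\<^sup>2" by (simp add: power2_eq_square field_simps)
  finally show ?thesis .
qed

section \<open>Spacing of Farey fractions modulo 1\<close>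

lemma sin_ge_linear:
  assumes "0 \<le> x" "x \<le> pi / 2"
  shows "sin x \<ge> 2 / pi * x"
proof -
  have "convex_on {0..pi/2} (\<lambda>x. - sin x)"
  proof (rule convex_on_realI[where f' = "\<lambda>x. - cos x"])
    show "((\<lambda>x. - sin x) has_real_derivative - cos x) (at x)" for x :: real
      by (auto intro!: derivative_eq_intros)
    show "- cos x \<le> - cos y" if "x \<in> {0..pi/2}" "y \<in> {0..pi/2}" "x \<le> y" for x y
      using that by (simp add: cos_mono_le_eq)
  qed auto
  from convex_onD_Icc'[OF this, of x] assms show ?thesis by (simp add: field_simps)
qed

lemma norm_one_minus_cis_ge:
  fixes \<theta> :: real and k :: int
  assumes "\<bar>\<theta> - k\<bar> \<le> 1/2"
  shows "norm (1 - cis (2 * pi * \<theta>)) \<ge> 4 * \<bar>\<theta> - k\<bar>"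
proof -
  define t where "t = \<bar>\<theta> - k\<bar>"
  have "cis (2 * pi * \<theta>) = cis (2 * pi * (\<theta> - k)) * cis (2 * pi * k)"
    by (simp add: cis_mult algebra_simps)
  then have e: "cis (2 * pi * \<theta>) = cis (2 * pi * (\<theta> - k))" by (simp add: cis_multiple_2pi)
  have "(norm (1 - cis (2 * pi * \<theta>)))\<^sup>2 = (2 * sin (pi * (\<theta> - k)))\<^sup>2"
  proof -
    have "(norm (1 - cis (2 * y)))\<^sup>2 = (2 * sin y)\<^sup>2" for y :: real
    proof -
      have "(norm (1 - cis (2 * y)))\<^sup>2 = 2 - 2 * cos (2 * y)"
        unfolding cmod_power2 using sin_cos_squared_add[of "2 * y"]
        by (simp add: power2_eq_square algebra_simps)
      then show ?thesis unfolding cos_double_sin by (simp add: power_mult_distrib)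
    qed
    from this[of "pi * (\<theta> - k)"] show ?thesis unfolding e by (simp add: mult_ac)
  qed
  then have "norm (1 - cis (2 * pi * \<theta>)) = \<bar>2 * sin (pi * (\<theta> - k))\<bar>"
    by (metis abs_norm_cancel power2_abs real_sqrt_abs)
  also have "\<dots> = 2 * \<bar>sin (pi * t)\<bar>"
  proof (cases "0 \<le> \<theta> - k")
    case False
    then have "sin (pi * t) = - sin (pi * (\<theta> - k))" unfolding t_def
      by (metis abs_of_neg mult_minus_right not_le sin_minus)
    then show ?thesis by (simp add: abs_mult)
  qed (simp add: t_def abs_mult)
  also have "\<dots> \<ge> 2 * (2 / pi * (pi * t))"
  proof -
    have "sin (pi * t) \<ge> 2 / pi * (pi * t)" by (rule sin_ge_linear) (use assms in \<open>auto simp: t_def\<close>)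
    then show ?thesis by linarith
  qed
  finally show ?thesis unfolding t_def by simp
qed

lemma sum_inverse_squares_nat_le: "(\<Sum>n=1..B. 1 / (real n)\<^sup>2) \<le> 2"
proof -
  have "(\<Sum>n=1..Suc B. 1 / (real n)\<^sup>2) \<le> 2 - 1 / Suc B" for B
  proof (induction B)
    case (Suc B)
    have "1 / (real (Suc (Suc B)))\<^sup>2 \<le> 1 / (real (Suc B) * real (Suc (Suc B)))"
      unfolding power2_eq_square by (intro divide_left_mono mult_right_mono) auto
    also have "\<dots> = 1 / Suc B - 1 / Suc (Suc B)" by (simp add: field_simps)
    finally have "1 / (real (Suc (Suc B)))\<^sup>2 \<le> 1 / Suc B - 1 / Suc (Suc B)" .
    then show ?case using Suc by simp
  qed simp
  from this[of "B - 1"] show ?thesis by (cases B) (auto intro: order_trans)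
qed

lemma sum_inverse_squares_int_le:
  fixes M :: "int set"
  assumes "finite M" "0 \<notin> M"
  shows "(\<Sum>m\<in>M. 1 / (real_of_int m)\<^sup>2) \<le> 4"
proof -
  obtain B :: nat where B: "\<And>m. m \<in> M \<Longrightarrow> \<bar>m\<bar> \<le> int B"
  proof -
    have "finite ((\<lambda>m. nat \<bar>m\<bar>) ` M)" using assms by simp
    then obtain B where "\<forall>x\<in>(\<lambda>m. nat \<bar>m\<bar>) ` M. x \<le> B" using finite_nat_set_iff_bounded_le by blast
    then have "\<bar>m\<bar> \<le> int B" if "m \<in> M" for m using that by fastforce
    then show ?thesis using that by blast
  qed
  have "M \<subseteq> int ` {1..B} \<union> (\<lambda>n. - int n) ` {1..B}"
  proof
    fix m assume m: "m \<in> M"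
    then have "m \<noteq> 0" using assms by metis
    then show "m \<in> int ` {1..B} \<union> (\<lambda>n. - int n) ` {1..B}"
      using B[OF m] by (cases "m > 0") (auto simp: image_iff intro!: bexI[of _ "nat \<bar>m\<bar>"])
  qed
  then have "(\<Sum>m\<in>M. 1 / (real_of_int m)\<^sup>2) \<le> (\<Sum>m\<in>int ` {1..B} \<union> (\<lambda>n. - int n) ` {1..B}. 1 / (real_of_int m)\<^sup>2)"
    by (intro sum_mono2) auto
  also have "\<dots> = (\<Sum>m\<in>int ` {1..B}. 1 / (real_of_int m)\<^sup>2) + (\<Sum>m\<in>(\<lambda>n. - int n) ` {1..B}. 1 / (real_of_int m)\<^sup>2)"
    by (intro sum.union_disjoint) auto
  also have "\<dots> = (\<Sum>n=1..B. 1 / (real n)\<^sup>2) + (\<Sum>n=1..B. 1 / (real n)\<^sup>2)"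
    by (subst (1 2) sum.reindex) (auto simp: inj_on_def)
  also have "\<dots> \<le> 4" using sum_inverse_squares_nat_le[of B] by linarith
  finally show ?thesis .
qed

definition farey :: "real \<Rightarrow> (nat \<times> nat) set" where
  "farey Z = {(a, q). 0 < q \<and> real q \<le> Z \<and> a < q \<and> coprime a q}"

lemma farey_eq_Sigma: "farey Z = prod.swap ` (SIGMA q:{q. 0 < q \<and> real q \<le> Z}. {a. a < q \<and> coprime a q})"
  by (force simp: farey_def)

lemma finite_nat_real_le: "finite {q::nat. 0 < q \<and> real q \<le> Z}"
  by (rule finite_subset[of _ "{..nat \<lfloor>Z\<rfloor>}"]) (auto simp: le_nat_floor)

lemma finite_farey: "finite (farey Z)"
  unfolding farey_eq_Sigma by (intro finite_imageI finite_SigmaI finite_nat_real_le) auto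

lemma sum_farey: "(\<Sum>(a, q)\<in>farey Z. f a q) = (\<Sum>q\<in>{q. 0 < q \<and> real q \<le> Z}. \<Sum>a\<in>{a. a < q \<and> coprime a q}. f a q)"
proof -
  have "(\<Sum>(a, q)\<in>farey Z. f a q) = (\<Sum>(q, a)\<in>(SIGMA q:{q. 0 < q \<and> real q \<le> Z}. {a. a < q \<and> coprime a q}). f a q)"
    unfolding farey_eq_Sigma by (subst sum.reindex) (auto intro!: sum.cong)
  then show ?thesis by (subst sum.Sigma) (auto simp: finite_nat_real_le)
qed

text \<open>The hypothesis says that the two fractions differ by the integer \<open>k\<close>; both
  lie in \<open>[0, 1)\<close>, so \<open>k = 0\<close>, and reduced fractions with equal values
  coincide. Hence the numerators summed below never vanish for distinct fractions.\<close>

lemma farey_cross_eq: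
  assumes "(a, q) \<in> farey Z" "(a', q') \<in> farey Z" "int a * int q' - int a' * int q = k * int q * int q'"
  shows "(a', q') = (a, q)"
proof -
  have b: "a < q" "a' < q'" "coprime a q" "coprime a' q'" "0 < q" "0 < q'" using assms by (auto simp: farey_def)
  have "int a * int q' < int q * int q'" "int a' * int q < int q * int q'"
    using b by (auto simp: mult.commute intro: mult_strict_right_mono)
  then have "\<bar>k * (int q * int q')\<bar> < int q * int q'" using assms(3)
    by (smt (verit, best) mult.assoc of_nat_0_le_iff mult_nonneg_nonneg)
  then have "k = 0" using b  by (simp add: abs_mult)
  then have "int a * int q' = int a' * int q" using assms(3) by simp
  then have e: "a * q' = a' * q" by (metis of_nat_eq_iff of_nat_mult)
  have "q dvd q'" using e b by (metis coprime_commute coprime_dvd_mult_right_iff dvd_triv_right)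
  moreover have "q' dvd q" using e b by (metis coprime_commute coprime_dvd_mult_right_iff dvd_triv_right)
  ultimately have "q = q'" by (rule dvd_antisym)
  then show ?thesis using e b by simp
qed

text \<open>Modulo \<open>q\<close> the numerator \<open>m (a', q')\<close> is
  \<open>a * q'\<close>, and \<open>a\<close> is invertible, so \<open>m\<close> fixes
  \<open>q' mod q\<close>. Together with \<open>q' div q\<close> it fixes \<open>q'\<close>, and
  then \<open>a'\<close> modulo \<open>q'\<close>. Each nonzero integer therefore occurs at most
  \<open>Z / q + 1\<close> times among the numerators, whatever \<open>k\<close> is.\<close>

lemma sum_inverse_square_farey_le:
  fixes k :: "nat \<times> nat \<Rightarrow> int" and a q :: nat
  defines "m \<equiv> \<lambda>(a', q'). int a * int q' - int a' * int q - k (a', q') * int q * int q'"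
  assumes aq: "(a, q) \<in> farey Z"
  shows "(\<Sum>s\<in>farey Z - {(a, q)}. 1 / (real_of_int (m s))\<^sup>2) \<le> 4 * (Z / q + 1)"
proof -
  let ?R = "farey Z - {(a, q)}"
  let ?g = "\<lambda>s. (m s, snd s div q)"
  have q: "0 < q" "coprime a q" using aq by (auto simp: farey_def)
  have fin: "finite ?R" using finite_farey by blast
  have m0: "0 \<notin> m ` ?R"
  proof
    assume "0 \<in> m ` ?R"
    then obtain s where s: "s \<in> ?R" "m s = 0" by (metis imageE)
    obtain a' q' where "s = (a', q')" by fastforce
    with s show False using farey_cross_eq[OF aq, of a' q' "k (a', q')"] by (auto simp: m_def)
  qed
  have inj: "inj_on ?g ?R"
  proof (rule inj_onI)
    fix s t assume st: "s \<in> ?R" "t \<in> ?R" "?g s = ?g t"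
    obtain a1 q1 where s: "s = (a1, q1)" by fastforce
    obtain a2 q2 where t: "t = (a2, q2)" by fastforce
    have e: "int a * int q1 - int a1 * int q - k s * int q * int q1 = int a * int q2 - int a2 * int q - k t * int q * int q2"
      using st(3) by (simp add: s t m_def)
    then have "int a * (int q1 - int q2) = int q * (int a1 + k s * int q1 - int a2 - k t * int q2)"
      by (simp add: algebra_simps)
    then have "int q dvd int a * (int q1 - int q2)" by simp
    then have "int q dvd int q1 - int q2"
      using q by (simp add: coprime_dvd_mult_right_iff coprime_commute)
    then have "q1 mod q = q2 mod q"
      by (metis mod_eq_dvd_iff of_nat_eq_iff of_nat_mod)
    moreover have "q1 div q = q2 div q" using st(3) by (simp add: s t)
    ultimately have qq: "q1 = q2" by (metis div_mult_mod_eq)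
    then have "int q * (int a1 - int a2) = int q * (int q1 * (k t - k s))" using e by (simp add: algebra_simps)
    then have "int a1 - int a2 = int q1 * (k t - k s)" using q by simp
    then have "int a1 mod int q1 = int a2 mod int q1" by (simp add: mod_eq_dvd_iff)
    then have "a1 = a2" using st(1,2) qq by (auto simp: s t farey_def)
    then show "s = t" using qq by (simp add: s t)
  qed
  have sub: "?g ` ?R \<subseteq> m ` ?R \<times> {..nat \<lfloor>Z / q\<rfloor>}"
  proof -
    have "real (q' div q) \<le> Z / q" if "(a', q') \<in> farey Z" for a' q'
    proof -
      have "real (q' div q) \<le> real q' / q" by (rule of_nat_div_le_of_nat)
      also have "\<dots> \<le> Z / q" using that by (auto simp: farey_def divide_right_mono)
      finally show ?thesis .
    qed
    then show ?thesis by (auto simp: le_nat_floor)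
  qed
  have Z: "Z / q \<ge> 0" using aq by (auto simp: farey_def)
  have "(\<Sum>s\<in>?R. 1 / (real_of_int (m s))\<^sup>2) = (\<Sum>(x, j)\<in>?g ` ?R. 1 / (real_of_int x)\<^sup>2)"
    by (subst sum.reindex[OF inj]) simp
  also have "\<dots> \<le> (\<Sum>(x, j)\<in>m ` ?R \<times> {..nat \<lfloor>Z / q\<rfloor>}. 1 / (real_of_int x)\<^sup>2)"
    using fin sub by (intro sum_mono2) auto
  also have "\<dots> = (\<Sum>x\<in>m ` ?R. \<Sum>j\<in>{..nat \<lfloor>Z / q\<rfloor>}. 1 / (real_of_int x)\<^sup>2)"
    by (rule sum.cartesian_product[symmetric])
  also have "\<dots> = (real (nat \<lfloor>Z / q\<rfloor>) + 1) * (\<Sum>x\<in>m ` ?R. 1 / (real_of_int x)\<^sup>2)"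
    by (simp add: sum_distrib_left algebra_simps)
  also have "\<dots> \<le> (Z / q + 1) * 4"
    using Z m0 fin by (intro mult_mono sum_inverse_squares_int_le sum_nonneg) auto
  finally show ?thesis by (simp add: mult.commute)
qed

lemma one_minus_exp_le: "1 - exp (- x) \<le> (x::real)"
  using exp_ge_add_one_self[of "- x"] by simp

text \<open>Dual form of the weighted large sieve of Montgomery and Vaughan (with a larger constant): the frequency
  \<open>a / q\<close> is continued with weight \<open>exp (-u / (2 q Z))\<close> at distance \<open>u\<close> outside the summation range.\<close>

lemma weighted_large_sieve:
  fixes b :: "nat \<times> nat \<Rightarrow> complex"
  shows "(\<Sum>n=1..N. (norm (\<Sum>(a, q)\<in>farey Z. b (a, q) * cis (2 * pi * (a / q)) ^ n))\<^sup>2)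
     \<le> (\<Sum>(a, q)\<in>farey Z. (norm (b (a, q)))\<^sup>2 * (N + 4 * real q * Z))"
proof -
  let ?R = "farey Z"
  define w where "w = (\<lambda>(a::nat, q::nat). cis (2 * pi * (a / q)))"
  \<comment> \<open>This decay length is the one that gives
    \<open>1 - l r * l s <= 1 / (Q r * Q s)\<close> as long as both denominators are at most
    \<open>Z\<close>. The diagonal then costs \<open>2 q Z\<close>, and the off-diagonal terms
    another \<open>2 q Z\<close>.\<close>
  define H where "H = (\<lambda>r::nat \<times> nat. 2 * real (snd r) * Z)"
  define l where "l = (\<lambda>r. exp (- (1 / H r)))"
  define Q where "Q = (\<lambda>r::nat \<times> nat. real (snd r))"
  define W where "W = (\<lambda>r s. w r * cnj (w s))"
  have QZ: "0 < Q r" "Q r \<le> Z" if "r \<in> ?R" for r using that by (auto simp: farey_def Q_def)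
  have H0: "0 < H r" if "r \<in> ?R" for r using QZ[OF that] by (auto simp: H_def Q_def)
  have nw: "norm (w r) = 1" for r by (auto simp: w_def split: prod.split)
  have nW: "norm (W r s) = 1" for r s by (simp add: W_def norm_mult nw)
  have W_cis: "W (a, q) (a', q') = cis (2 * pi * (a / q - a' / q'))" for a q a' q' :: nat
    by (simp add: W_def w_def cis_cnj cis_mult algebra_simps)
  \<comment> \<open>With \<open>k\<close> the integer nearest to \<open>a / q - a' / q'\<close>, the
    distance to that integer is the absolute numerator over \<open>q q'\<close>, and the chord on
    the unit circle is at least 4 times this distance.\<close>
  have gap: "\<exists>k. \<forall>s\<in>?R - {r}. norm (1 - W r s) \<ge> 4 * \<bar>real_of_int ((\<lambda>(a', q'). int (fst r) * int q' - int a' * int (snd r) - k (a', q') * int (snd r) * int q') s)\<bar> / (Q r * Q s)"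
    if r: "r \<in> ?R" for r
  proof -
    obtain a q where rr: "r = (a, q)" by fastforce
    let ?k = "\<lambda>(a'::nat, q'::nat). round (real a / q - real a' / q')"
    have "norm (1 - W r s) \<ge> 4 * \<bar>real_of_int ((\<lambda>(a', q'). int (fst r) * int q' - int a' * int (snd r) - ?k (a', q') * int (snd r) * int q') s)\<bar> / (Q r * Q s)"
      if s: "s \<in> ?R" for s
    proof -
      obtain a' q' where ss: "s = (a', q')" by fastforce
      let ?t = "real a / q - real a' / q'"
      have pos: "0 < q" "0 < q'" using r s by (auto simp: rr ss farey_def)
      have "norm (1 - W r s) \<ge> 4 * \<bar>?t - round ?t\<bar>"
        unfolding rr ss W_cis by (rule norm_one_minus_cis_ge) (use of_int_round_abs_le[of ?t] in \<open>simp add: abs_minus_commute\<close>)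
      also have "?t - round ?t = (real a * q' - real a' * q - round ?t * real q * real q') / (real q * q')"
        using pos by (simp add: field_simps)
      finally show ?thesis using pos by (simp add: rr ss Q_def abs_mult)
    qed
    then show ?thesis by (intro exI[of _ ?k] ballI) blast
  qed
  have W1: "W r s \<noteq> 1" if W1_asms: "r \<in> ?R" "s \<in> ?R" "r \<noteq> s" for r s
  proof
    assume "W r s = 1"
    obtain k where "\<forall>s\<in>?R - {r}. norm (1 - W r s) \<ge> 4 * \<bar>real_of_int ((\<lambda>(a', q'). int (fst r) * int q' - int a' * int (snd r) - k (a', q') * int (snd r) * int q') s)\<bar> / (Q r * Q s)"
      using gap[OF W1_asms(1)] by blast
    then have "4 * \<bar>real_of_int ((\<lambda>(a', q'). int (fst r) * int q' - int a' * int (snd r) - k (a', q') * int (snd r) * int q') s)\<bar> / (Q r * Q s) \<le> 0"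
      using that \<open>W r s = 1\<close> by force
    then have "(\<lambda>(a', q'). int (fst r) * int q' - int a' * int (snd r) - k (a', q') * int (snd r) * int q') s = 0"
      using mult_pos_pos[OF QZ(1)[OF that(1)] QZ(1)[OF that(2)]] by (simp add: divide_le_0_iff del: of_int_mult)
    then show False using that farey_cross_eq[of "fst r" "snd r" Z "fst s" "snd s" "k s"]
      by (auto simp: split_beta)
  qed
  \<comment> \<open>\<open>T\<close> is symmetric. After \<open>2 x y <= x^2 + y^2\<close> the two
    halves of the off-diagonal sum agree, and only the row sums of \<open>T\<close> matter; the
    squares of the denominators in \<open>T\<close> cancel those in the spacing, leaving
    \<open>1 / (16 m^2)\<close>.\<close>
  define T where "T = (\<lambda>r s. 1 / ((norm (1 - W r s))\<^sup>2 * (Q r)\<^sup>2 * (Q s)\<^sup>2))"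
  have T_sym: "T r s = T s r" for r s
  proof -
    have "W s r = cnj (W r s)" by (simp add: W_def mult.commute)
    then have "norm (1 - W s r) = norm (1 - W r s)" by (metis complex_cnj_diff complex_cnj_one complex_mod_cnj)
    then show ?thesis by (simp add: T_def mult_ac)
  qed
  have T_sum: "(\<Sum>s\<in>?R - {r}. T r s) \<le> Z / (2 * Q r)" if r: "r \<in> ?R" for r
  proof -
    obtain k where k: "\<forall>s\<in>?R - {r}. norm (1 - W r s) \<ge> 4 * \<bar>real_of_int ((\<lambda>(a', q'). int (fst r) * int q' - int a' * int (snd r) - k (a', q') * int (snd r) * int q') s)\<bar> / (Q r * Q s)"
      using gap[OF r] by blast
    define m where "m = (\<lambda>(a', q'). int (fst r) * int q' - int a' * int (snd r) - k (a', q') * int (snd r) * int q')"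
    have "T r s \<le> 1 / 16 * (1 / (real_of_int (m s))\<^sup>2)" if s: "s \<in> ?R - {r}" for s
    proof -
      have m0: "m s \<noteq> 0"
        using s r farey_cross_eq[of "fst r" "snd r" Z "fst s" "snd s" "k s"] by (auto simp: split_beta m_def)
      have "4 * \<bar>real_of_int (m s)\<bar> / (Q r * Q s) \<le> norm (1 - W r s)" using k s by (simp add: m_def)
      then have "4 * \<bar>real_of_int (m s)\<bar> \<le> norm (1 - W r s) * Q r * Q s"
        using QZ(1)[OF r] QZ(1)[of s] s by (simp add: field_simps)
      then have "(4 * \<bar>real_of_int (m s)\<bar>)\<^sup>2 \<le> (norm (1 - W r s) * Q r * Q s)\<^sup>2"
        by (intro power_mono) auto
      then have "16 * (real_of_int (m s))\<^sup>2 \<le> (norm (1 - W r s))\<^sup>2 * (Q r)\<^sup>2 * (Q s)\<^sup>2"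
        by (simp add: power_mult_distrib)
      then have "T r s \<le> 1 / (16 * (real_of_int (m s))\<^sup>2)"
        unfolding T_def using m0 by (intro divide_left_mono mult_pos_pos) (auto intro: less_le_trans[rotated])
      then show ?thesis by simp
    qed
    then have "(\<Sum>s\<in>?R - {r}. T r s) \<le> (\<Sum>s\<in>?R - {r}. 1 / 16 * (1 / (real_of_int (m s))\<^sup>2))"
      by (rule sum_mono)
    also have "\<dots> = 1 / 16 * (\<Sum>s\<in>?R - {r}. 1 / (real_of_int (m s))\<^sup>2)" by (rule sum_distrib_left[symmetric])
    also have "\<dots> \<le> 1 / 16 * (4 * (Z / Q r + 1))"
      using sum_inverse_square_farey_le[of "fst r" "snd r" Z k] r by (simp add: m_def Q_def)
    also have "\<dots> \<le> Z / (2 * Q r)" using QZ[OF r] by (simp add: field_simps)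
    finally show ?thesis .
  qed
  define B where "B = (\<lambda>r. norm (b r))"
  have l01: "0 < l r \<and> l r < 1" if "r \<in> ?R" for r using H0[OF that] by (simp add: l_def)
  have fin: "finite ?R" by (rule finite_farey)
  have diag: "Re (b r * cnj (b r) * tail_kernel N (l r * l r) (W r r)) \<le> (B r)\<^sup>2 * (N + H r)" if r: "r \<in> ?R" for r
  proof -
    have Wr: "W r r = 1" using nw[of r] by (simp add: W_def complex_norm_square[symmetric])
    have ll: "0 < l r * l r" "l r * l r < 1" using l01[OF r] mult_strict_mono[of "l r" 1 "l r" 1] by auto
    have e: "l r * l r = 1 / exp (2 / H r)" unfolding l_def by (simp add: exp_minus exp_add[symmetric] inverse_eq_divide field_simps flip: exp_add)
    \<comment> \<open>The two tails contribute \<open>2 / (exp (2 / H r) - 1)\<close> to the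
      diagonal, hence at most \<open>H r\<close>.\<close>
    have "exp (2 / H r) \<ge> 1 + 2 / H r" by (rule exp_ge_add_one_self)
    then have "2 * (l r * l r) / (1 - l r * l r) \<le> H r"
      using H0[OF r] ll unfolding e by (simp add: field_simps)
    moreover have "b r * cnj (b r) = complex_of_real ((B r)\<^sup>2)" unfolding B_def complex_norm_square ..
    ultimately show ?thesis using Re_tail_kernel_diag[OF ll, of N]
      by (simp add: Wr mult_left_mono del: of_real_power)
  qed
  have off: "Re (b r * cnj (b s) * tail_kernel N (l r * l s) (W r s)) \<le> 2 * ((Q r)\<^sup>2 * (B r)\<^sup>2 + (Q s)\<^sup>2 * (B s)\<^sup>2) * T r s"
    if r: "r \<in> ?R" and s: "s \<in> ?R" and ne: "r \<noteq> s" for r s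
  proof -
    have ll: "0 < l r * l s" "l r * l s < 1" using l01[OF r] l01[OF s] mult_strict_mono[of "l r" 1 "l s" 1] by auto
    have Qp: "0 < Q r" "0 < Q s" "Q r \<le> Z" "Q s \<le> Z" using QZ r s by auto
    have Wp: "norm (1 - W r s) > 0" using W1[OF r s ne] by simp
    have "1 - l r * l s \<le> 1 / H r + 1 / H s"
      using one_minus_exp_le[of "1 / H r + 1 / H s"] by (simp add: l_def exp_add[symmetric])
    also have "\<dots> = (Q r + Q s) / (2 * Z) / (Q r * Q s)" using Qp by (simp add: H_def Q_def field_simps)
    also have "\<dots> \<le> 1 / (Q r * Q s)" using Qp by (intro divide_right_mono) auto
    finally have l1: "1 - l r * l s \<le> 1 / (Q r * Q s)" .
    have "Re (b r * cnj (b s) * tail_kernel N (l r * l s) (W r s)) \<le> norm (b r * cnj (b s) * tail_kernel N (l r * l s) (W r s))"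
      by (rule complex_Re_le_cmod)
    also have "\<dots> = B r * B s * norm (tail_kernel N (l r * l s) (W r s))" by (simp add: norm_mult B_def)
    also have "\<dots> \<le> B r * B s * (4 * (1 - l r * l s) / (norm (1 - W r s))\<^sup>2)"
      using norm_tail_kernel_le[OF nW W1[OF r s ne] ll] by (intro mult_left_mono) (auto simp: B_def)
    also have "\<dots> \<le> B r * B s * (4 * (1 / (Q r * Q s)) / (norm (1 - W r s))\<^sup>2)"
      using l1 by (intro mult_left_mono divide_right_mono) (auto simp: B_def)
    also have "\<dots> = 2 * (2 * (Q r * B r) * (Q s * B s)) * T r s"
      using Qp Wp by (simp add: T_def field_simps power2_eq_square)
    also have "\<dots> \<le> 2 * ((Q r * B r)\<^sup>2 + (Q s * B s)\<^sup>2) * T r s"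
      using sum_squares_bound[of "Q r * B r" "Q s * B s"] by (intro mult_right_mono mult_left_mono) (auto simp: T_def)
    finally show ?thesis by (simp add: power_mult_distrib)
  qed
  have "(\<Sum>n=1..N. (norm (\<Sum>r\<in>?R. b r * w r ^ n))\<^sup>2)
     \<le> Re (\<Sum>r\<in>?R. \<Sum>s\<in>?R. b r * cnj (b s) * tail_kernel N (l r * l s) (w r * cnj (w s)))"
    by (rule sum_norm_square_le_tail_kernel[OF fin nw l01])
  also have "\<dots> = (\<Sum>r\<in>?R. \<Sum>s\<in>?R. Re (b r * cnj (b s) * tail_kernel N (l r * l s) (W r s)))"
    unfolding W_def Re_sum ..
  also have "\<dots> = (\<Sum>r\<in>?R. Re (b r * cnj (b r) * tail_kernel N (l r * l r) (W r r))
       + (\<Sum>s\<in>?R - {r}. Re (b r * cnj (b s) * tail_kernel N (l r * l s) (W r s))))"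
    using fin by (intro sum.cong refl sum.remove) auto
  also have "\<dots> \<le> (\<Sum>r\<in>?R. (B r)\<^sup>2 * (N + H r) + (\<Sum>s\<in>?R - {r}. 2 * ((Q r)\<^sup>2 * (B r)\<^sup>2 + (Q s)\<^sup>2 * (B s)\<^sup>2) * T r s))"
    by (intro sum_mono add_mono diag off) auto
  also have "\<dots> = (\<Sum>r\<in>?R. (B r)\<^sup>2 * (N + H r)) + (\<Sum>r\<in>?R. \<Sum>s\<in>?R - {r}. 2 * ((Q r)\<^sup>2 * (B r)\<^sup>2) * T r s)
       + (\<Sum>r\<in>?R. \<Sum>s\<in>?R - {r}. 2 * ((Q s)\<^sup>2 * (B s)\<^sup>2) * T r s)"
    by (simp add: sum.distrib algebra_simps)
  also have "(\<Sum>r\<in>?R. \<Sum>s\<in>?R - {r}. 2 * ((Q s)\<^sup>2 * (B s)\<^sup>2) * T r s) = (\<Sum>s\<in>?R. \<Sum>r\<in>?R - {s}. 2 * ((Q s)\<^sup>2 * (B s)\<^sup>2) * T r s)"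
  proof -
    have "(\<Sum>r\<in>?R. \<Sum>s\<in>?R - {r}. f r s) = (\<Sum>s\<in>?R. \<Sum>r\<in>?R - {s}. f r s)" for f :: "_ \<Rightarrow> _ \<Rightarrow> real"
    proof -
      have "(\<Sum>r\<in>?R. \<Sum>s\<in>?R - {r}. f r s) = (\<Sum>r\<in>?R. \<Sum>s\<in>{s \<in> ?R. r \<noteq> s}. f r s)"
        by (intro sum.cong refl) auto
      also have "\<dots> = (\<Sum>s\<in>?R. \<Sum>r\<in>{r \<in> ?R. r \<noteq> s}. f r s)" by (rule sum.swap_restrict[OF fin fin])
      also have "\<dots> = (\<Sum>s\<in>?R. \<Sum>r\<in>?R - {s}. f r s)" by (intro sum.cong refl) auto
      finally show ?thesis .
    qed
    then show ?thesis .
  qed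
  also have "\<dots> = (\<Sum>r\<in>?R. \<Sum>s\<in>?R - {r}. 2 * ((Q r)\<^sup>2 * (B r)\<^sup>2) * T r s)"
    by (intro sum.cong refl) (simp add: T_sym)
  also have "(\<Sum>r\<in>?R. (B r)\<^sup>2 * (N + H r)) + (\<Sum>r\<in>?R. \<Sum>s\<in>?R - {r}. 2 * ((Q r)\<^sup>2 * (B r)\<^sup>2) * T r s)
       + (\<Sum>r\<in>?R. \<Sum>s\<in>?R - {r}. 2 * ((Q r)\<^sup>2 * (B r)\<^sup>2) * T r s)
     = (\<Sum>r\<in>?R. (B r)\<^sup>2 * (N + H r) + 4 * ((Q r)\<^sup>2 * (B r)\<^sup>2) * (\<Sum>s\<in>?R - {r}. T r s))"
    by (simp add: sum.distrib sum_distrib_left algebra_simps flip: sum.distrib)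
  also have "\<dots> \<le> (\<Sum>r\<in>?R. (B r)\<^sup>2 * (N + H r) + 4 * ((Q r)\<^sup>2 * (B r)\<^sup>2) * (Z / (2 * Q r)))"
    by (intro sum_mono add_left_mono mult_left_mono T_sum) auto
  also have "\<dots> = (\<Sum>r\<in>?R. (B r)\<^sup>2 * (N + 4 * Q r * Z))"
  proof (intro sum.cong refl)
    fix r assume "r \<in> ?R"
    then show "(B r)\<^sup>2 * (N + H r) + 4 * ((Q r)\<^sup>2 * (B r)\<^sup>2) * (Z / (2 * Q r)) = (B r)\<^sup>2 * (N + 4 * Q r * Z)"
      using QZ(1)[of r] by (simp add: H_def Q_def field_simps power2_eq_square)
  qed
  finally show ?thesis by (simp add: w_def B_def Q_def split_beta)
qed

section \<open>Sieving residue classes\<close>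

lemma cis_two_pi_eq_1_imp:
  assumes "cis (2 * pi * \<theta>) = 1"
  shows "\<theta> = of_int (round \<theta>)"
  using norm_one_minus_cis_ge[of \<theta> "round \<theta>"] of_int_round_abs_le[of \<theta>] assms
  by (simp add: abs_minus_commute)

section \<open>Fourier analysis on residues and the Chinese remainder theorem\<close>

lemma sum_roots_of_unity_orthogonal:
  fixes q n m :: nat
  assumes "n < q" "m < q"
  shows "(\<Sum>a<q. cis (2 * pi * (a / q)) ^ n * cnj (cis (2 * pi * (a / q)) ^ m)) = (if n = m then of_nat q else 0)"
proof -
  let ?x = "cis (2 * pi * ((real n - real m) / q))"
  have "cis (2 * pi * (a / q)) ^ n * cnj (cis (2 * pi * (a / q)) ^ m) = ?x ^ a" for a :: nat
    by (simp add: Complex.DeMoivre cis_cnj cis_mult algebra_simps diff_divide_distrib flip: complex_cnj_power)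
  then have *: "(\<Sum>a<q. cis (2 * pi * (a / q)) ^ n * cnj (cis (2 * pi * (a / q)) ^ m)) = (\<Sum>a<q. ?x ^ a)"
    by simp
  show ?thesis
  proof (cases "n = m")
    case False
    have "?x \<noteq> 1"
    proof
      assume "?x = 1"
      from cis_two_pi_eq_1_imp[OF this] obtain k :: int where "(real n - real m) / q = k" by blast
      then have "real n - real m = k * q" using assms by (simp add: field_simps)
      then have e: "int n - int m = k * int q" by (metis of_int_diff of_int_eq_iff of_int_mult of_int_of_nat_eq)
      have "\<bar>int n - int m\<bar> < int q" using assms by auto
      then have "\<bar>k\<bar> * int q < 1 * int q" using e by (simp add: abs_mult)
      then have "k = 0" using assms by (subst (asm) mult_less_cancel_right) auto
      then show False using e False by simp
    qed
    moreover have "?x ^ q = 1"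
    proof -
      have "?x ^ q = cis (2 * pi * of_int (int n - int m))"
        using assms by (simp add: Complex.DeMoivre)
      also have "\<dots> = 1" by (rule cis_multiple_2pi) simp
      finally show ?thesis .
    qed
    ultimately show ?thesis using * False by (simp add: geometric_sum)
  qed (use * in simp)
qed

definition dft :: "nat \<Rightarrow> (nat \<Rightarrow> real) \<Rightarrow> nat \<Rightarrow> complex" where
  "dft q f a = (\<Sum>m<q. f m * cnj (cis (2 * pi * (a / q)) ^ m)) / q"

lemma dft_inversion:
  assumes "n < q"
  shows "(\<Sum>a<q. dft q f a * cis (2 * pi * (a / q)) ^ n) = f n"
proof -
  have "(\<Sum>a<q. dft q f a * cis (2 * pi * (a / q)) ^ n)
      = (\<Sum>a<q. \<Sum>m<q. f m / q * (cis (2 * pi * (a / q)) ^ n * cnj (cis (2 * pi * (a / q)) ^ m)))"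
    unfolding dft_def sum_divide_distrib sum_distrib_right
    by (intro sum.cong refl) simp
  also have "\<dots> = (\<Sum>m<q. f m / q * (\<Sum>a<q. cis (2 * pi * (a / q)) ^ n * cnj (cis (2 * pi * (a / q)) ^ m)))"
    by (subst sum.swap) (simp add: sum_distrib_left)
  also have "\<dots> = (\<Sum>m<q. if m = n then complex_of_real (f n) else 0)"
  proof (intro sum.cong refl)
    fix m assume "m \<in> {..<q}"
    then have m: "m < q" by simp
    show "f m / q * (\<Sum>a<q. cis (2 * pi * (a / q)) ^ n * cnj (cis (2 * pi * (a / q)) ^ m)) = (if m = n then complex_of_real (f n) else 0)"
      unfolding sum_roots_of_unity_orthogonal[OF assms m] using m by auto
  qed
  finally show ?thesis using assms by (simp add: sum.delta)
qed

lemma dft_parseval: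
  assumes "q > 0"
  shows "(\<Sum>a<q. (norm (dft q f a))\<^sup>2) = (\<Sum>n<q. (f n)\<^sup>2) / q"
proof -
  let ?e = "\<lambda>(a::nat) (m::nat). cis (2 * pi * (a / q)) ^ m"
  have "complex_of_real (\<Sum>a<q. (norm (dft q f a))\<^sup>2) = (\<Sum>a<q. dft q f a * cnj (dft q f a))"
    unfolding of_real_sum complex_norm_square ..
  also have "\<dots> = (\<Sum>a<q. \<Sum>n<q. dft q f a * (of_real (f n / q) * ?e a n))"
  proof (intro sum.cong refl)
    fix a
    have "cnj (dft q f a) = (\<Sum>n<q. of_real (f n / q) * ?e a n)"
      unfolding dft_def by (simp add: sum_divide_distrib del: complex_cnj_power)
    then show "dft q f a * cnj (dft q f a) = (\<Sum>n<q. dft q f a * (of_real (f n / q) * ?e a n))"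
      by (simp only: sum_distrib_left)
  qed
  also have "\<dots> = (\<Sum>n<q. \<Sum>a<q. of_real (f n / q) * (dft q f a * ?e a n))"
    by (subst sum.swap) (simp add: mult_ac)
  also have "\<dots> = (\<Sum>n<q. of_real (f n / q) * of_real (f n))"
    by (intro sum.cong refl) (simp only: sum_distrib_left[symmetric] dft_inversion lessThan_iff)
  also have "\<dots> = complex_of_real ((\<Sum>n<q. (f n)\<^sup>2) / q)"
    by (simp add: sum_divide_distrib power2_eq_square)
  finally show ?thesis using of_real_eq_iff by blast
qed

lemma bij_betw_crt:
  fixes a b :: nat
  assumes "coprime a b" "a > 0" "b > 0"
  shows "bij_betw (\<lambda>n. (n mod a, n mod b)) {..<a * b} ({..<a} \<times> {..<b})"
proof -
  have inj: "inj_on (\<lambda>n. (n mod a, n mod b)) {..<a * b}"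
  proof (rule inj_onI)
    fix x y assume xy: "x \<in> {..<a * b}" "y \<in> {..<a * b}" "(x mod a, x mod b) = (y mod a, y mod b)"
    then have "[x = y] (mod a * b)" using assms(1) by (intro coprime_cong_mult_nat) (auto simp: cong_def)
    then show "x = y" using xy by (simp add: cong_def)
  qed
  moreover have "(\<lambda>n. (n mod a, n mod b)) ` {..<a * b} = {..<a} \<times> {..<b}"
    by (rule card_subset_eq) (use assms in \<open>auto simp: card_image[OF inj] card_cartesian_product\<close>)
  ultimately show ?thesis by (simp add: bij_betw_def)
qed

lemma sum_crt:
  fixes f g :: "nat \<Rightarrow> 'c::comm_semiring_1"
  assumes "coprime a b" "a > 0" "b > 0"
    and "\<And>n. f (n mod a) = f n" "\<And>n. g (n mod b) = g n"
  shows "(\<Sum>n<a * b. f n * g n) = (\<Sum>i<a. f i) * (\<Sum>j<b. g j)"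
proof -
  have "(\<Sum>n<a * b. f n * g n) = (\<Sum>n<a * b. (\<lambda>(i, j). f i * g j) (n mod a, n mod b))"
    using assms by simp
  also have "\<dots> = (\<Sum>(i, j)\<in>{..<a} \<times> {..<b}. f i * g j)"
    by (rule sum.reindex_bij_betw[OF bij_betw_crt]) (use assms in auto)
  finally show ?thesis by (simp add: sum_product sum.cartesian_product)
qed

section \<open>Test functions adapted to the forbidden residue classes\<close>

locale residue_sieve =
  fixes R :: "nat \<Rightarrow> nat set"
  assumes R_subset: "prime p \<Longrightarrow> R p \<subseteq> {..<p}"
    and card_R_less: "prime p \<Longrightarrow> card (R p) < p"
begin

definition h :: "nat \<Rightarrow> real" where
  "h q = (\<Prod>p\<in>prime_factors q. real (card (R p)) / (real p - real (card (R p))))"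

text \<open>For prime \<open>p\<close> this is, up to scaling, the indicator of the allowed classes
  minus its mean: \<open>h p\<close> is exactly the value that makes the sum over a period zero. On
  sifted integers \<open>psi q\<close> is the constant \<open>h q\<close>.\<close>

definition psi :: "nat \<Rightarrow> nat \<Rightarrow> real" where
  "psi q n = (\<Prod>p\<in>prime_factors q. if n mod p \<in> R p then - 1 else h p)"

lemma h_prime: "prime p \<Longrightarrow> h p = real (card (R p)) / (real p - real (card (R p)))"
  by (simp add: h_def prime_prime_factors)

lemma psi_prime: "prime p \<Longrightarrow> psi p n = (if n mod p \<in> R p then - 1 else h p)"
  by (simp add: psi_def prime_prime_factors)

lemma h_nonneg: "h q \<ge> 0"
  unfolding h_def using card_R_less by (intro prod_nonneg) (auto simp: in_prime_factors_iff less_imp_le)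

lemma prime_factors_mult_coprime:
  fixes a b :: nat
  assumes "coprime a b" "a > 0" "b > 0"
  shows "prime_factors (a * b) = prime_factors a \<union> prime_factors b" "prime_factors a \<inter> prime_factors b = {}"
proof -
  show "prime_factors (a * b) = prime_factors a \<union> prime_factors b"
    using assms by (intro prime_factors_product) auto
  show "prime_factors a \<inter> prime_factors b = {}"
    using assms by (auto simp: in_prime_factors_iff) (metis coprime_common_divisor not_prime_unit)
qed

lemma h_mult: "coprime a b \<Longrightarrow> a > 0 \<Longrightarrow> b > 0 \<Longrightarrow> h (a * b) = h a * h b"
  unfolding h_def by (simp add: prime_factors_mult_coprime prod.union_disjoint)

lemma psi_mult: "coprime a b \<Longrightarrow> a > 0 \<Longrightarrow> b > 0 \<Longrightarrow> psi (a * b) n = psi a n * psi b n"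
  unfolding psi_def by (simp add: prime_factors_mult_coprime prod.union_disjoint)

lemma psi_mod: "psi q (n mod q) = psi q n"
  unfolding psi_def by (intro prod.cong refl) (simp add: in_prime_factors_iff mod_mod_cancel)

lemma psi_eq_h: "(\<And>p. p \<in> prime_factors q \<Longrightarrow> n mod p \<notin> R p) \<Longrightarrow> psi q n = h q"
  unfolding psi_def h_def[of q] by (intro prod.cong refl) (simp add: h_prime in_prime_factors_iff)

lemma sum_indicator_prime:
  fixes x y :: real
  assumes p: "prime p"
  shows "(\<Sum>i<p. if i \<in> R p then x else y) = card (R p) * x + (real p - card (R p)) * y"
proof -
  have "(\<Sum>i<p. if i \<in> R p then x else y) = (\<Sum>i\<in>{..<p} \<inter> R p. x) + (\<Sum>i\<in>{..<p} \<inter> - R p. y)"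
    using sum.If_cases[of "{..<p}" "\<lambda>i. i \<in> R p" "\<lambda>_. x" "\<lambda>_. y"] by simp
  also have "{..<p} \<inter> R p = R p" using R_subset[OF p] by blast
  also have "card ({..<p} \<inter> - R p) = p - card (R p)"
    using R_subset[OF p] by (simp add: Diff_eq[symmetric] card_Diff_subset finite_subset)
  ultimately show ?thesis using card_R_less[OF p] by (simp add: of_nat_diff)
qed

lemma sum_psi_prime: "prime p \<Longrightarrow> (\<Sum>i<p. psi p i) = 0"
  using card_R_less[of p] by (simp add: psi_prime sum_indicator_prime h_prime)

lemma sum_psi_prime_square:
  assumes p: "prime p"
  shows "(\<Sum>i<p. (psi p i)\<^sup>2) = p * h p"
proof -
  have "(\<Sum>i<p. (psi p i)\<^sup>2) = (\<Sum>i<p. if i \<in> R p then 1 else (h p)\<^sup>2)"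
    using p by (intro sum.cong) (auto simp: psi_prime)
  also have "\<dots> = card (R p) + (real p - card (R p)) * (h p)\<^sup>2"
    using sum_indicator_prime[OF p] by simp
  also have "\<dots> = p * h p"
  proof -
    have "x + d * (x / d)\<^sup>2 = (x + d) * (x / d)" if "d > 0" for x d :: real
      using that by (simp add: power2_eq_square field_simps)
    from this[of "real p - card (R p)" "card (R p)"] show ?thesis
      using card_R_less[OF p] by (simp add: h_prime[OF p])
  qed
  finally show ?thesis .
qed

lemma sum_psi_square:
  assumes "squarefree q"
  shows "(\<Sum>n<q. (psi q n)\<^sup>2) = q * h q"
  using assms
proof (induction q rule: less_induct)
  case (less q)
  have q0: "q > 0" using less.prems by (intro gr0I) auto
  show ?case
  proof (cases "q = 1")
    case True then show ?thesis by (simp add: psi_def h_def)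
  next
    case False
    then obtain p where p: "prime p" "p dvd q" using prime_factor_nat by blast
    then obtain m where m: "q = p * m" by blast
    have m0: "m > 0" using q0 m by auto
    have cop: "coprime p m"
    proof (rule ccontr)
      assume "\<not> coprime p m"
      then have "p dvd m" using p prime_imp_coprime by blast
      then have "p ^ 2 dvd q" using m by (auto simp: power2_eq_square)
      then show False using less.prems p by (auto simp: squarefree_def)
    qed
    have sqm: "squarefree m" using less.prems m squarefree_multD by blast
    have "m < q" using m m0 prime_gt_1_nat[OF p(1)] by simp
    have "(\<Sum>n<q. (psi q n)\<^sup>2) = (\<Sum>n<p * m. (psi p n)\<^sup>2 * (psi m n)\<^sup>2)"
      using m cop m0 prime_gt_0_nat[OF p(1)] by (simp add: psi_mult power_mult_distrib)
    also have "\<dots> = (\<Sum>i<p. (psi p i)\<^sup>2) * (\<Sum>j<m. (psi m j)\<^sup>2)"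
      using cop m0 prime_gt_0_nat[OF p(1)] by (intro sum_crt) (auto simp: psi_mod)
    also have "\<dots> = q * h q"
      using less.IH[OF \<open>m < q\<close> sqm] cop m0 prime_gt_0_nat[OF p(1)] p
      by (simp add: m h_mult sum_psi_prime_square)
    finally show ?thesis .
  qed
qed

text \<open>If a prime \<open>p\<close> divides both \<open>a\<close> and \<open>q\<close>, the
  character of \<open>a / q\<close> has period \<open>q / p\<close>. The Chinese remainder theorem
  then splits off the factor \<open>\<Sum>i<p. psi p i = 0\<close>. So \<open>psi q\<close> only has
  frequencies that are reduced with denominator exactly \<open>q\<close>.\<close>

lemma dft_psi_eq_0:
  assumes q: "squarefree q" "\<not> coprime a q"
  shows "dft q (psi q) a = 0"
proof -
  have q0: "q > 0" using q by (intro gr0I) auto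
  have "gcd a q \<noteq> 1" using q(2) unfolding coprime_iff_gcd_eq_1 .
  from prime_factor_nat[OF this] obtain p where pp: "prime p" "p dvd gcd a q" by (elim exE conjE)
  have p: "prime p" "p dvd a" "p dvd q"
    using pp(1) dvd_trans[OF pp(2) gcd_dvd1] dvd_trans[OF pp(2) gcd_dvd2] by blast+
  obtain m where m: "q = p * m" using p(3) by (rule dvdE)
  obtain c where c: "a = p * c" using p(2) by (rule dvdE)
  have m0: "m > 0" using q0 m by auto
  have p0: "p > 0" using p prime_gt_0_nat by blast
  have cop: "coprime p m"
  proof (rule ccontr)
    assume "\<not> coprime p m"
    then have "p dvd m" using p prime_imp_coprime by blast
    then have "p ^ 2 dvd q" using m by (auto simp: power2_eq_square)
    then show False using q p by (auto simp: squarefree_def)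
  qed
  let ?g = "\<lambda>n. complex_of_real (psi m n) * cnj (cis (2 * pi * (c / m)) ^ n)"
  have per: "cis (2 * pi * (c / m)) ^ (n mod m) = cis (2 * pi * (c / m)) ^ n" for n
  proof -
    have "cis (2 * pi * (c / m)) ^ m = cis (2 * pi * of_nat c)" using m0 by (simp add: Complex.DeMoivre)
    also have "\<dots> = 1" by (rule cis_multiple_2pi) simp
    finally have 1: "cis (2 * pi * (c / m)) ^ m = 1" .
    have "cis (2 * pi * (c / m)) ^ (m * (n div m) + n mod m) = cis (2 * pi * (c / m)) ^ (n mod m)"
      unfolding power_add power_mult 1 by simp
    then show ?thesis unfolding mult_div_mod_eq by (rule sym)
  qed
  have "(\<Sum>n<q. psi q n * cnj (cis (2 * pi * (a / q)) ^ n)) = (\<Sum>n<p * m. complex_of_real (psi p n) * ?g n)"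
  proof (intro sum.cong)
    have "real a / real q = real c / real m" using m0 p0 by (simp add: m c)
    then show "psi q n * cnj (cis (2 * pi * (a / q)) ^ n) = complex_of_real (psi p n) * ?g n" for n
      unfolding m psi_mult[OF cop p0 m0] by simp
  qed (simp add: m)
  also have "\<dots> = (\<Sum>i<p. complex_of_real (psi p i)) * (\<Sum>j<m. ?g j)"
    using cop m0 p0 by (intro sum_crt) (simp_all only: psi_mod per)
  also have "(\<Sum>i<p. complex_of_real (psi p i)) = 0"
    unfolding of_real_sum[symmetric] sum_psi_prime[OF p(1)] by simp
  finally show ?thesis by (simp add: dft_def del: complex_cnj_power)
qed

text \<open>The dual inequality is tested on \<open>F\<close>, a combination of the
  \<open>psi q\<close> that is constantly \<open>G\<close> on \<open>S\<close>. By Parseval the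
  weighted norm of its coefficients is \<open>\<Sum>q. (y q)^2 * (N + 4 q Z) * h q\<close>; taking
  \<open>y q\<close> as the inverse weight makes this equal to \<open>G\<close> again, so
  \<open>card S * G^2 <= G\<close>.\<close>

theorem large_sieve_bound:
  fixes Z :: real and N :: nat and S :: "nat set"
  assumes S: "S \<subseteq> {1..N}" and avoid: "\<And>n p. n \<in> S \<Longrightarrow> prime p \<Longrightarrow> real p \<le> Z \<Longrightarrow> n mod p \<notin> R p"
    and Z: "Z > 0"
  shows "card S * (\<Sum>q | 0 < q \<and> real q \<le> Z \<and> squarefree q. h q / (N + 4 * real q * Z)) \<le> 1"
proof -
  let ?Q = "{q. 0 < q \<and> real q \<le> Z \<and> squarefree q}" and ?Q' = "{q. 0 < q \<and> real q \<le> Z}"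
  have fin: "finite ?Q'" by (rule finite_nat_real_le)
  define y where "y = (\<lambda>q. if squarefree q then 1 / (N + 4 * real q * Z) else 0)"
  define F where "F = (\<lambda>n. \<Sum>q\<in>?Q'. y q * psi q n)"
  define G where "G = (\<Sum>q\<in>?Q. h q / (N + 4 * real q * Z))"
  define b where "b = (\<lambda>(a, q). complex_of_real (y q) * dft q (psi q) a)"
  have G0: "G \<ge> 0" unfolding G_def using Z by (intro sum_nonneg divide_nonneg_nonneg h_nonneg) auto
  have Gy: "G = (\<Sum>q\<in>?Q'. y q * h q)"
    unfolding G_def using fin by (intro sum.mono_neutral_cong_left) (auto simp: y_def)
  have F_S: "F n = G" if "n \<in> S" for n
    unfolding F_def Gy
  proof (intro sum.cong refl)
    fix q assume q: "q \<in> ?Q'"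
    have "n mod p \<notin> R p" if p: "p \<in> prime_factors q" for p
    proof (rule avoid[OF \<open>n \<in> S\<close>])
      show "prime p" using p by auto
      have "p \<le> q" using p q by (auto simp: in_prime_factors_iff dvd_imp_le)
      then show "real p \<le> Z" using q by auto
    qed
    then show "y q * psi q n = y q * h q" by (simp add: psi_eq_h)
  qed
  \<comment> \<open>The Farey sum sees only reduced numerators; the transforms at all others vanish,
    so inversion and Parseval over the full period apply.\<close>
  have cop: "(\<Sum>a\<in>{a. a < q \<and> coprime a q}. f a) = (\<Sum>a<q. f a)"
    if "\<And>a. \<not> coprime a q \<Longrightarrow> f a = 0" for f :: "nat \<Rightarrow> 'x::comm_monoid_add" and q
    using that by (intro sum.mono_neutral_left) auto
  have F_b: "complex_of_real (F n) = (\<Sum>(a, q)\<in>farey Z. b (a, q) * cis (2 * pi * (a / q)) ^ n)" for n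
  proof -
    have "(\<Sum>a\<in>{a. a < q \<and> coprime a q}. b (a, q) * cis (2 * pi * (a / q)) ^ n) = y q * psi q n" if "q \<in> ?Q'" for q
    proof (cases "squarefree q")
      case True
      have "(\<Sum>a\<in>{a. a < q \<and> coprime a q}. b (a, q) * cis (2 * pi * (a / q)) ^ n) = (\<Sum>a<q. b (a, q) * cis (2 * pi * (a / q)) ^ n)"
        by (rule cop) (simp add: b_def dft_psi_eq_0 True)
      also have "\<dots> = (\<Sum>a<q. b (a, q) * cis (2 * pi * (a / q)) ^ (n mod q))"
      proof (intro sum.cong refl)
        fix a
        have "cis (2 * pi * (a / q)) ^ q = cis (2 * pi * of_nat a)" using that by (simp add: Complex.DeMoivre)
        also have "\<dots> = 1" by (rule cis_multiple_2pi) simp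
        finally have 1: "cis (2 * pi * (a / q)) ^ q = 1" .
        have "cis (2 * pi * (a / q)) ^ (q * (n div q) + n mod q) = cis (2 * pi * (a / q)) ^ (n mod q)"
          unfolding power_add power_mult 1 by simp
        then show "b (a, q) * cis (2 * pi * (a / q)) ^ n = b (a, q) * cis (2 * pi * (a / q)) ^ (n mod q)"
          unfolding mult_div_mod_eq by (rule arg_cong)
      qed
      also have "\<dots> = y q * (\<Sum>a<q. dft q (psi q) a * cis (2 * pi * (a / q)) ^ (n mod q))"
        by (simp add: b_def sum_distrib_left mult.assoc)
      also have "\<dots> = y q * psi q n"
        using that by (subst dft_inversion) (auto simp: psi_mod)
      finally show ?thesis .
    qed (simp add: b_def y_def)
    then show ?thesis unfolding sum_farey F_def by (simp add: of_real_sum)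
  qed
  have "real (card S) * G\<^sup>2 = (\<Sum>n\<in>S. (F n)\<^sup>2)" by (simp add: F_S)
  also have "\<dots> \<le> (\<Sum>n=1..N. (F n)\<^sup>2)" using S by (intro sum_mono2) auto
  also have "\<dots> = (\<Sum>n=1..N. (norm (complex_of_real (F n)))\<^sup>2)" by simp
  also have "\<dots> \<le> (\<Sum>(a, q)\<in>farey Z. (norm (b (a, q)))\<^sup>2 * (N + 4 * real q * Z))"
    unfolding F_b by (rule weighted_large_sieve)
  also have "\<dots> = (\<Sum>q\<in>?Q'. \<Sum>a\<in>{a. a < q \<and> coprime a q}. (norm (b (a, q)))\<^sup>2 * (N + 4 * real q * Z))"
    by (rule sum_farey)
  also have "\<dots> = (\<Sum>q\<in>?Q'. y q * h q)"
  proof (intro sum.cong refl)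
    fix q assume q: "q \<in> ?Q'"
    show "(\<Sum>a\<in>{a. a < q \<and> coprime a q}. (norm (b (a, q)))\<^sup>2 * (N + 4 * real q * Z)) = y q * h q"
    proof (cases "squarefree q")
      case True
      have "(\<Sum>a\<in>{a. a < q \<and> coprime a q}. (norm (b (a, q)))\<^sup>2 * (N + 4 * real q * Z)) = (\<Sum>a<q. (norm (b (a, q)))\<^sup>2 * (N + 4 * real q * Z))"
        by (rule cop) (simp add: b_def dft_psi_eq_0 True)
      also have "\<dots> = (y q)\<^sup>2 * (N + 4 * real q * Z) * (\<Sum>a<q. (norm (dft q (psi q) a))\<^sup>2)"
        by (simp add: b_def sum_distrib_left norm_mult power_mult_distrib mult_ac)
      also have "\<dots> = (y q)\<^sup>2 * (N + 4 * real q * Z) * h q"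
        using q by (simp add: dft_parseval sum_psi_square True)
      also have "\<dots> = y q * h q"
      proof -
        have "N + 4 * real q * Z > 0" using q Z by (intro add_nonneg_pos) auto
        then show ?thesis using True by (simp add: y_def power2_eq_square)
      qed
      finally show ?thesis .
    qed (simp add: b_def y_def)
  qed
  also have "\<dots> = G" by (rule Gy[symmetric])
  finally have "card S * G * G \<le> 1 * G" by (simp add: power2_eq_square mult.assoc)
  then have "card S * G \<le> 1"
    using G0 by (cases "G = 0") (auto dest: mult_right_le_imp_le)
  then show ?thesis by (simp add: G_def)
qed

end

section \<open>Stochastic domination\<close>

text \<open>Distributions on the multiples of \<open>l\<close> act on functions as averaging operators over translates. Truncating all
  of them at the same \<open>M\<close> makes them commute and keeps every sum finite.\<close>

definition shift_sum :: "nat \<Rightarrow> real \<times> (nat \<Rightarrow> real) \<Rightarrow> (real \<Rightarrow> real) \<Rightarrow> real \<Rightarrow> real" where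
  "shift_sum M = (\<lambda>(l, c) F x. \<Sum>k\<le>M. c k * F (x - k * l))"

lemma shift_sum_commute: "shift_sum M u (shift_sum M v F) = shift_sum M v (shift_sum M u F)"
proof
  fix x
  show "shift_sum M u (shift_sum M v F) x = shift_sum M v (shift_sum M u F) x"
    unfolding shift_sum_def split_beta sum_distrib_left
    by (subst sum.swap) (simp add: algebra_simps)
qed

interpretation shift_sum: comp_fun_commute "shift_sum M"
  by standard (simp add: fun_eq_iff shift_sum_commute)

abbreviation shift_sums :: "nat \<Rightarrow> (real \<times> (nat \<Rightarrow> real)) multiset \<Rightarrow> (real \<Rightarrow> real) \<Rightarrow> real \<Rightarrow> real" where
  "shift_sums M A F \<equiv> fold_mset (shift_sum M) F A"

definition bern :: "(nat \<Rightarrow> real) \<Rightarrow> nat \<Rightarrow> real \<times> (nat \<Rightarrow> real)" where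
  "bern e p = (ln p, \<lambda>k. if k = 0 then 1 - e p else if k = 1 then e p else 0)"

text \<open>The law of \<open>ln p\<close> times a geometric variable. Over all primes, unique
  factorisation turns the sum of these variables into \<open>ln m\<close> with weight proportional
  to \<open>1 / m\<close>. The cut at \<open>M\<close> in \<open>shift_sum\<close> is harmless in
  both directions: it lowers upper bounds for nonnegative functions, and no \<open>m <= M\<close>
  has an exponent above \<open>M\<close>.\<close>

definition geo :: "nat \<Rightarrow> real \<times> (nat \<Rightarrow> real)" where
  "geo p = (ln p, \<lambda>k. (1 - 1 / p) / p ^ k)"

lemma shift_sum_bern:
  assumes "M \<ge> 1"
  shows "shift_sum M (bern e p) F x = (1 - e p) * F x + e p * F (x - ln p)"
proof -
  have "(\<Sum>k\<le>M. (if k = 0 then 1 - e p else if k = 1 then e p else 0) * F (x - real k * ln p))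
      = (\<Sum>k\<in>{0, 1}. (if k = 0 then 1 - e p else if k = 1 then e p else 0) * F (x - real k * ln p))"
    using assms by (intro sum.mono_neutral_right) auto
  then show ?thesis by (simp add: shift_sum_def bern_def)
qed

lemma shift_sum_geo: "shift_sum M (geo p) F x = (\<Sum>k\<le>M. (1 - 1 / p) / p ^ k * F (x - k * ln p))"
  by (simp add: shift_sum_def geo_def)

lemma shift_sum_good:
  assumes "mono F" "\<And>x. 0 \<le> F x" "\<And>k. 0 \<le> snd u k"
  shows "mono (shift_sum M u F)" "0 \<le> shift_sum M u F x"
  using assms by (auto simp: shift_sum_def split_beta intro!: monoI sum_mono sum_nonneg mult_left_mono monoD[OF assms(1)])

lemma shift_sums_good:
  assumes F: "mono F" "\<And>x. 0 \<le> F x" and "\<And>l c k. (l, c) \<in># A \<Longrightarrow> 0 \<le> c k"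
  shows "mono (shift_sums M A F) \<and> (\<forall>x. 0 \<le> shift_sums M A F x)"
  using assms(3)
proof (induction A)
  case (add u A)
  obtain l c where u: "u = (l, c)" by fastforce
  have c: "0 \<le> c k" for k using add.prems[of l c] u by simp
  have IH: "mono (shift_sums M A F)" "\<And>x. 0 \<le> shift_sums M A F x" using add by auto
  show ?case using shift_sum_good[OF IH, of u M] c by (auto simp: u)
qed (use F in auto)

text \<open>All \<open>K\<close> geometric variables vanish with probability at most
  \<open>(1 - 1 / p) ^ K\<close>; otherwise the total shift is at least \<open>ln p\<close>, and
  \<open>F\<close> is monotone. Lost truncation mass only helps, as \<open>F\<close> is
  nonnegative.\<close>

lemma shift_sum_geo_iterate_le:
  assumes p: "p \<ge> 2" and F: "mono F" "\<And>x. 0 \<le> F x"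
  shows "mono ((shift_sum M (geo p) ^^ K) F) \<and> (\<forall>x. 0 \<le> (shift_sum M (geo p) ^^ K) F x \<and>
     (shift_sum M (geo p) ^^ K) F x \<le> (1 - 1 / p) ^ K * F x + (1 - (1 - 1 / p) ^ K) * F (x - ln p))"
proof (induction K)
  case (Suc K)
  let ?H = "(shift_sum M (geo p) ^^ K) F" and ?b = "1 - 1 / real p"
  have H: "mono ?H" "\<And>x. 0 \<le> ?H x"
    "\<And>x. ?H x \<le> ?b ^ K * F x + (1 - ?b ^ K) * F (x - ln p)"
    using Suc by auto
  have l: "ln p \<ge> 0" using p by simp
  have b: "0 \<le> ?b" "?b \<le> 1" using p by auto
  have good: "mono (shift_sum M (geo p) ?H)" "0 \<le> shift_sum M (geo p) ?H x" for x
    using shift_sums_good[of ?H "{#geo p#}" M] H b by (auto simp: geo_def)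
  have mH: "?H (x - real k * ln p) \<le> ?H (x - ln p)" if "1 \<le> k" for x k
    by (rule monoD[OF H(1)]) (use that l mult_right_mono[of 1 "real k" "ln p"] in auto)
  have "shift_sum M (geo p) ?H x \<le> ?b ^ Suc K * F x + (1 - ?b ^ Suc K) * F (x - ln p)" for x
  proof -
    have "shift_sum M (geo p) ?H x = (\<Sum>k\<le>M. ?b / p ^ k * ?H (x - k * ln p))"
      by (simp add: shift_sum_def geo_def)
    also have "\<dots> = ?b * ?H x + (\<Sum>k=1..M. ?b / p ^ k * ?H (x - k * ln p))"
      by (simp add: atMost_atLeast0 sum.atLeast_Suc_atMost)
    also have "\<dots> \<le> ?b * ?H x + (\<Sum>k=1..M. ?b / p ^ k * ?H (x - ln p))"
      using b by (intro add_left_mono sum_mono mult_left_mono mH) auto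
    also have "(\<Sum>k=1..M. ?b / p ^ k * ?H (x - ln p)) = (\<Sum>k=1..M. ?b / p ^ k) * ?H (x - ln p)"
      by (simp add: sum_distrib_right)
    also have "(\<Sum>k=1..M. ?b / p ^ k) * ?H (x - ln p) \<le> 1 / p * ?H (x - ln p)"
    proof (intro mult_right_mono H)
      have "(\<Sum>k=1..M. ?b / p ^ k) = 1 / p - 1 / p ^ Suc M" for M
      proof (induction M)
        case (Suc M)
        then have "(\<Sum>k=1..Suc M. ?b / p ^ k) = 1 / p - 1 / p ^ Suc M + ?b / p ^ Suc M" by simp
        then show ?case using p by (simp add: field_simps)
      qed simp
      then show "(\<Sum>k=1..M. ?b / p ^ k) \<le> 1 / p" by simp
    qed
    also have "?b * ?H x + 1 / p * ?H (x - ln p) \<le> ?b * (?b ^ K * F x + (1 - ?b ^ K) * F (x - ln p)) + 1 / p * F (x - ln p)"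
    proof (intro add_mono mult_left_mono H(3))
      have "?H (x - ln p) \<le> ?b ^ K * F (x - ln p) + (1 - ?b ^ K) * F (x - ln p - ln p)" by (rule H(3))
      also have "\<dots> \<le> ?b ^ K * F (x - ln p) + (1 - ?b ^ K) * F (x - ln p)"
        using b l by (intro add_left_mono mult_left_mono monoD[OF F(1)]) (auto intro: power_le_one)
      finally show "?H (x - ln p) \<le> F (x - ln p)" by (simp add: algebra_simps)
    qed (use b in auto)
    also have "\<dots> = ?b ^ Suc K * F x + (1 - ?b ^ Suc K) * F (x - ln p)"
      by (simp add: algebra_simps)
    finally show ?thesis by (simp add: add_left_mono)
  qed
  then show ?case using good by simp
qed (use F in auto)

text \<open>Both sides shift by multiples of \<open>ln p\<close>. By \<open>e0\<close> the left
  total is 0 no more often than the right one, and when nonzero it is at least \<open>ln p\<close>,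
  the largest value on the right.\<close>

lemma shift_sum_bern_dominates:
  assumes p: "p \<ge> 2" and M: "M \<ge> 1" and F: "mono F" "\<And>x. 0 \<le> F x"
    and e: "0 \<le> e p" "e p \<le> 1" and e0: "(1 - 1 / p) ^ K * (1 - e p) \<le> 1 - e0 p"
  shows "shift_sum M (bern e p) ((shift_sum M (geo p) ^^ K) F) x \<le> shift_sum M (bern e0 p) F x"
proof -
  let ?H = "(shift_sum M (geo p) ^^ K) F" and ?b = "1 - 1 / real p"
  have b: "0 \<le> ?b ^ K" "?b ^ K \<le> 1" using p by (auto intro!: power_le_one)
  have H: "?H y \<le> ?b ^ K * F y + (1 - ?b ^ K) * F (y - ln p)" for y
    using shift_sum_geo_iterate_le[OF p F] by blast
  have dec: "F (y - ln p) \<le> F y" for y by (rule monoD[OF F(1)]) (use p in auto)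
  have "?H (x - ln p) \<le> ?b ^ K * F (x - ln p) + (1 - ?b ^ K) * F (x - ln p)"
    using H[of "x - ln p"] mult_left_mono[OF dec[of "x - ln p"], of "1 - ?b ^ K"] b by linarith
  then have H1: "?H (x - ln p) \<le> F (x - ln p)" by (simp add: algebra_simps)
  have "(1 - e p) * ?H x + e p * ?H (x - ln p)
      \<le> (1 - e p) * (?b ^ K * F x + (1 - ?b ^ K) * F (x - ln p)) + e p * F (x - ln p)"
    using e by (intro add_mono mult_left_mono H H1) auto
  also have "\<dots> = F (x - ln p) + ?b ^ K * (1 - e p) * (F x - F (x - ln p))"
    by (simp add: algebra_simps)
  also have "\<dots> \<le> F (x - ln p) + (1 - e0 p) * (F x - F (x - ln p))"
    using e0 dec[of x] by (intro add_left_mono mult_right_mono) auto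
  finally show ?thesis using M by (simp add: shift_sum_bern algebra_simps)
qed

lemma shift_sum_mono:
  assumes "\<And>k. 0 \<le> snd u k" "\<And>x. F x \<le> G x"
  shows "shift_sum M u F x \<le> shift_sum M u G x"
  using assms by (auto simp: shift_sum_def split_beta intro!: sum_mono mult_left_mono)

lemma shift_sums_replicate: "shift_sums M (replicate_mset K u) F = (shift_sum M u ^^ K) F"
  by (induction K) auto

text \<open>The operators commute, so the \<open>K\<close> geometric factors and the Bernoulli
  factor of one prime can be moved outside and exchanged together. The function they act on is still
  monotone and nonnegative, as the one-prime comparison demands.\<close>

lemma shift_sums_bern_dominates:
  assumes "finite P" and P: "\<And>p. p \<in> P \<Longrightarrow> p \<ge> 2" and M: "M \<ge> 1" and F: "mono F" "\<And>x. 0 \<le> F x"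
    and e: "\<And>p. p \<in> P \<Longrightarrow> 0 \<le> e p \<and> e p \<le> 1" and e0: "\<And>p. p \<in> P \<Longrightarrow> 0 \<le> e0 p \<and> e0 p \<le> 1"
    and dom: "\<And>p. p \<in> P \<Longrightarrow> (1 - 1 / p) ^ K * (1 - e p) \<le> 1 - e0 p"
  shows "shift_sums M (repeat_mset K (image_mset geo (mset_set P)) + image_mset (bern e) (mset_set P)) F x
    \<le> shift_sums M (image_mset (bern e0) (mset_set P)) F x"
  using assms(1) P e e0 dom
proof (induction P arbitrary: x rule: finite_induct)
  case (insert p P)
  let ?A = "repeat_mset K (image_mset geo (mset_set P)) + image_mset (bern e) (mset_set P)"
  have "0 \<le> c k" if lc: "(l, c) \<in># ?A" for l c k
  proof -
    have "\<exists>p\<in>P. (l, c) = geo p \<or> (l, c) = bern e p"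
    proof -
      have "(l, c) \<in># image_mset geo (mset_set P) \<or> (l, c) \<in># image_mset (bern e) (mset_set P)"
        using lc by (metis count_repeat_mset mult_0_right not_in_iff union_iff)
      then show ?thesis using insert.hyps(1) by auto
    qed
    then obtain p where p: "p \<in> P" and "(l, c) = geo p \<or> (l, c) = bern e p" by blast
    then show ?thesis using insert.prems(2)[of p] insert.prems(1)[of p] by (auto simp: geo_def bern_def)
  qed
  then have good: "mono (shift_sums M ?A F)" "\<And>x. 0 \<le> shift_sums M ?A F x"
    using shift_sums_good[OF F, of ?A M] by blast+
  have "shift_sums M (repeat_mset K (image_mset geo (mset_set (insert p P))) + image_mset (bern e) (mset_set (insert p P))) F
      = shift_sums M (?A + replicate_mset K (geo p) + {#bern e p#}) F"
    using insert.hyps by (simp add: ac_simps)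
  also have "\<dots> = shift_sum M (bern e p) ((shift_sum M (geo p) ^^ K) (shift_sums M ?A F))"
    unfolding shift_sum.fold_mset_union shift_sums_replicate by simp
  finally have "shift_sums M (repeat_mset K (image_mset geo (mset_set (insert p P))) + image_mset (bern e) (mset_set (insert p P))) F x
      \<le> shift_sum M (bern e0 p) (shift_sums M ?A F) x"
    using shift_sum_bern_dominates[OF _ M good, of p e K e0 x] insert.prems by simp
  also have "\<dots> \<le> shift_sum M (bern e0 p) (shift_sums M (image_mset (bern e0) (mset_set P)) F) x"
    using insert.prems by (intro shift_sum_mono insert.IH) (auto simp: bern_def)
  finally show ?case using insert.hyps by simp
qed simp

text \<open>Pulling out \<open>1 - e p\<close> leaves the odds \<open>e p / (1 - e p)\<close>; for
  \<open>e p = rho p / p\<close> these are the values \<open>h p\<close>, and the subsets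
  \<open>D\<close> stand for squarefree numbers.\<close>

lemma shift_sums_bern_expand:
  assumes "finite P" "M \<ge> 1" "\<And>p. p \<in> P \<Longrightarrow> e p \<noteq> 1"
  shows "shift_sums M (image_mset (bern e) (mset_set P)) F x
    = (\<Prod>p\<in>P. 1 - e p) * (\<Sum>D\<in>Pow P. (\<Prod>p\<in>D. e p / (1 - e p)) * F (x - (\<Sum>p\<in>D. ln p)))"
  using assms(1,3)
proof (induction P arbitrary: x rule: finite_induct)
  case (insert p P)
  let ?S = "\<lambda>x. \<Sum>D\<in>Pow P. (\<Prod>p\<in>D. e p / (1 - e p)) * F (x - (\<Sum>p\<in>D. ln p))"
  have e: "1 - e p \<noteq> 0" using insert.prems by auto
  have fin: "finite D" "p \<notin> D" if "D \<in> Pow P" for D using that insert.hyps by (auto intro: finite_subset)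
  have inj: "inj_on (insert p) (Pow P)" using insert.hyps by (auto simp: inj_on_def)
  have "(\<Sum>D\<in>insert p ` Pow P. (\<Prod>p\<in>D. e p / (1 - e p)) * F (x - (\<Sum>p\<in>D. ln p)))
      = (\<Sum>D\<in>Pow P. e p / (1 - e p) * ((\<Prod>p\<in>D. e p / (1 - e p)) * F (x - ln p - (\<Sum>p\<in>D. ln p))))"
    unfolding sum.reindex[OF inj] by (intro sum.cong refl) (simp add: fin algebra_simps)
  also have "\<dots> = e p / (1 - e p) * ?S (x - ln p)" by (rule sum_distrib_left[symmetric])
  finally have S: "(\<Sum>D\<in>Pow (insert p P). (\<Prod>p\<in>D. e p / (1 - e p)) * F (x - (\<Sum>p\<in>D. ln p)))
      = ?S x + e p / (1 - e p) * ?S (x - ln p)"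
    unfolding Pow_insert using insert.hyps by (subst sum.union_disjoint) auto
  have "shift_sums M (image_mset (bern e) (mset_set (insert p P))) F x
      = (1 - e p) * ((\<Prod>p\<in>P. 1 - e p) * ?S x) + e p * ((\<Prod>p\<in>P. 1 - e p) * ?S (x - ln p))"
    using insert assms(2) by (simp add: shift_sum_bern)
  also have "\<dots> = ((1 - e p) * (\<Prod>p\<in>P. 1 - e p)) * (?S x + e p / (1 - e p) * ?S (x - ln p))"
    using e by (simp add: field_simps)
  finally show ?case unfolding S using insert.hyps by simp
qed simp

text \<open>Jensen's inequality, one two-point law at a time. All shifts go to the left because
  \<open>ln p >= 0\<close>, so the minorant of \<open>H\<close> is only needed up to
  \<open>x\<close>; the truncation at \<open>M\<close> makes it available only there.\<close>

lemma shift_sums_bern_convex: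
  assumes "finite P" "M \<ge> 1" "\<And>p. p \<in> P \<Longrightarrow> 0 \<le> e p \<and> e p \<le> 1" "\<And>p. p \<in> P \<Longrightarrow> p \<ge> 1"
    and G: "convex_on UNIV G" and H: "\<And>y. y \<le> x \<Longrightarrow> c * G y \<le> H y" and c: "c \<ge> 0"
  shows "c * G (x - (\<Sum>p\<in>P. e p * ln p)) \<le> shift_sums M (image_mset (bern e) (mset_set P)) H x"
  using assms(1,3,4) H
proof (induction P arbitrary: x rule: finite_induct)
  case (insert p P)
  let ?E = "shift_sums M (image_mset (bern e) (mset_set P)) H" and ?m = "\<Sum>p\<in>P. e p * ln p"
  have e: "0 \<le> e p" "e p \<le> 1" "ln p \<ge> 0" using insert.prems(1,2)[of p] by auto
  have "G ((1 - e p) *\<^sub>R (x - ?m) + e p *\<^sub>R (x - ln p - ?m)) \<le> (1 - e p) * G (x - ?m) + e p * G (x - ln p - ?m)"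
    by (rule convex_onD[OF G]) (use e in auto)
  moreover have "(1 - e p) *\<^sub>R (x - ?m) + e p *\<^sub>R (x - ln p - ?m) = x - (e p * ln p + ?m)"
    by (simp add: algebra_simps)
  ultimately have "c * G (x - (e p * ln p + ?m)) \<le> c * ((1 - e p) * G (x - ?m) + e p * G (x - ln p - ?m))"
    using c by (intro mult_left_mono) auto
  also have "\<dots> = (1 - e p) * (c * G (x - ?m)) + e p * (c * G (x - ln p - ?m))" by (simp add: algebra_simps)
  also have "\<dots> \<le> (1 - e p) * ?E x + e p * ?E (x - ln p)"
  proof (intro add_mono mult_left_mono insert.IH)
    show "c * G y \<le> H y" if "y \<le> x - ln p" for y
      using insert.prems(3)[of y] that e(3) by linarith
  qed (use insert.prems e in auto)
  finally show ?case using insert.hyps assms(2) by (simp add: shift_sum_bern)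
qed simp

section \<open>Geometric laws as sums over 1 / m, and iterated integration\<close>

lemma prod_one_minus_inverse_prime_nonneg:
  assumes "\<And>p. p \<in> P \<Longrightarrow> prime p"
  shows "0 \<le> (\<Prod>p\<in>P. 1 - 1 / real p)"
proof (rule prod_nonneg)
  fix r assume "r \<in> P"
  then have "r \<ge> 1" using assms prime_ge_1_nat by blast
  then show "0 \<le> 1 - 1 / real r" by simp
qed

text \<open>Writing \<open>m = p ^ k * m'\<close> with \<open>p\<close> not dividing
  \<open>m'\<close> embeds the numbers for \<open>insert p P\<close> into pairs of an exponent and a
  number for \<open>P\<close>. The surplus pairs are dropped at no cost since \<open>F\<close> is
  nonnegative.\<close>

lemma shift_sums_geo_ge:
  assumes "finite P" "\<And>p. p \<in> P \<Longrightarrow> prime p" "\<And>x. 0 \<le> F x"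
  shows "(\<Prod>p\<in>P. 1 - 1 / p) * (\<Sum>m | m \<in> {1..M} \<and> prime_factors m \<subseteq> P. F (x - ln m) / m)
    \<le> shift_sums M (image_mset geo (mset_set P)) F x"
  using assms(1,2)
proof (induction P arbitrary: x rule: finite_induct)
  case empty
  have "{m. m \<in> {1..M} \<and> prime_factors m \<subseteq> {}} \<subseteq> {1}"
    by (auto simp: prime_factorization_empty_iff)
  then have "(\<Sum>m | m \<in> {1..M} \<and> prime_factors m \<subseteq> {}. F (x - ln m) / m) \<le> (\<Sum>m\<in>{1}. F (x - ln (real m)) / m)"
    by (rule sum_mono2[rotated]) (auto simp: assms(3))
  then show ?case by simp
next
  case (insert p P)
  have p: "prime p" using insert.prems by simp
  have p2: "p \<ge> 2" using p prime_ge_2_nat by blast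
  let ?S = "\<lambda>P. {m. m \<in> {1..M} \<and> prime_factors m \<subseteq> P}"
  let ?V = "\<Prod>p\<in>P. 1 - 1 / real p"
  have V: "?V \<ge> 0" using insert.prems by (intro prod_one_minus_inverse_prime_nonneg) auto
  let ?g = "\<lambda>m. (multiplicity p m, m div p ^ multiplicity p m)"
  have dec: "m = p ^ multiplicity p m * (m div p ^ multiplicity p m)" for m
    by (simp add: multiplicity_dvd)
  have inj: "inj_on ?g (?S (insert p P))" by (rule inj_onI) (metis dec prod.inject)
  have sub: "?g ` ?S (insert p P) \<subseteq> {..M} \<times> ?S P"
  proof (rule image_subsetI)
    fix m assume "m \<in> ?S (insert p P)"
    then have m: "m \<in> {1..M}" "prime_factors m \<subseteq> insert p P" by auto
    let ?k = "multiplicity p m" and ?m = "m div p ^ multiplicity p m"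
    have m0: "m \<noteq> 0" using m by auto
    have "p ^ ?k dvd m" by (rule multiplicity_dvd)
    then have "p ^ ?k \<le> m" using m0 by (simp add: dvd_imp_le)
    \<comment> \<open>This bounds the exponent by \<open>M\<close>, so the truncated geometric law
      still covers it.\<close>
    moreover have "?k < p ^ ?k" using p2 by (simp add: power_gt_expt)
    ultimately have "?k \<le> M" using m by auto
    moreover have "?m \<in> {1..M}" using m \<open>p ^ ?k \<le> m\<close> p2
      by (auto simp: div_greater_zero_iff Suc_le_eq intro: order_trans[OF div_le_dividend])
    moreover have "prime_factors ?m \<subseteq> P"
    proof
      fix r assume r: "r \<in> prime_factors ?m"
      then have "r dvd m" by (metis dec dvd_mult in_prime_factors_iff)
      then have "r \<in> insert p P" using r m m0 by (auto simp: in_prime_factors_iff)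
      moreover have "r \<noteq> p"
      proof -
        have "\<not> p dvd ?m" by (rule multiplicity_decompose) (use m0 p in \<open>auto dest: not_prime_unit\<close>)
        then show ?thesis using r by (auto simp: in_prime_factors_iff)
      qed
      ultimately show "r \<in> P" by simp
    qed
    ultimately show "?g m \<in> {..M} \<times> ?S P" by simp
  qed
  have fin: "finite (?S P)" by simp
  let ?t = "\<lambda>k m. F (x - ln (real (p ^ k * m))) / real (p ^ k * m)"
  have "(\<Sum>m\<in>?S (insert p P). F (x - ln m) / m) = (\<Sum>(k, m)\<in>?g ` ?S (insert p P). ?t k m)"
    unfolding sum.reindex[OF inj] by (intro sum.cong refl) (simp only: o_def prod.case dec[symmetric])
  also have "\<dots> \<le> (\<Sum>(k, m)\<in>{..M} \<times> ?S P. ?t k m)"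
    using sub by (intro sum_mono2) (auto simp: assms(3))
  also have "\<dots> = (\<Sum>k\<le>M. \<Sum>m\<in>?S P. ?t k m)" by (rule sum.cartesian_product[symmetric])
  also have "\<dots> = (\<Sum>k\<le>M. 1 / p ^ k * (\<Sum>m\<in>?S P. F (x - k * ln p - ln m) / m))"
    unfolding sum_distrib_left
    by (intro sum.cong refl) (use p2 in \<open>auto simp: ln_mult ln_realpow algebra_simps\<close>)
  finally have "(1 - 1 / p) * ?V * (\<Sum>m\<in>?S (insert p P). F (x - ln m) / m)
      \<le> (1 - 1 / p) * ?V * (\<Sum>k\<le>M. 1 / p ^ k * (\<Sum>m\<in>?S P. F (x - k * ln p - ln m) / m))"
    using V p2 by (intro mult_left_mono) auto
  also have "\<dots> = (\<Sum>k\<le>M. (1 - 1 / p) / p ^ k * (?V * (\<Sum>m\<in>?S P. F (x - k * ln p - ln m) / m)))"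
    by (simp add: sum_distrib_left mult_ac)
  also have "\<dots> \<le> (\<Sum>k\<le>M. (1 - 1 / p) / p ^ k * shift_sums M (image_mset geo (mset_set P)) F (x - k * ln p))"
    using p2 insert.prems by (intro sum_mono mult_left_mono insert.IH) auto
  finally show ?case using insert.hyps by (simp add: shift_sum_geo)
qed

text \<open>A Riemann sum over the points \<open>x - ln m\<close>: the gap
  \<open>ln (m + 1) - ln m\<close> is at most \<open>1 / m\<close>. The hypothesis on
  \<open>G\<close> is what a primitive of an increasing \<open>f\<close> satisfies, and
  \<open>x <= ln (M + 1)\<close> makes the last point fall where \<open>G\<close> vanishes.\<close>

lemma sum_shift_ge_primitive:
  assumes F: "\<And>y. y \<le> x \<Longrightarrow> f y \<le> F y"
    and G: "\<And>u v. v \<le> u \<Longrightarrow> G u - G v \<le> f u * (u - v)" and f0: "\<And>u. 0 \<le> f u" and G0: "\<And>u. u \<le> 0 \<Longrightarrow> G u = 0"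
    and x: "x \<le> ln (real M + 1)"
  shows "G x \<le> (\<Sum>m=1..M. F (x - ln m) / m)"
proof -
  have "G x - G (x - ln (real M + 1)) = (\<Sum>m=1..M. G (x - ln m) - G (x - ln (real m + 1)))"
  proof -
    have "(\<Sum>m=1..M. G (x - ln m) - G (x - ln (real m + 1))) = G x - G (x - ln (real M + 1))"
      by (induction M) (auto simp: add_ac)
    then show ?thesis ..
  qed
  also have "\<dots> \<le> (\<Sum>m=1..M. F (x - ln m) / m)"
  proof (rule sum_mono)
    fix m assume "m \<in> {1..M}"
    then have m: "m \<ge> 1" by simp
    have "ln (real m + 1) - ln m = ln ((real m + 1) / m)"
      using m by (subst ln_div) auto
    also have "(real m + 1) / m = 1 + 1 / m" using m by (simp add: field_simps)
    also have "ln (1 + 1 / m) \<le> 1 / m" by (rule ln_add_one_self_le_self) simp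
    finally have l: "ln (real m + 1) - ln m \<le> 1 / m" .
    have "G (x - ln m) - G (x - ln (real m + 1)) \<le> f (x - ln m) * (ln (real m + 1) - ln m)"
      using G[of "x - ln (real m + 1)" "x - ln m"] m by simp
    also have "\<dots> \<le> f (x - ln m) * (1 / m)" using l f0 by (intro mult_left_mono) auto
    also have "\<dots> \<le> F (x - ln m) * (1 / m)" using m by (intro mult_right_mono F) auto
    finally show "G (x - ln m) - G (x - ln (real m + 1)) \<le> F (x - ln m) / m" by simp
  qed
  finally show ?thesis using G0[of "x - ln (real M + 1)"] x by simp
qed

text \<open>For \<open>j >= 1\<close> these are the iterated primitives of the unit step at 1. They
  suit both tools: summation over \<open>1 / m\<close> raises the index, and convexity permits
  Jensen's inequality.\<close>

definition hinge :: "nat \<Rightarrow> real \<Rightarrow> real" where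
  "hinge j x = (max 0 (x - 1)) ^ j / fact j"

text \<open>\<open>exp_step (ln z - ln q) = 1 - q / z\<close> for \<open>q \<le> z\<close>.\<close>

definition exp_step :: "real \<Rightarrow> real" where
  "exp_step x = (if x \<ge> 0 then 1 - exp (- x) else 0)"

lemma power_diff_le_tangent:
  fixes a b :: real
  assumes "0 \<le> b" "b \<le> a"
  shows "a ^ Suc n - b ^ Suc n \<le> Suc n * a ^ n * (a - b)"
proof (induction n)
  case (Suc n)
  have "a ^ Suc (Suc n) - b ^ Suc (Suc n) = a * (a ^ Suc n - b ^ Suc n) + (a - b) * b ^ Suc n"
    by (simp add: algebra_simps)
  also have "\<dots> \<le> a * (Suc n * a ^ n * (a - b)) + (a - b) * a ^ Suc n"
    using assms Suc by (intro add_mono mult_left_mono power_mono) auto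
  also have "\<dots> = Suc (Suc n) * a ^ Suc n * (a - b)" by (simp add: algebra_simps)
  finally show ?case .
qed simp

lemma hinge_diff_le:
  assumes "v \<le> u"
  shows "hinge (Suc j) u - hinge (Suc j) v \<le> hinge j u * (u - v)"
proof -
  let ?a = "max 0 (u - 1)" and ?b = "max 0 (v - 1)"
  have "hinge (Suc j) u - hinge (Suc j) v = (?a ^ Suc j - ?b ^ Suc j) / fact (Suc j)"
    by (simp only: hinge_def diff_divide_distrib)
  also have "\<dots> \<le> (Suc j * ?a ^ j * (?a - ?b)) / fact (Suc j)"
    using assms by (intro divide_right_mono power_diff_le_tangent) auto
  also have "\<dots> = hinge j u * (?a - ?b)"
    unfolding hinge_def fact_Suc of_nat_mult by (simp del: of_nat_Suc)
  also have "\<dots> \<le> hinge j u * (u - v)"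
  proof (cases "u \<le> 1 \<and> j \<noteq> 0")
    case True
    then have "?a = 0" by simp
    then have "hinge j u = 0" using True by (simp add: hinge_def)
    then show ?thesis by simp
  next
    case False
    then show ?thesis using assms by (intro mult_left_mono) (auto simp: hinge_def)
  qed
  finally show ?thesis .
qed

lemma hinge_nonneg: "0 \<le> hinge j x" by (simp add: hinge_def)

lemma mono_exp_step: "mono exp_step"
  by (rule monoI) (auto simp: exp_step_def)

lemma exp_step_nonneg: "0 \<le> exp_step x"
  by (simp add: exp_step_def)

text \<open>The first summation turns \<open>exp_step\<close> into its primitive \<open>x - 1 + exp (-x)\<close>, which dominates \<open>hinge 1\<close>.\<close>

lemma exp_step_primitive_diff_le:
  assumes "v \<le> u"
  defines "G \<equiv> \<lambda>x::real. if x \<ge> 0 then x - 1 + exp (- x) else 0"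
  shows "G u - G v \<le> exp_step u * (u - v)"
proof -
  have *: "(u - 1 + exp (- u)) - (w - 1 + exp (- w)) \<le> (1 - exp (- u)) * (u - w)" for w
  proof -
    have "exp (- u) * (1 + (u - w)) \<le> exp (- u) * exp (u - w)"
      by (intro mult_left_mono exp_ge_add_one_self) auto
    also have "\<dots> = exp (- w)" by (simp flip: exp_add)
    finally show ?thesis by (simp add: algebra_simps)
  qed
  show ?thesis
  proof (cases "u \<ge> 0")
    case u: True
    show ?thesis
    proof (cases "v \<ge> 0")
      case True then show ?thesis using *[of v] u by (simp add: G_def exp_step_def)
    next
      case False
      have "G u - G v \<le> (1 - exp (- u)) * (u - 0)" using *[of 0] u False by (simp add: G_def)
      also have "\<dots> \<le> (1 - exp (- u)) * (u - v)" using u False by (intro mult_left_mono) auto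
      finally show ?thesis using u by (simp add: exp_step_def)
    qed
  qed (use assms in \<open>auto simp: G_def exp_step_def\<close>)
qed

lemma hinge_1_le: "hinge 1 x \<le> (if x \<ge> 0 then x - 1 + exp (- x) else 0)"
proof -
  have "exp (- x) \<ge> 1 - x" using exp_ge_add_one_self[of "- x"] by simp
  then show ?thesis by (auto simp: hinge_def)
qed

lemma convex_hinge: "convex_on UNIV (hinge j)"
proof (rule convex_onI)
  fix t x y :: real assume t: "0 < t" "t < 1"
  let ?m = "\<lambda>x::real. max 0 (x - 1)"
  have c: "convex_on {0..} (\<lambda>x::real. x ^ j)"
    using convex_power_odd[of j] convex_on_subset[OF convex_power_even[of j], of "{0..}"] by (cases "even j") auto
  have "?m ((1 - t) *\<^sub>R x + t *\<^sub>R y) \<le> (1 - t) * ?m x + t * ?m y"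
  proof (rule max.boundedI)
    show "0 \<le> (1 - t) * ?m x + t * ?m y" using t by simp
    have "(1 - t) * (x - 1) + t * (y - 1) \<le> (1 - t) * ?m x + t * ?m y"
      using t by (intro add_mono mult_left_mono) auto
    then show "(1 - t) *\<^sub>R x + t *\<^sub>R y - 1 \<le> (1 - t) * ?m x + t * ?m y" by (simp add: algebra_simps)
  qed
  then have "?m ((1 - t) *\<^sub>R x + t *\<^sub>R y) ^ j \<le> ((1 - t) *\<^sub>R ?m x + t *\<^sub>R ?m y) ^ j"
    by (intro power_mono) auto
  also have "\<dots> \<le> (1 - t) * ?m x ^ j + t * ?m y ^ j"
    using t by (intro convex_onD[OF c]) auto
  finally have "?m ((1 - t) *\<^sub>R x + t *\<^sub>R y) ^ j / fact j \<le> ((1 - t) * ?m x ^ j + t * ?m y ^ j) / fact j"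
    by (intro divide_right_mono) auto
  then show "hinge j ((1 - t) *\<^sub>R x + t *\<^sub>R y) \<le> (1 - t) * hinge j x + t * hinge j y"
    by (simp add: hinge_def add_divide_distrib)
qed auto

lemma shift_sums_geo_ge_primitive:
  assumes P: "finite P" "\<And>p. p \<in> P \<Longrightarrow> prime p" "\<And>p. prime p \<Longrightarrow> p \<le> M \<Longrightarrow> p \<in> P"
    and F0: "\<And>x. 0 \<le> F x" and F: "\<And>y. y \<le> x \<Longrightarrow> f y \<le> F y"
    and G: "\<And>u v. v \<le> u \<Longrightarrow> G u - G v \<le> f u * (u - v)" and f0: "\<And>u. 0 \<le> f u" and G0: "\<And>u. u \<le> 0 \<Longrightarrow> G u = 0"
    and x: "x \<le> ln (real M + 1)"
  shows "(\<Prod>p\<in>P. 1 - 1 / p) * G x \<le> shift_sums M (image_mset geo (mset_set P)) F x"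
proof -
  have "prime_factors m \<subseteq> P" if "m \<in> {1..M}" for m
  proof
    fix p assume "p \<in> prime_factors m"
    then have "prime p" "p dvd m" by auto
    moreover have "p \<le> M" using that dvd_imp_le[OF \<open>p dvd m\<close>] by simp
    ultimately show "p \<in> P" using P(3) by blast
  qed
  then have "{m. m \<in> {1..M} \<and> prime_factors m \<subseteq> P} = {1..M}" by blast
  then have le: "(\<Prod>p\<in>P. 1 - 1 / p) * (\<Sum>m=1..M. F (x - ln m) / m) \<le> shift_sums M (image_mset geo (mset_set P)) F x"
    using shift_sums_geo_ge[OF P(1,2) F0, where M = M and x = x] by simp
  have "0 \<le> (\<Prod>p\<in>P. 1 - 1 / real p)" by (rule prod_one_minus_inverse_prime_nonneg[OF P(2)])
  then have "(\<Prod>p\<in>P. 1 - 1 / p) * G x \<le> (\<Prod>p\<in>P. 1 - 1 / p) * (\<Sum>m=1..M. F (x - ln m) / m)"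
    by (intro mult_left_mono sum_shift_ge_primitive[OF F G f0 G0 x])
  then show ?thesis using le by simp
qed

lemma shift_sums_repeat: "shift_sums M (repeat_mset K A) F = (shift_sums M A ^^ K) F"
proof (induction K)
  case (Suc K)
  have "shift_sums M (repeat_mset (Suc K) A) F = shift_sums M (repeat_mset K A + A) F"
    by (simp add: add.commute)
  also have "\<dots> = shift_sums M A (shift_sums M (repeat_mset K A) F)" by (rule shift_sum.fold_mset_union)
  finally show ?case by (simp only: Suc funpow.simps o_def)
qed simp

text \<open>One family of geometric laws over \<open>P\<close> contributes the factor
  \<open>\<Prod>p\<in>P. 1 - 1 / p\<close> and one integration. The first one leads from
  \<open>exp_step\<close> to \<open>hinge 1\<close>, each further one from \<open>hinge j\<close> to
  \<open>hinge (Suc j)\<close>.\<close>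

lemma shift_sums_geo_iterate_ge_hinge:
  assumes P: "finite P" "\<And>p. p \<in> P \<Longrightarrow> prime p" "\<And>p. prime p \<Longrightarrow> p \<le> M \<Longrightarrow> p \<in> P"
    and x: "x \<le> ln (real M + 1)"
  shows "(\<Prod>p\<in>P. 1 - 1 / p) ^ Suc K * hinge (Suc K) x
    \<le> shift_sums M (repeat_mset (Suc K) (image_mset geo (mset_set P))) exp_step x"
  using x
proof (induction K arbitrary: x)
  case 0
  let ?V = "\<Prod>p\<in>P. 1 - 1 / real p"
  let ?G = "\<lambda>x::real. if x \<ge> 0 then x - 1 + exp (- x) else 0"
  have V: "0 \<le> ?V" by (rule prod_one_minus_inverse_prime_nonneg[OF P(2)])
  have "?V * ?G x \<le> shift_sums M (image_mset geo (mset_set P)) exp_step x"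
    by (rule shift_sums_geo_ge_primitive[OF P exp_step_nonneg order_refl exp_step_primitive_diff_le exp_step_nonneg _ 0]) auto
  moreover have "?V * hinge 1 x \<le> ?V * ?G x" by (intro mult_left_mono hinge_1_le V)
  ultimately show ?case by simp
next
  case (Suc K)
  let ?V = "\<Prod>p\<in>P. 1 - 1 / real p"
  let ?A = "image_mset geo (mset_set P)"
  have V: "0 \<le> ?V" by (rule prod_one_minus_inverse_prime_nonneg[OF P(2)])
  have "0 \<le> c k" if lc: "(l, c) \<in># repeat_mset (Suc K) ?A" for l c k
  proof -
    have "(l, c) \<in># ?A" using lc by (metis count_repeat_mset mult_0_right not_in_iff)
    then obtain p where p: "p \<in> P" "(l, c) = geo p" using P(1) by auto
    then have "p \<ge> 1" using P(2) prime_ge_1_nat by blast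
    then show ?thesis using p by (simp add: geo_def)
  qed
  then have good: "0 \<le> shift_sums M (repeat_mset (Suc K) ?A) exp_step x" for x
    using shift_sums_good[OF mono_exp_step exp_step_nonneg, of "repeat_mset (Suc K) ?A" M] by blast
  have "?V * (?V ^ Suc K * hinge (Suc (Suc K)) x) \<le> shift_sums M ?A (shift_sums M (repeat_mset (Suc K) ?A) exp_step) x"
  proof (rule shift_sums_geo_ge_primitive[OF P good _ _ _ _ Suc.prems])
    show "?V ^ Suc K * hinge (Suc K) y \<le> shift_sums M (repeat_mset (Suc K) ?A) exp_step y" if "y \<le> x" for y
      using Suc that by simp
    show "?V ^ Suc K * hinge (Suc (Suc K)) u - ?V ^ Suc K * hinge (Suc (Suc K)) v \<le> ?V ^ Suc K * hinge (Suc K) u * (u - v)"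
      if "v \<le> u" for u v
    proof -
      have "?V ^ Suc K * (hinge (Suc (Suc K)) u - hinge (Suc (Suc K)) v) \<le> ?V ^ Suc K * (hinge (Suc K) u * (u - v))"
        using V by (intro mult_left_mono hinge_diff_le that) simp
      then show ?thesis by (simp only: right_diff_distrib mult.assoc)
    qed
    show "0 \<le> ?V ^ Suc K * hinge (Suc K) u" for u using V by (intro mult_nonneg_nonneg hinge_nonneg) simp
    show "?V ^ Suc K * hinge (Suc (Suc K)) u = 0" if "u \<le> 0" for u using that by (simp add: hinge_def)
  qed
  moreover have "shift_sums M ?A (shift_sums M (repeat_mset (Suc K) ?A) exp_step) = shift_sums M (repeat_mset (Suc (Suc K)) ?A) exp_step"
    by (simp only: shift_sums_repeat funpow.simps o_def)
  ultimately show ?case by (simp only: power_Suc mult.assoc)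
qed

text \<open>A sum of independent Bernoulli variables \<open>e0\<close> is stochastically smaller than the sum of \<open>K\<close> copies of the
  (geometric) distribution of \<open>ln m\<close> with weights \<open>1 / m\<close> and of Bernoulli variables \<open>e\<close>; Jensen's inequality
  replaces the latter by their mean.\<close>

theorem bernoulli_sum_lower_bound:
  fixes e e0 :: "nat \<Rightarrow> real"
  assumes P: "finite P" "\<And>p. p \<in> P \<Longrightarrow> prime p" "\<And>p. prime p \<Longrightarrow> p \<le> M \<Longrightarrow> p \<in> P"
    and M: "M \<ge> 1" and K: "K \<ge> 1" and x: "x \<le> ln (real M + 1)"
    and e: "\<And>p. p \<in> P \<Longrightarrow> 0 \<le> e p \<and> e p \<le> 1" and e0: "\<And>p. p \<in> P \<Longrightarrow> 0 \<le> e0 p \<and> e0 p < 1"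
    and dom: "\<And>p. p \<in> P \<Longrightarrow> (1 - 1 / p) ^ K * (1 - e p) \<le> 1 - e0 p"
  shows "(\<Prod>p\<in>P. 1 - 1 / p) ^ K * hinge K (x - (\<Sum>p\<in>P. e p * ln p))
    \<le> (\<Prod>p\<in>P. 1 - e0 p) * (\<Sum>D\<in>Pow P. (\<Prod>p\<in>D. e0 p / (1 - e0 p)) * exp_step (x - (\<Sum>p\<in>D. ln p)))"
proof -
  let ?V = "\<Prod>p\<in>P. 1 - 1 / real p"
  let ?A = "repeat_mset K (image_mset geo (mset_set P))" and ?E = "image_mset (bern e) (mset_set P)"
  have ge1: "p \<ge> 2" if "p \<in> P" for p using P(2)[OF that] prime_ge_2_nat by blast
  have V: "0 \<le> ?V" by (rule prod_nonneg) (use ge1 in \<open>force simp: divide_le_eq_1\<close>)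
  \<comment> \<open>The Bernoulli operators are applied last, so that Jensen acts on the convex
    minorant \<open>?V ^ K * hinge K\<close> of the geometric part.\<close>
  have "?V ^ K * hinge K (x - (\<Sum>p\<in>P. e p * ln p)) \<le> shift_sums M ?E (shift_sums M ?A exp_step) x"
  proof (rule shift_sums_bern_convex[OF P(1) M e _ convex_hinge])
    show "?V ^ K * hinge K y \<le> shift_sums M ?A exp_step y" if "y \<le> x" for y
      using shift_sums_geo_iterate_ge_hinge[OF P, where x = y and K = "K - 1"] that x K by simp
  qed (use ge1 V in force)+
  also have "\<dots> = shift_sums M (?A + ?E) exp_step x" by (simp only: shift_sum.fold_mset_union)
  also have "\<dots> \<le> shift_sums M (image_mset (bern e0) (mset_set P)) exp_step x"
    using e0 by (intro shift_sums_bern_dominates[OF P(1) ge1 M mono_exp_step exp_step_nonneg e _ dom]) (auto intro: less_imp_le)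
  also have "\<dots> = (\<Prod>p\<in>P. 1 - e0 p) * (\<Sum>D\<in>Pow P. (\<Prod>p\<in>D. e0 p / (1 - e0 p)) * exp_step (x - (\<Sum>p\<in>D. ln p)))"
    using e0 by (intro shift_sums_bern_expand[OF P(1) M]) force
  finally show ?thesis .
qed

section \<open>Tuples of linear forms and the singular series\<close>

lemma power_one_minus_le_quadratic:
  fixes x :: real
  assumes "0 \<le> x" "x \<le> 1"
  shows "(1 - x) ^ K \<le> 1 - K * x + K * (real K - 1) / 2 * x\<^sup>2"
proof (induction K)
  case (Suc K)
  have "(1 - x) ^ Suc K \<le> (1 - x) * (1 - K * x + K * (real K - 1) / 2 * x\<^sup>2)"
    using Suc assms by (simp add: mult_left_mono)
  also have "\<dots> = 1 - Suc K * x + Suc K * (real (Suc K) - 1) / 2 * x\<^sup>2 - K * (real K - 1) / 2 * x ^ 3"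
    by (simp add: field_simps power2_eq_square power3_eq_cube)
  also have "K * (real K - 1) / 2 * x ^ 3 \<ge> 0"
    using assms by (cases K) auto
  then have "1 - Suc K * x + Suc K * (real (Suc K) - 1) / 2 * x\<^sup>2 - K * (real K - 1) / 2 * x ^ 3
    \<le> 1 - Suc K * x + Suc K * (real (Suc K) - 1) / 2 * x\<^sup>2" by simp
  finally show ?case .
qed simp

locale prime_tuple =
  fixes K :: nat and a b :: "nat \<Rightarrow> int"
  assumes K_ge_2: "K \<ge> 2" and E_nonzero: "E_K K a b \<noteq> 0"
    and rho_less: "prime p \<Longrightarrow> rho_K K a b p < p"
begin

abbreviation rho :: "nat \<Rightarrow> nat" where "rho \<equiv> rho_K K a b"

definition R :: "nat \<Rightarrow> nat set" where
  "R p = {m. m < p \<and> [int m * (\<Prod>i\<in>{1..K-1}. a i * int m + b i) = 0] (mod int p)}"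

lemma card_R: "card (R p) = rho p"
  by (simp add: R_def rho_K_def)

sublocale residue_sieve R
  using rho_less by unfold_locales (auto simp: card_R, auto simp: R_def)

lemma in_R_iff: "m \<in> R p \<longleftrightarrow> m < p \<and> int p dvd int m * (\<Prod>i\<in>{1..K-1}. a i * int m + b i)"
  by (simp add: R_def cong_0_iff)

lemma coeffs_not_dvd:
  assumes p: "prime p" and i: "i \<in> {1..K-1}" and "int p dvd a i"
  shows "\<not> int p dvd b i"
proof
  assume "int p dvd b i"
  have "m \<in> R p" if "m < p" for m
  proof -
    have "int p dvd a i * int m + b i" using assms(3) \<open>int p dvd b i\<close> by simp
    then have "int p dvd (\<Prod>i\<in>{1..K-1}. a i * int m + b i)"
      using dvd_prodI[OF _ i, of "\<lambda>i. a i * int m + b i"] dvd_trans by blast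
    then show ?thesis using that by (simp add: in_R_iff)
  qed
  then have "card {..<p} \<le> card (R p)" by (intro card_mono) (auto simp: R_def)
  then show False using rho_less[OF p] by (simp add: card_R)
qed

text \<open>Each of the \<open>K\<close> forms has at most one root modulo \<open>p\<close>. Index 0
  stands for the form \<open>m\<close>; a form whose leading coefficient is divisible by
  \<open>p\<close> has no root at all, because \<open>p\<close> cannot divide both
  coefficients.\<close>

lemma rho_le: assumes p: "prime p" shows "rho p \<le> K"
proof -
  let ?S = "\<lambda>i. if i = 0 then {0} else {m. m < p \<and> int p dvd a i * int m + b i}"
  have pp: "prime (int p)" using p by simp
  have one: "card (?S i) \<le> 1" if i: "i \<in> {..<K}" for i
  proof (cases "i = 0")
    case False
    then have iK: "i \<in> {1..K-1}" using i by auto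
    have "x = y" if x: "x \<in> ?S i" and y: "y \<in> ?S i" for x y
    proof -
      have "int p dvd (a i * int x + b i) - (a i * int y + b i)"
        using x y False by (intro dvd_diff) auto
      then have "int p dvd a i * (int x - int y)" by (simp add: algebra_simps)
      moreover have "\<not> int p dvd a i"
      proof
        assume "int p dvd a i"
        then have "int p dvd a i * int x" by simp
        moreover have "int p dvd a i * int x + b i" using x False by simp
        ultimately have "int p dvd b i" using dvd_add_right_iff by blast
        then show False using coeffs_not_dvd[OF p iK] \<open>int p dvd a i\<close> by blast
      qed
      ultimately have "int p dvd int x - int y" using prime_dvd_multD[OF pp, of "a i" "int x - int y"] by meson
      then have "int x mod int p = int y mod int p" by (simp add: mod_eq_dvd_iff)
      moreover have "x < p" "y < p" using x y False by auto
      ultimately show "x = y" by simp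
    qed
    moreover have "finite (?S i)" by simp
    ultimately have "card (?S i) \<le> Suc 0" unfolding card_le_Suc0_iff_eq[OF \<open>finite (?S i)\<close>] by blast
    then show ?thesis by simp
  qed simp
  have "R p \<subseteq> (\<Union>i\<in>{..<K}. ?S i)"
  proof
    fix m assume "m \<in> R p"
    then have m: "m < p" "int p dvd int m * (\<Prod>i\<in>{1..K-1}. a i * int m + b i)" by (auto simp: in_R_iff)
    have "int p dvd int m \<or> int p dvd (\<Prod>i\<in>{1..K-1}. a i * int m + b i)"
      using m(2) prime_dvd_multD[OF pp] by blast
    then consider "int p dvd int m" | "\<exists>i\<in>{1..K-1}. int p dvd a i * int m + b i"
      unfolding prime_dvd_prod_iff[OF finite_atLeastAtMost pp] by blast
    then show "m \<in> (\<Union>i\<in>{..<K}. ?S i)"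
    proof cases
      case 1
      then have "p dvd m" by simp
      then have "m = 0" using m(1) dvd_imp_le[of p m] by linarith
      then show ?thesis using K_ge_2 by (intro UN_I[of 0]) auto
    next
      case 2
      then obtain i where i: "i \<in> {1..K-1}" "int p dvd a i * int m + b i" by blast
      then show ?thesis using m(1) by (intro UN_I[of i]) auto
    qed
  qed
  then have "card (R p) \<le> card (\<Union>i\<in>{..<K}. ?S i)" by (intro card_mono) auto
  also have "\<dots> \<le> (\<Sum>i<K. card (?S i))" by (rule card_UN_le) simp
  also have "\<dots> \<le> (\<Sum>i<K. 1)" by (intro sum_mono one)
  finally show ?thesis by (simp add: card_R)
qed

lemma zero_in_R: "p > 0 \<Longrightarrow> 0 \<in> R p" by (simp add: in_R_iff)

lemma rho_pos: "p > 0 \<Longrightarrow> rho p \<ge> 1"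
proof -
  assume "p > 0"
  then have "card {0::nat} \<le> card (R p)" by (intro card_mono) (auto simp: zero_in_R, auto simp: R_def)
  then show ?thesis by (simp add: card_R)
qed

lemma coeff_dvd_E: "i \<in> {1..K-1} \<Longrightarrow> a i * b i dvd E_K K a b"
  unfolding E_K_def by (intro dvd_mult2 dvd_prodI) auto

lemma det_dvd_E:
  assumes "1 \<le> i" "i < j" "j \<le> K - 1"
  shows "a i * b j - a j * b i dvd E_K K a b"
proof -
  let ?P = "{(i, j). 1 \<le> i \<and> i < j \<and> j \<le> K - 1}"
  have "finite ?P" by (rule finite_subset[of _ "{..K} \<times> {..K}"]) auto
  then have "(\<lambda>(i, j). a i * b j - a j * b i) (i, j) dvd (\<Prod>(i,j)\<in>?P. a i * b j - a j * b i)"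
    by (rule dvd_prodI) (use assms in auto)
  then show ?thesis unfolding E_K_def by (intro dvd_mult) simp
qed

lemma a_nonzero: "i \<in> {1..K-1} \<Longrightarrow> a i \<noteq> 0"
  using coeff_dvd_E[of i] E_nonzero by auto

text \<open>Such a prime divides neither a coefficient nor a determinant. So every form has a root,
  no root is 0, and a common root of two forms would make \<open>p\<close> divide their
  determinant.\<close>

lemma rho_eq:
  assumes p: "prime p" and "int p > \<bar>E_K K a b\<bar>"
  shows "rho p = K"
proof (rule antisym[OF rho_le[OF p]])
  have pp: "prime (int p)" using p by simp
  have pE: "\<not> int p dvd E_K K a b" using assms(2) E_nonzero zdvd_not_zless[of "\<bar>E_K K a b\<bar>" "int p"] by simp
  have pa: "\<not> int p dvd a i" "\<not> int p dvd b i" if "i \<in> {1..K-1}" for i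
    using coeff_dvd_E[OF that] pE by (metis dvd_mult dvd_mult2 dvd_trans)+
  have "\<exists>m. m < p \<and> int p dvd a i * int m + b i" if i: "i \<in> {1..K-1}" for i
  proof -
    have "coprime (a i) (int p)" using pa(1)[OF i] pp by (metis coprime_commute prime_imp_coprime)
    then obtain x where x: "[a i * x = 1] (mod int p)" using cong_solve_coprime_int by blast
    define m where "m = nat ((- b i * x) mod int p)"
    have m: "int m = (- b i * x) mod int p" "m < p"
      using prime_gt_0_nat[OF p] by (auto simp: m_def nat_less_iff)
    have "[a i * int m + b i = a i * (- b i * x) + b i] (mod int p)"
      unfolding m by (intro cong_add cong_mult cong_refl) (simp add: cong_def)
    also have "a i * (- b i * x) + b i = - b i * (a i * x) + b i" by simp
    also have "[- b i * (a i * x) + b i = - b i * 1 + b i] (mod int p)"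
      by (intro cong_add cong_mult cong_refl x)
    finally have "int p dvd a i * int m + b i" by (simp add: cong_0_iff)
    then show ?thesis using m by blast
  qed
  then obtain s where s: "\<And>i. i \<in> {1..K-1} \<Longrightarrow> s i < p \<and> int p dvd a i * int (s i) + b i" by metis
  define t where "t i = (if i = 0 then 0 else s i)" for i
  have tne: "t i \<noteq> t j" if "i < j" "j < K" for i j
  proof
    assume e: "t i = t j"
    have j: "j \<in> {1..K-1}" using that by auto
    show False
    proof (cases "i = 0")
      case True
      then have "s j = 0" using e that by (simp add: t_def)
      then show False using s[OF j] pa(2)[OF j] by simp
    next
      case False
      then have i: "i \<in> {1..K-1}" using that by auto
      have e': "s i = s j" using e that False by (simp add: t_def)
      have "int p dvd a i * (a j * int (s j) + b j) - a j * (a i * int (s i) + b i)"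
        using s[OF i] s[OF j] by (intro dvd_diff dvd_mult) auto
      also have "\<dots> = a i * b j - a j * b i" using e' by (simp add: algebra_simps)
      finally show False using det_dvd_E[of i j] that False pE dvd_trans by (metis One_nat_def Suc_leI not_gr_zero Suc_pred' less_Suc_eq_le K_ge_2 gr_zeroI i j atLeastAtMost_iff)
    qed
  qed
  then have inj: "inj_on t {..<K}" by (intro linorder_inj_onI) auto
  have "t ` {..<K} \<subseteq> R p"
  proof
    fix m assume "m \<in> t ` {..<K}"
    then obtain i where i: "i < K" "m = t i" by auto
    show "m \<in> R p"
    proof (cases "i = 0")
      case True then show ?thesis using i zero_in_R prime_gt_0_nat[OF p] by (simp add: t_def)
    next
      case False
      then have iK: "i \<in> {1..K-1}" using i by auto
      have "int p dvd (\<Prod>i\<in>{1..K-1}. a i * int m + b i)"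
        using dvd_prodI[OF _ iK, of "\<lambda>i. a i * int m + b i"] s[OF iK] i False by (auto simp: t_def intro: dvd_trans)
      then show ?thesis using s[OF iK] i False by (auto simp: in_R_iff t_def)
    qed
  qed
  then have "card (t ` {..<K}) \<le> card (R p)" by (intro card_mono) (auto simp: R_def)
  then show "K \<le> rho p" by (simp add: card_image[OF inj] card_R)
qed

section \<open>Local factors and convergence of the singular product\<close>

definition euler :: "nat \<Rightarrow> real" where
  "euler p = (1 - rho p / p) / (1 - 1 / p) ^ K"

lemma euler_pos: assumes "prime p" shows "euler p > 0"
proof -
  have "real (rho p) < p" "p > 1" using rho_less[OF assms] prime_gt_1_nat[OF assms] by auto
  then show ?thesis unfolding euler_def by (intro divide_pos_pos zero_less_power) auto
qed

text \<open>To second order \<open>(1 - 1 / p) ^ K\<close> exceeds \<open>1 - K / p\<close> by at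
  most \<open>K^2 / (2 p^2)\<close>, and for \<open>p >= 2 K\<close> the denominator is at least
  \<open>1/2\<close>.\<close>

lemma euler_ge:
  assumes p: "prime p" and "p \<ge> 2 * K"
  shows "euler p \<ge> 1 - (real K)\<^sup>2 / (real p)\<^sup>2"
proof -
  have p0: "p > 1" using prime_gt_1_nat[OF p] .
  let ?x = "1 / real p" and ?b = "(1 - 1 / real p) ^ K"
  have x: "0 \<le> ?x" "?x \<le> 1" using p0 by auto
  have "1 - K * ?x \<le> ?b"
    using Bernoulli_inequality[of "- ?x" K] x by simp
  moreover have "K * ?x \<le> 1 / 2" using assms p0 by (simp add: field_simps flip: of_nat_mult)
  ultimately have b: "?b \<ge> 1 / 2" by linarith
  have "?b \<le> 1 - K * ?x + K * (real K - 1) / 2 * ?x\<^sup>2"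
    by (rule power_one_minus_le_quadratic[OF x])
  also have "K * (real K - 1) / 2 * ?x\<^sup>2 \<le> (real K)\<^sup>2 / 2 * ?x\<^sup>2"
    by (intro mult_right_mono divide_right_mono) (auto simp: power2_eq_square algebra_simps)
  finally have "?b - (real K)\<^sup>2 * ?x\<^sup>2 * (1 / 2) \<le> 1 - K * ?x" by simp
  moreover have "(real K)\<^sup>2 * ?x\<^sup>2 * (1 / 2) \<le> (real K)\<^sup>2 * ?x\<^sup>2 * ?b" using b by (intro mult_left_mono) auto
  ultimately have "(1 - (real K)\<^sup>2 * ?x\<^sup>2) * ?b \<le> 1 - K * ?x" by (simp add: algebra_simps)
  also have "\<dots> \<le> 1 - rho p * ?x" using rho_le[OF p] x by (simp add: divide_right_mono)
  finally have "1 - (real K)\<^sup>2 * ?x\<^sup>2 \<le> (1 - rho p * ?x) / ?b" using b by (simp add: pos_le_divide_eq)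
  then show ?thesis by (simp add: euler_def power_divide)
qed

lemma euler_le_1:
  assumes p: "prime p" and "rho p = K"
  shows "euler p \<le> 1"
proof -
  have p0: "p > 1" using prime_gt_1_nat[OF p] .
  have "1 - K * (1 / p) \<le> (1 - 1 / p) ^ K"
    using Bernoulli_inequality[of "- (1 / p)" K] p0 by simp
  moreover have "(1 - 1 / real p) ^ K > 0" using p0 by simp
  ultimately show ?thesis using assms(2) by (simp add: euler_def)
qed

text \<open>Beyond \<open>2 K\<close> and the absolute value of \<open>E_K\<close> the factors lie
  between \<open>1 - K^2 / p^2\<close> and 1, so the product converges absolutely. Later bounds on
  \<open>sing_prod\<close> are proved for finite products and passed to the limit.\<close>

lemma sing_prod_LIMSEQ: "(\<lambda>n. \<Prod>p | prime p \<and> p \<le> n. euler p) \<longlonglongrightarrow> sing_prod K a b"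
proof -
  define g where "g = (\<lambda>p. if prime p then euler p else 1)"
  have sing: "sing_prod K a b = prodinf g"
    unfolding sing_prod_def g_def
    by (rule arg_cong[where f = prodinf]) (auto simp: fun_eq_iff euler_def power_int_minus field_simps)
  have "summable (\<lambda>n. (real K)\<^sup>2 * inverse ((real n) ^ 2))"
    by (intro summable_mult inverse_power_summable) auto
  moreover have "eventually (\<lambda>n. norm (norm (g n - 1)) \<le> (real K)\<^sup>2 * inverse ((real n) ^ 2)) sequentially"
    using eventually_ge_at_top[of "max (2 * K) (Suc (nat \<bar>E_K K a b\<bar>))"]
  proof eventually_elim
    case (elim n)
    show ?case
    proof (cases "prime n")
      case True
      have "rho n = K" using elim by (intro rho_eq True) auto
      then have "euler n \<le> 1" using euler_le_1 True by blast
      moreover have "euler n \<ge> 1 - (real K)\<^sup>2 / (real n)\<^sup>2" using elim by (intro euler_ge True) auto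
      ultimately show ?thesis using True by (simp add: g_def divide_inverse)
    qed (simp add: g_def)
  qed
  ultimately have "summable (\<lambda>n. norm (g n - 1))" by (rule summable_comparison_test_ev[rotated])
  then have "convergent_prod g"
    by (intro abs_convergent_prod_imp_convergent_prod summable_imp_abs_convergent_prod)
  then have "(\<lambda>n. \<Prod>i\<le>n. g i) \<longlonglongrightarrow> prodinf g" by (rule convergent_prod_LIMSEQ)
  moreover have "(\<Prod>i\<le>n. g i) = (\<Prod>p | prime p \<and> p \<le> n. euler p)" for n
    unfolding g_def by (subst prod.inter_filter[symmetric]) (auto intro!: prod.cong)
  ultimately show ?thesis by (simp add: sing)
qed

end

section \<open>The sieve bound\<close>

lemma prime_factors_prod_primes:
  assumes "finite D" "\<And>p. p \<in> D \<Longrightarrow> prime (p::nat)"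
  shows "prime_factors (\<Prod>D) = D"
proof -
  have "0 \<notin> (\<lambda>p. p) ` D" using assms(2)[of 0] by auto
  from prime_factors_prod[OF assms(1) this] have "prime_factors (\<Prod>D) = (\<Union>p\<in>D. prime_factors p)"
    by (simp add: o_def)
  also have "\<dots> = D" using assms(2) by (auto simp: prime_prime_factors)
  finally show ?thesis .
qed

lemma squarefree_prod_primes:
  assumes "finite D" "\<And>p. p \<in> D \<Longrightarrow> prime (p::nat)"
  shows "squarefree (\<Prod>D)"
proof (rule squarefree_prod_coprime)
  show "coprime p q" if "p \<in> D" "q \<in> D" "p \<noteq> q" for p q
    by (rule primes_coprime) (use assms(2) that in auto)
  show "squarefree p" if "p \<in> D" for p by (rule squarefree_prime) (use assms(2) that in auto)
qed

lemma prod_prime_factors_le: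
  assumes "q > (0::nat)"
  shows "(\<Prod>p\<in>prime_factors q. p) \<le> q"
proof -
  have "(\<Prod>p\<in>prime_factors q. p) \<le> (\<Prod>p\<in>prime_factors q. p ^ multiplicity p q)"
  proof (rule prod_mono)
    fix p assume p: "p \<in> prime_factors q"
    then have "multiplicity p q \<ge> 1" "p \<ge> 1"
      by (auto simp: prime_factors_multiplicity Suc_le_eq prime_gt_0_nat)
    then show "0 \<le> p \<and> p \<le> p ^ multiplicity p q" using self_le_power[of p "multiplicity p q"] by auto
  qed
  also have "\<dots> = q" using assms by (rule prime_factorization_nat[symmetric])
  finally show ?thesis .
qed

context prime_tuple
begin

definition defect :: "nat \<Rightarrow> real" where "defect p = max 0 (1 - euler p)"

definition sieve_sum :: "real \<Rightarrow> real" where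
  "sieve_sum z = (\<Sum>q | 0 < q \<and> real q \<le> z \<and> squarefree q. h q * exp_step (ln z - ln q))"

definition mean_bound :: "real \<Rightarrow> bool" where
  "mean_bound \<mu> \<longleftrightarrow> (\<forall>P. finite P \<longrightarrow> (\<forall>p\<in>P. prime p) \<longrightarrow> (\<Sum>p\<in>P. defect p * ln p) \<le> \<mu>)"

lemma finite_sieve_support: "finite {q. 0 < q \<and> real q \<le> z \<and> squarefree q}"
  by (rule finite_subset[OF _ finite_nat_real_le[of z]]) auto

text \<open>\<open>D\<close> corresponds to the squarefree number \<open>\<Prod>D\<close>. Products
  exceeding \<open>z\<close> drop out because \<open>exp_step\<close> vanishes at negative
  arguments, so \<open>P\<close> may contain primes far beyond \<open>z\<close>.\<close>

lemma sum_Pow_primes_le_sieve_sum: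
  assumes P: "finite P" "\<And>p. p \<in> P \<Longrightarrow> prime p" and z: "z > 0"
  shows "(\<Sum>D\<in>Pow P. (\<Prod>p\<in>D. rho p / (real p - rho p)) * exp_step (ln z - (\<Sum>p\<in>D. ln p))) \<le> sieve_sum z"
proof -
  let ?Q = "{q. 0 < q \<and> real q \<le> z \<and> squarefree q}"
  let ?t = "\<lambda>q. h q * exp_step (ln z - ln (real q))"
  have D: "finite D" "\<And>p. p \<in> D \<Longrightarrow> prime p" if "D \<in> Pow P" for D
    using that P by (auto intro: finite_subset)
  have inj: "inj_on (\<lambda>D. \<Prod>D) (Pow P)"
    by (rule inj_on_inverseI[of _ prime_factors]) (rule prime_factors_prod_primes[OF D])
  have "(\<Sum>D\<in>Pow P. (\<Prod>p\<in>D. rho p / (real p - rho p)) * exp_step (ln z - (\<Sum>p\<in>D. ln p)))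
      = (\<Sum>D\<in>Pow P. ?t (\<Prod>D))"
  proof (intro sum.cong refl)
    fix D assume DP: "D \<in> Pow P"
    have "prime_factors (\<Prod>D) = D" by (rule prime_factors_prod_primes) (use D[OF DP] in auto)
    then have "h (\<Prod>D) = (\<Prod>p\<in>D. rho p / (real p - rho p))"
      by (simp only: h_def card_R)
    moreover have "ln (real (\<Prod>D)) = (\<Sum>p\<in>D. ln p)"
      unfolding of_nat_prod by (rule ln_prod) (use D[OF DP] in \<open>auto intro: prime_gt_0_nat\<close>)
    ultimately show "(\<Prod>p\<in>D. rho p / (real p - rho p)) * exp_step (ln z - (\<Sum>p\<in>D. ln p)) = ?t (\<Prod>D)"
      by simp
  qed
  also have "\<dots> = (\<Sum>q\<in>(\<lambda>D. \<Prod>D) ` Pow P. ?t q)" by (simp add: sum.reindex[OF inj])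
  also have "\<dots> = (\<Sum>q\<in>(\<lambda>D. \<Prod>D) ` Pow P \<inter> ?Q. ?t q)"
  proof (rule sum.mono_neutral_right)
    show "\<forall>q\<in>(\<lambda>D. \<Prod>D) ` Pow P - (\<lambda>D. \<Prod>D) ` Pow P \<inter> ?Q. ?t q = 0"
    proof
      fix q assume q: "q \<in> (\<lambda>D. \<Prod>D) ` Pow P - (\<lambda>D. \<Prod>D) ` Pow P \<inter> ?Q"
      then obtain D where DP: "D \<in> Pow P" "q = \<Prod>D" by auto
      have "squarefree q" using squarefree_prod_primes[OF D[OF DP(1)]] DP by simp
      moreover then have q0: "q > 0" by (intro gr0I) auto
      ultimately have "real q > z" using q by auto
      then have "ln (real q) > ln z" using z q0 by simp
      then show "?t q = 0" by (simp add: exp_step_def)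
    qed
  qed (use P in auto)
  also have "\<dots> \<le> (\<Sum>q\<in>?Q. ?t q)"
    by (rule sum_mono2) (auto simp: finite_sieve_support h_nonneg exp_step_nonneg)
  finally show ?thesis by (simp add: sieve_sum_def)
qed

lemma hinge_mono: "x \<le> y \<Longrightarrow> hinge j x \<le> hinge j y"
  unfolding hinge_def by (intro divide_right_mono power_mono) auto

text \<open>The domination theorem is applied with all primes up to \<open>n\<close>. The factor
  \<open>(\<Prod>p. 1 - 1 / p) ^ K\<close> tends to 0, but it occurs on both sides and cancels,
  leaving the finite product of \<open>euler p\<close>; then \<open>n\<close> tends to infinity with
  \<open>z\<close> fixed.\<close>

theorem sieve_sum_lower_bound:
  assumes z: "z \<ge> 1" and mu: "mean_bound \<mu>"
  shows "hinge K (ln z - \<mu>) \<le> sing_prod K a b * sieve_sum z"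
proof -
  define M where "M = nat \<lfloor>z\<rfloor>"
  have M: "M \<ge> 1" "z \<le> real M + 1" using z unfolding M_def by linarith+
  have "hinge K (ln z - \<mu>) \<le> (\<Prod>p | prime p \<and> p \<le> n. euler p) * sieve_sum z" if n: "n \<ge> M" for n
  proof -
    let ?P = "{p. prime p \<and> p \<le> n}" and ?e0 = "\<lambda>p. real (rho p) / real p"
    have fin: "finite ?P" by simp
    have p1: "real p > 1" "real (rho p) < p" if "p \<in> ?P" for p
      using that prime_gt_1_nat[of p] rho_less[of p] by auto
    have b0: "(1 - 1 / real p) ^ K > 0" if "p \<in> ?P" for p using p1[OF that] by simp
    have be: "(1 - 1 / real p) ^ K * euler p = 1 - ?e0 p" if "p \<in> ?P" for p
    proof -
      have "(1 - 1 / real p) ^ K \<noteq> 0" using b0[OF that] by linarith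
      then show ?thesis unfolding euler_def by (metis nonzero_mult_div_cancel_left times_divide_eq_right)
    qed
    have "(\<Prod>p\<in>?P. 1 - 1 / p) ^ K * hinge K (ln z - (\<Sum>p\<in>?P. defect p * ln p))
      \<le> (\<Prod>p\<in>?P. 1 - ?e0 p) * (\<Sum>D\<in>Pow ?P. (\<Prod>p\<in>D. ?e0 p / (1 - ?e0 p)) * exp_step (ln z - (\<Sum>p\<in>D. ln p)))"
    proof (rule bernoulli_sum_lower_bound[where M = M])
      show "ln z \<le> ln (real M + 1)" using z M by simp
      fix p assume p: "p \<in> ?P"
      show "0 \<le> defect p \<and> defect p \<le> 1" using euler_pos[of p] p by (simp add: defect_def)
      show "0 \<le> ?e0 p \<and> ?e0 p < 1" using p1[OF p] by simp
      have "(1 - 1 / p) ^ K * (1 - defect p) \<le> (1 - 1 / p) ^ K * euler p"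
        using b0[OF p] by (intro mult_left_mono) (auto simp: defect_def)
      also have "\<dots> = 1 - ?e0 p" by (rule be[OF p])
      finally show "(1 - 1 / p) ^ K * (1 - defect p) \<le> 1 - ?e0 p" .
    qed (use fin M K_ge_2 n in auto)
    also have "(\<Sum>D\<in>Pow ?P. (\<Prod>p\<in>D. ?e0 p / (1 - ?e0 p)) * exp_step (ln z - (\<Sum>p\<in>D. ln p)))
        = (\<Sum>D\<in>Pow ?P. (\<Prod>p\<in>D. rho p / (real p - rho p)) * exp_step (ln z - (\<Sum>p\<in>D. ln p)))"
    proof (intro sum.cong refl arg_cong2[where f = "(*)"] prod.cong)
      fix D p assume "D \<in> Pow ?P" "p \<in> D"
      then have "p \<in> ?P" by auto
      then show "?e0 p / (1 - ?e0 p) = rho p / (real p - rho p)" using p1[of p] by (simp add: field_simps)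
    qed
    also have "(\<Prod>p\<in>?P. 1 - ?e0 p) * \<dots> \<le> (\<Prod>p\<in>?P. 1 - ?e0 p) * sieve_sum z"
    proof (intro mult_left_mono sum_Pow_primes_le_sieve_sum prod_nonneg)
      show "0 \<le> 1 - ?e0 p" if "p \<in> ?P" for p using p1[OF that] by simp
    qed (use z in auto)
    also have "(\<Prod>p\<in>?P. 1 - ?e0 p) = (\<Prod>p\<in>?P. 1 - 1 / p) ^ K * (\<Prod>p\<in>?P. euler p)"
      unfolding prod_power_distrib prod.distrib[symmetric]
    by (intro prod.cong refl) (simp only: be)
    finally have "(\<Prod>p\<in>?P. 1 - 1 / p) ^ K * hinge K (ln z - (\<Sum>p\<in>?P. defect p * ln p))
        \<le> (\<Prod>p\<in>?P. 1 - 1 / p) ^ K * ((\<Prod>p\<in>?P. euler p) * sieve_sum z)" by (simp only: mult.assoc)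
    moreover have "(\<Prod>p\<in>?P. 1 - 1 / p) ^ K > 0" unfolding prod_power_distrib by (intro prod_pos b0)
    ultimately have "hinge K (ln z - (\<Sum>p\<in>?P. defect p * ln p)) \<le> (\<Prod>p\<in>?P. euler p) * sieve_sum z"
      by (simp only: mult_le_cancel_left_pos)
    moreover have "(\<Sum>p\<in>?P. defect p * ln p) \<le> \<mu>" using mu fin unfolding mean_bound_def by blast
    ultimately show ?thesis using hinge_mono[of "ln z - \<mu>" "ln z - (\<Sum>p\<in>?P. defect p * ln p)" K] by linarith
  qed
  then show ?thesis
    by (intro LIMSEQ_le_const[OF tendsto_mult_right[OF sing_prod_LIMSEQ]]) blast
qed

lemma sing_prod_nonneg: "sing_prod K a b \<ge> 0"
  by (rule LIMSEQ_le_const[OF sing_prod_LIMSEQ]) (auto intro!: prod_nonneg less_imp_le[OF euler_pos])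

lemma h_le: assumes "q > 0" shows "h q \<le> q"
proof -
  have "h q \<le> (\<Prod>p\<in>prime_factors q. real p)"
    unfolding h_def
  proof (rule prod_mono)
    fix p assume "p \<in> prime_factors q"
    then have p: "prime p" by auto
    have r: "real (card (R p)) + 1 \<le> real p" using rho_less[OF p] unfolding card_R by linarith
    then have "real (card (R p)) / (real p - real (card (R p))) \<le> real (card (R p)) / 1"
      by (intro divide_left_mono) auto
    then show "0 \<le> real (card (R p)) / (real p - real (card (R p))) \<and> real (card (R p)) / (real p - real (card (R p))) \<le> real p"
      using r by auto
  qed
  also have "\<dots> \<le> q" using prod_prime_factors_le[OF assms] by (simp flip: of_nat_prod)
  finally show ?thesis .
qed

text \<open>Crude, but applied only at one \<open>z\<close> depending on \<mu>, to bound the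
  singular product from below independently of the coefficients.\<close>

lemma sieve_sum_le: assumes "z > 0" shows "sieve_sum z \<le> z\<^sup>2"
proof -
  have "sieve_sum z \<le> (\<Sum>q | 0 < q \<and> real q \<le> z \<and> squarefree q. z)"
    unfolding sieve_sum_def
  proof (rule sum_mono)
    fix q assume q: "q \<in> {q. 0 < q \<and> real q \<le> z \<and> squarefree q}"
    have "h q * exp_step (ln z - ln q) \<le> h q * 1"
      by (intro mult_left_mono h_nonneg) (auto simp: exp_step_def)
    then show "h q * exp_step (ln z - ln q) \<le> z" using h_le[of q] q by auto
  qed
  also have "\<dots> = card {q. 0 < q \<and> real q \<le> z \<and> squarefree q} * z" by simp
  also have "\<dots> \<le> z * z"
  proof (rule mult_right_mono)
    have "card {q. 0 < q \<and> real q \<le> z \<and> squarefree q} \<le> card {1..nat \<lfloor>z\<rfloor>}"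
      by (intro card_mono) (auto simp: le_nat_floor)
    then have "card {q. 0 < q \<and> real q \<le> z \<and> squarefree q} \<le> nat \<lfloor>z\<rfloor>" by simp
    then show "real (card {q. 0 < q \<and> real q \<le> z \<and> squarefree q}) \<le> z" using assms by linarith
  qed (use assms in simp)
  finally show ?thesis by (simp add: power2_eq_square)
qed

text \<open>Apply \<open>sieve_sum_lower_bound\<close> with \<open>ln z = 2 + \<mu>\<close>.\<close>

lemma sing_prod_lower_bound:
  assumes mu: "mean_bound \<mu>"
  shows "sing_prod K a b \<ge> exp (- 4 - 2 * \<mu>) / fact K"
proof -
  have "\<mu> \<ge> 0" using mu unfolding mean_bound_def by (metis empty_iff finite.emptyI sum.empty)
  then have "hinge K (ln (exp (2 + \<mu>)) - \<mu>) \<le> sing_prod K a b * sieve_sum (exp (2 + \<mu>))"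
    by (intro sieve_sum_lower_bound mu) simp
  also have "\<dots> \<le> sing_prod K a b * (exp (2 + \<mu>))\<^sup>2"
    by (intro mult_left_mono sieve_sum_le sing_prod_nonneg) simp
  finally have "1 / fact K \<le> sing_prod K a b * exp (4 + 2 * \<mu>)"
    by (simp add: hinge_def power2_eq_square flip: exp_add)
  then have "exp (- (4 + 2 * \<mu>)) * (1 / fact K) \<le> exp (- (4 + 2 * \<mu>)) * (sing_prod K a b * exp (4 + 2 * \<mu>))"
    by (intro mult_left_mono) auto
  also have "\<dots> = sing_prod K a b * exp (- (4 + 2 * \<mu>) + (4 + 2 * \<mu>))" unfolding exp_add by (simp only: mult_ac)
  also have "\<dots> = sing_prod K a b" by simp
  finally show ?thesis by simp
qed

text \<open>With \<open>z = sqrt X / 2\<close> the sieve weight is at most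
  \<open>X + 4 q z = X (1 + q / z)\<close>, and \<open>1 - q / z <= 1 / (1 + q / z)\<close>. This is
  where the profile \<open>exp_step\<close> of the sieve sum originates.\<close>

theorem sifted_set_bound:
  assumes X: "X \<ge> 4" and N: "real N \<le> X" and T: "T \<subseteq> {1..N}" and mu: "mean_bound \<mu>"
    and avoid: "\<And>n p. n \<in> T \<Longrightarrow> prime p \<Longrightarrow> real p \<le> sqrt X / 2 \<Longrightarrow> n mod p \<notin> R p"
  shows "card T * hinge K (ln X / 2 - ln 2 - \<mu>) \<le> sing_prod K a b * X"
proof -
  define z where "z = sqrt X / 2"
  have z: "z \<ge> 1" "4 * z * z = X" using X real_le_rsqrt[of 2 X] by (auto simp: z_def)
  have lnz: "ln z = ln X / 2 - ln 2" using X by (simp add: z_def ln_div ln_sqrt)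
  let ?Q = "{q. 0 < q \<and> real q \<le> z \<and> squarefree q}"
  have "sieve_sum z \<le> X * (\<Sum>q\<in>?Q. h q / (N + 4 * real q * z))"
    unfolding sieve_sum_def sum_distrib_left
  proof (rule sum_mono)
    fix q assume q: "q \<in> ?Q"
    have "exp_step (ln z - ln q) = 1 - q / z"
      using q z by (simp add: exp_step_def exp_diff)
    also have "\<dots> \<le> 1 / (1 + q / z)"
    proof -
      have "(1 - q / z) * (1 + q / z) \<le> 1" by (simp add: algebra_simps)
      then show ?thesis using q z by (simp add: pos_le_divide_eq add_pos_nonneg)
    qed
    also have "\<dots> = X / (X + 4 * real q * z)"
    proof -
      have "X + 4 * real q * z = X * (1 + q / z)" using z(1) unfolding z(2)[symmetric] by (simp add: field_simps)
      then show ?thesis using X by simp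
    qed
    also have "\<dots> \<le> X / (N + 4 * real q * z)"
      using q z N X by (intro divide_left_mono add_mono mult_pos_pos add_nonneg_pos) auto
    finally have "h q * exp_step (ln z - ln q) \<le> h q * (X / (N + 4 * real q * z))"
      by (intro mult_left_mono h_nonneg)
    then show "h q * exp_step (ln z - ln q) \<le> X * (h q / (N + 4 * real q * z))" by (simp add: mult_ac)
  qed
  then have "card T * sieve_sum z \<le> card T * (X * (\<Sum>q\<in>?Q. h q / (N + 4 * real q * z)))"
    by (intro mult_left_mono) auto
  also have "\<dots> = X * (card T * (\<Sum>q\<in>?Q. h q / (N + 4 * real q * z)))" by (simp add: mult_ac)
  also have "\<dots> \<le> X * 1"
    using X z avoid by (intro mult_left_mono large_sieve_bound T) (auto simp: z_def)
  finally have c: "card T * sieve_sum z \<le> X" by simp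
  have "card T * hinge K (ln X / 2 - ln 2 - \<mu>) \<le> card T * (sing_prod K a b * sieve_sum z)"
    using sieve_sum_lower_bound[OF z(1) mu] by (intro mult_left_mono) (auto simp: lnz)
  also have "\<dots> = sing_prod K a b * (card T * sieve_sum z)" by simp
  also have "\<dots> \<le> sing_prod K a b * X" by (intro mult_left_mono c sing_prod_nonneg)
  finally show ?thesis .
qed

theorem pi_K_bound:
  assumes X: "X \<ge> 4" and mu: "mean_bound \<mu>"
  shows "(pi_K K a b X - K * sqrt X / 2) * hinge K (ln X / 2 - ln 2 - \<mu>) \<le> sing_prod K a b * X"
proof -
  define z where "z = sqrt X / 2"
  define A where "A = {p::nat. prime p \<and> real p \<le> X \<and> (\<forall>i\<in>{1..K-1}. prime (a i * int p + b i))}"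
  \<comment> \<open>The counted primes for which \<open>p\<close> or one of the values
    \<open>a i * p + b i\<close> is at most \<open>z\<close> lie in \<open>B\<close>. Each of the
    \<open>K\<close> forms is injective and contributes at most \<open>z\<close> elements; the
    intervals start at 1 because integer primes are positive.\<close>
  define B where "B = {1..nat \<lfloor>z\<rfloor>} \<union> (\<Union>i\<in>{1..K-1}. {p. a i * int p + b i \<in> {1..int (nat \<lfloor>z\<rfloor>)}})"
  have z0: "z \<ge> 0" using X by (simp add: z_def)
  have one: "finite {p::nat. a i * int p + b i \<in> {1..int n}} \<and> card {p::nat. a i * int p + b i \<in> {1..int n}} \<le> n"
    if i: "i \<in> {1..K-1}" for i n
  proof -
    let ?f = "\<lambda>p::nat. a i * int p + b i"
    have inj: "inj_on ?f A" for A using a_nonzero[OF i] by (auto simp: inj_on_def)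
    have sub: "?f ` {p. ?f p \<in> {1..int n}} \<subseteq> {1..int n}" by auto
    then have "finite (?f ` {p. ?f p \<in> {1..int n}})" by (rule finite_subset) simp
    then have "finite {p. ?f p \<in> {1..int n}}" using finite_imageD[OF _ inj] by blast
    moreover have "card {p. ?f p \<in> {1..int n}} \<le> card {1..int n}"
      by (rule card_inj_on_le[OF inj sub]) simp
    ultimately show ?thesis by simp
  qed
  have finB: "finite B" unfolding B_def using one by blast
  have "card B \<le> card {1..nat \<lfloor>z\<rfloor>} + card (\<Union>i\<in>{1..K-1}. {p::nat. a i * int p + b i \<in> {1..int (nat \<lfloor>z\<rfloor>)}})"
    unfolding B_def by (rule card_Un_le)
  also have "card (\<Union>i\<in>{1..K-1}. {p::nat. a i * int p + b i \<in> {1..int (nat \<lfloor>z\<rfloor>)}})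
      \<le> (\<Sum>i\<in>{1..K-1}. card {p::nat. a i * int p + b i \<in> {1..int (nat \<lfloor>z\<rfloor>)}})"
    by (rule card_UN_le) simp
  also have "\<dots> \<le> (\<Sum>i\<in>{1..K-1}. nat \<lfloor>z\<rfloor>)" using one by (intro sum_mono) blast
  finally have "card B \<le> K * nat \<lfloor>z\<rfloor>" using K_ge_2 by (cases K) auto
  then have "real (card B) \<le> K * real (nat \<lfloor>z\<rfloor>)" by (simp flip: of_nat_mult)
  also have "\<dots> \<le> K * z" using z0 by (intro mult_left_mono) auto
  finally have cB: "real (card B) \<le> K * sqrt X / 2" by (simp add: z_def)
  define T where "T = A - B"
  have finA: "finite A"
    by (rule finite_subset[of _ "{..nat \<lfloor>X\<rfloor>}"]) (auto simp: A_def le_nat_floor)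
  have "card A - card B \<le> card T" unfolding T_def by (rule diff_card_le_card_Diff[OF finB])
  then have "real (card A) - real (card B) \<le> card T" by linarith
  then have cT: "pi_K K a b X - K * sqrt X / 2 \<le> card T" using cB by (simp add: pi_K_def A_def)
  have big: "prime l \<Longrightarrow> real l \<le> z \<Longrightarrow> n \<in> T \<Longrightarrow> n mod l \<notin> R l" for l n
  proof
    assume l: "prime l" "real l \<le> z" and n: "n \<in> T" and mem: "n mod l \<in> R l"
    have ll: "l \<le> nat \<lfloor>z\<rfloor>" using l by (simp add: le_nat_floor)
    have pl: "prime (int l)" using l by simp
    have nn: "prime n" "\<And>i. i \<in> {1..K-1} \<Longrightarrow> prime (a i * int n + b i)" "n \<notin> B" using n by (auto simp: T_def A_def)
    have "[int (n mod l) * (\<Prod>i\<in>{1..K-1}. a i * int (n mod l) + b i) = int n * (\<Prod>i\<in>{1..K-1}. a i * int n + b i)] (mod int l)"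
      by (intro cong_mult cong_prod cong_add cong_refl) (simp_all add: cong_def zmod_int)
    moreover have "int l dvd int (n mod l) * (\<Prod>i\<in>{1..K-1}. a i * int (n mod l) + b i)"
      using mem unfolding in_R_iff by (rule conjunct2)
    ultimately have "int l dvd int n * (\<Prod>i\<in>{1..K-1}. a i * int n + b i)"
      using cong_dvd_iff by blast
    then have "int l dvd int n \<or> int l dvd (\<Prod>i\<in>{1..K-1}. a i * int n + b i)"
      using prime_dvd_multD[OF pl] by blast
    then show False
    proof
      assume "int l dvd int n"
      then have "l dvd n" by simp
      then have "l = n" by (rule primes_dvd_imp_eq[OF l(1) nn(1)])
      then have "n \<in> {1..nat \<lfloor>z\<rfloor>}" using ll prime_gt_0_nat[OF l(1)] by simp
      then show False using nn(3) unfolding B_def by blast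
    next
      assume "int l dvd (\<Prod>i\<in>{1..K-1}. a i * int n + b i)"
      then obtain i where i: "i \<in> {1..K-1}" "int l dvd a i * int n + b i"
        unfolding prime_dvd_prod_iff[OF finite_atLeastAtMost pl] by blast
      \<comment> \<open>One prime dividing another equals it, so the value would be at most
        \<open>z\<close> and \<open>n\<close> would belong to \<open>B\<close>.\<close>
      then have "int l = a i * int n + b i" using primes_dvd_imp_eq[OF pl nn(2)[OF i(1)]] by simp
      moreover have "1 \<le> int l" "int l \<le> int (nat \<lfloor>z\<rfloor>)" using ll prime_gt_0_nat[OF l(1)] by linarith+
      ultimately have "a i * int n + b i \<in> {1..int (nat \<lfloor>z\<rfloor>)}" by simp
      then show False using nn(3) i(1) unfolding B_def by blast
    qed
  qed
  have "(pi_K K a b X - K * sqrt X / 2) * hinge K (ln X / 2 - ln 2 - \<mu>) \<le> card T * hinge K (ln X / 2 - ln 2 - \<mu>)"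
    using cT by (intro mult_right_mono hinge_nonneg)
  also have "\<dots> \<le> sing_prod K a b * X"
  proof (rule sifted_set_bound[where N = "nat \<lfloor>X\<rfloor>", OF X _ _ mu])
    show "T \<subseteq> {1..nat \<lfloor>X\<rfloor>}" by (auto simp: T_def A_def le_nat_floor Suc_le_eq prime_gt_0_nat)
    show "real (nat \<lfloor>X\<rfloor>) \<le> X" using X by simp
  qed (use big in \<open>auto simp: z_def\<close>)
  finally show ?thesis .
qed

end

section \<open>Explicit constants\<close>

text \<open>\<open>- (ln t + 1) / t\<close> is a primitive of \<open>ln t / t^2\<close>, so the
  bound telescopes. After \<open>ln y - ln x <= (y - x) / x\<close> the difference of the two sides
  has the sign of \<open>x * ln y - y\<close>, which the last hypothesis makes nonnegative.\<close>

lemma ln_over_square_le: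
  fixes x y :: real
  assumes "0 < x" "x < y" "y \<le> x * ln y"
  shows "(y - x) * (ln y / y\<^sup>2) \<le> (ln x + 1) / x - (ln y + 1) / y"
proof -
  have y: "y > 0" using assms by simp
  have "1 + (y - x) / x = y / x" using assms by (simp add: field_simps)
  then have "ln y - ln x = ln (1 + (y - x) / x)" using assms y by (simp add: ln_div)
  also have "\<dots> \<le> (y - x) / x" by (rule ln_add_one_self_le_self) (use assms in auto)
  finally have "ln x \<ge> ln y - (y - x) / x" by simp
  then have "(ln x + 1) / x \<ge> (ln y - (y - x) / x + 1) / x" using assms by (intro divide_right_mono) auto
  moreover have "(ln y - (y - x) / x + 1) / x - (ln y + 1) / y - (y - x) * (ln y / y\<^sup>2)
      = (y - x)\<^sup>2 * (x * ln y - y) / (x\<^sup>2 * y\<^sup>2)"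
    using assms(1) y by (simp add: field_simps power2_eq_square)
  moreover have "(y - x)\<^sup>2 * (x * ln y - y) / (x\<^sup>2 * y\<^sup>2) \<ge> 0" using assms by (intro divide_nonneg_nonneg mult_nonneg_nonneg) auto
  ultimately show ?thesis by linarith
qed

lemma ln_bounds_small:
  "ln 4 \<ge> (4/3 :: real)" "ln 5 \<le> (25/14 :: real)" "ln 8 \<le> (25/12 :: real)" "ln 16 \<le> (25/9 :: real)"
proof -
  have "ln (2 ^ n) = n * ln (2::real)" for n by (rule ln_realpow)
  from this[of 2] this[of 3] this[of 4] show "ln 4 \<ge> (4/3 :: real)" "ln 8 \<le> (25/12 :: real)" "ln 16 \<le> (25/9 :: real)"
    using ln2_ge_two_thirds ln2_le_25_over_36 by simp_all
  have "2 * ln (5::real) = ln 25" using ln_realpow[of 5 2] by simp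
  also have "\<dots> \<le> ln 32" by simp
  also have "\<dots> = 5 * ln (2::real)" using ln_realpow[of 2 5] by simp
  finally show "ln 5 \<le> (25/14 :: real)" using ln2_le_25_over_36 by simp
qed

lemma ln_ge_four_thirds: "(4::real) \<le> x \<Longrightarrow> 4/3 \<le> ln x"
proof -
  assume "4 \<le> x"
  then have "ln 4 \<le> ln x" by (subst ln_le_cancel_iff) auto
  then show ?thesis using ln_bounds_small(1) by linarith
qed

lemma sum_ln_over_square_le:
  fixes m :: nat and P :: "nat set"
  assumes "m \<ge> 4" "finite P" "\<And>p. p \<in> P \<Longrightarrow> p > m"
  shows "(\<Sum>p\<in>P. ln (real p) / (real p)\<^sup>2) \<le> (ln m + 1) / m"
proof -
  have step: "ln (real (Suc n)) / (real (Suc n))\<^sup>2 \<le> (ln n + 1) / n - (ln (real (Suc n)) + 1) / Suc n" if "n \<ge> 4" for n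
  proof -
    have "4/3 \<le> ln (real (Suc n))" using that by (intro ln_ge_four_thirds) simp
    then have "n * (4/3) \<le> n * ln (real (Suc n))" by (intro mult_left_mono) auto
    moreover have "real (Suc n) \<le> n * (4/3)" using that by simp
    ultimately have "real (Suc n) \<le> n * ln (real (Suc n))" by linarith
    from ln_over_square_le[OF _ _ this] show ?thesis using that by simp
  qed
  have B: "(\<Sum>n\<in>{m<..m+k}. ln (real n) / (real n)\<^sup>2) \<le> (ln m + 1) / m - (ln (real (m + k)) + 1) / (m + k)" for k :: nat
  proof (induction k)
    case (Suc k)
    have "{m<..m + Suc k} = insert (Suc (m + k)) {m<..m + k}" by auto
    then show ?case using Suc step[of "m + k"] assms(1) by simp
  qed simp
  obtain k :: nat where "\<And>p. p \<in> P \<Longrightarrow> p \<le> m + k"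
  proof (rule that[of "Max P"])
    fix p assume "p \<in> P"
    then have "p \<le> Max P" by (rule Max_ge[OF assms(2)])
    then show "p \<le> m + Max P" by simp
  qed
  then have "(\<Sum>p\<in>P. ln (real p) / (real p)\<^sup>2) \<le> (\<Sum>n\<in>{m<..m+k}. ln (real n) / (real n)\<^sup>2)"
    using assms by (intro sum_mono2) auto
  also have "\<dots> \<le> (ln m + 1) / m"
  proof -
    have "real (m + k) \<ge> 1" using assms(1) by simp
    then have "0 \<le> (ln (real (m + k)) + 1) / (m + k)" by (intro divide_nonneg_nonneg add_nonneg_nonneg ln_ge_zero) auto
    then show ?thesis using B[of k] by linarith
  qed
  finally show ?thesis .
qed

text \<open>Telescoping through the odd numbers from 15 on halves the integral bound;
  \<open>17/135\<close> is \<open>(25/9 + 1) / 30\<close>, with \<open>25/9\<close> bounding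
  \<open>ln 16\<close>.\<close>

lemma sum_odd_ln_over_square_le:
  fixes P :: "nat set"
  assumes "finite P" "\<And>p. p \<in> P \<Longrightarrow> odd p \<and> p \<ge> 17"
  shows "(\<Sum>p\<in>P. ln (real p) / (real p)\<^sup>2) \<le> 17/135"
proof -
  let ?g = "\<lambda>n. real (15 + 2 * n)"
  have step: "ln (?g (Suc n)) / (?g (Suc n))\<^sup>2 \<le> ((ln (?g n) + 1) / ?g n - (ln (?g (Suc n)) + 1) / ?g (Suc n)) / 2" for n
  proof -
    have "4/3 \<le> ln (?g (Suc n))" by (intro ln_ge_four_thirds) simp
    then have "?g n * (4/3) \<le> ?g n * ln (?g (Suc n))" by (intro mult_left_mono) auto
    then have "?g (Suc n) \<le> ?g n * ln (?g (Suc n))" by simp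
    from ln_over_square_le[OF _ _ this] show ?thesis by (simp add: mult.commute)
  qed
  have B: "(\<Sum>n=1..k. ln (?g n) / (?g n)\<^sup>2) \<le> ((ln (?g 0) + 1) / ?g 0 - (ln (?g k) + 1) / ?g k) / 2" for k
  proof (induction k)
    case (Suc k)
    have "{1..Suc k} = insert (Suc k) {1..k}" by auto
    then show ?case using Suc step[of k] by simp
  qed simp
  have "P \<subseteq> (\<lambda>n. 15 + 2 * n) ` {1..Max P}"
  proof
    fix p assume p: "p \<in> P"
    then obtain j where j: "p = 2 * j + 1" using assms(2) oddE by blast
    have "p = 15 + 2 * (j - 7)" "j - 7 \<ge> 1" "j - 7 \<le> p" using j assms(2)[OF p] by auto
    moreover have "p \<le> Max P" using assms(1) p by simp
    ultimately show "p \<in> (\<lambda>n. 15 + 2 * n) ` {1..Max P}" by (intro image_eqI[of _ _ "j - 7"]) auto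
  qed
  then have "(\<Sum>p\<in>P. ln (real p) / (real p)\<^sup>2) \<le> (\<Sum>p\<in>(\<lambda>n. 15 + 2 * n) ` {1..Max P}. ln (real p) / (real p)\<^sup>2)"
    by (intro sum_mono2) auto
  also have "\<dots> = (\<Sum>n=1..Max P. ln (?g n) / (?g n)\<^sup>2)" by (subst sum.reindex) (auto simp: inj_on_def)
  also have "\<dots> \<le> ((ln (?g 0) + 1) / ?g 0 - (ln (?g (Max P)) + 1) / ?g (Max P)) / 2" by (rule B)
  also have "\<dots> \<le> ((ln (?g 0) + 1) / ?g 0) / 2"
  proof -
    have "0 \<le> (ln (?g (Max P)) + 1) / ?g (Max P)"
      by (intro divide_nonneg_nonneg add_nonneg_nonneg ln_ge_zero) auto
    then have "(ln (?g 0) + 1) / ?g 0 - (ln (?g (Max P)) + 1) / ?g (Max P) \<le> (ln (?g 0) + 1) / ?g 0"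
      by (simp only: diff_le_eq le_add_same_cancel1)
    then show ?thesis by (rule divide_right_mono) simp
  qed
  also have "\<dots> \<le> 17/135"
  proof -
    have "ln (15::real) \<le> ln 16" by simp
    then have "ln (15::real) \<le> 25/9" using ln_bounds_small(4) by linarith
    then show ?thesis by simp
  qed
  finally show ?thesis .
qed

section \<open>Mean of the defects and the bound for general K\<close>

context prime_tuple
begin

lemma defect_nonneg: "defect p \<ge> 0" by (simp add: defect_def)

lemma defect_le_1: "prime p \<Longrightarrow> defect p \<le> 1"
  using euler_pos[of p] by (simp add: defect_def)

lemma defect_le: "prime p \<Longrightarrow> p \<ge> 2 * K \<Longrightarrow> defect p \<le> (real K)\<^sup>2 / (real p)\<^sup>2"
  using euler_ge[of p] by (simp add: defect_def)

text \<open>Up to \<open>2 K\<close> a defect is trivially at most 1 and there are at most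
  \<open>2 K\<close> primes; beyond, it is at most \<open>K^2 / p^2\<close>. The total is
  \<open>K (5/2 ln (2 K) + 1/2)\<close>.\<close>

lemma mean_bound_general: "mean_bound (6 * K * ln K)"
  unfolding mean_bound_def
proof (intro allI impI)
  fix P :: "nat set" assume P: "finite P" "\<forall>p\<in>P. prime p"
  have K: "real K \<ge> 2" using K_ge_2 by simp
  have lnK: "ln 2 \<le> ln (real K)" using K by simp
  have ln2K: "ln (real (2 * K)) = ln 2 + ln K" using K by (simp add: ln_mult)
  have p1: "real p \<ge> 1" if "p \<in> P" for p using that P prime_ge_1_nat by auto
  let ?A = "P \<inter> {..2 * K}" and ?B = "P - {..2 * K}"
  have "(\<Sum>p\<in>P. defect p * ln p) = (\<Sum>p\<in>?A. defect p * ln p) + (\<Sum>p\<in>?B. defect p * ln p)"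
    by (rule sum.Int_Diff[OF P(1)])
  also have "(\<Sum>p\<in>?A. defect p * ln p) \<le> (\<Sum>p\<in>?A. 1 * ln (2 * K))"
  proof (rule sum_mono)
    fix p assume p: "p \<in> ?A"
    then have "ln (real p) \<le> ln (real (2 * K))" using p1[of p] by (subst ln_le_cancel_iff) auto
    then show "defect p * ln p \<le> 1 * ln (2 * K)"
      using p P p1[of p] defect_le_1[of p] by (intro mult_mono) auto
  qed
  also have "\<dots> \<le> (2 * K) * ln (2 * K)"
  proof -
    have "?A \<subseteq> {1..2 * K}" using P prime_ge_1_nat by auto
    then have "card ?A \<le> 2 * K" using card_mono[of "{1..2 * K}" ?A] by simp
    then have "real (card ?A) \<le> 2 * K" by linarith
    then show ?thesis using K by (simp add: mult_right_mono)
  qed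
  also have "(\<Sum>p\<in>?B. defect p * ln p) \<le> (\<Sum>p\<in>?B. (real K)\<^sup>2 * (ln (real p) / (real p)\<^sup>2))"
  proof (rule sum_mono)
    fix p assume p: "p \<in> ?B"
    then have "defect p * ln p \<le> (real K)\<^sup>2 / (real p)\<^sup>2 * ln p"
      using P p1[of p] by (intro mult_right_mono defect_le) auto
    then show "defect p * ln p \<le> (real K)\<^sup>2 * (ln (real p) / (real p)\<^sup>2)" by simp
  qed
  also have "\<dots> = (real K)\<^sup>2 * (\<Sum>p\<in>?B. ln (real p) / (real p)\<^sup>2)" by (rule sum_distrib_left[symmetric])
  also have "\<dots> \<le> (real K)\<^sup>2 * ((ln (2 * K) + 1) / (2 * K))"
    using K_ge_2 P sum_ln_over_square_le[of "2 * K" ?B] by (intro mult_left_mono) auto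
  also have "(2 * K) * ln (2 * K) + (real K)\<^sup>2 * ((ln (2 * K) + 1) / (2 * K)) = K * (5/2 * ln (2 * K) + 1 / 2)"
    using K by (simp add: field_simps power2_eq_square)
  also have "\<dots> \<le> K * (6 * ln K)"
  proof (rule mult_left_mono)
    show "5/2 * ln (real (2 * K)) + 1 / 2 \<le> 6 * ln (real K)"
    proof -
      have "5/2 * (c + k) + 1/2 \<le> 6 * k" if "c \<le> k" "2/3 \<le> c" for c k :: real
        using that by (simp add: field_simps)
      from this[OF lnK ln2_ge_two_thirds] show ?thesis unfolding ln2K .
    qed
  qed simp
  finally show "(\<Sum>p\<in>P. defect p * ln p) \<le> 6 * K * ln K" by simp
qed

text \<open>\<open>L\<close> collects twice the shifts of \<open>ln X / 2\<close>:
  \<open>ln 2\<close> from \<open>z = sqrt X / 2\<close>, 1 from \<open>hinge\<close>, and the mean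
  \<mu>.\<close>

lemma pi_K_upper:
  assumes X: "X \<ge> 4" and mu: "mean_bound \<mu>" and L: "L \<ge> 2 * ln 2 + 2 + 2 * \<mu>" "L < ln X"
  shows "pi_K K a b X \<le> K * sqrt X / 2 + 2 ^ K * fact K * sing_prod K a b * X / (ln X - L) ^ K"
proof -
  have d: "ln X - L > 0" using L by simp
  have "(ln X - L) / 2 \<le> ln X / 2 - ln 2 - \<mu> - 1" using L(1) by (simp add: field_simps)
  then have "(ln X - L) / 2 \<le> max 0 (ln X / 2 - ln 2 - \<mu> - 1)" by (rule max.coboundedI2)
  then have "((ln X - L) / 2) ^ K \<le> (max 0 (ln X / 2 - ln 2 - \<mu> - 1)) ^ K"
    by (rule power_mono) (use d in simp)
  then have "((ln X - L) / 2) ^ K / fact K \<le> hinge K (ln X / 2 - ln 2 - \<mu>)"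
    unfolding hinge_def by (rule divide_right_mono) simp
  \<comment> \<open>The factor multiplying the hinge bound may be negative; then the right side,
    being nonnegative, wins trivially.\<close>
  then have "(pi_K K a b X - K * sqrt X / 2) * (((ln X - L) / 2) ^ K / fact K) \<le> sing_prod K a b * X"
  proof (cases "pi_K K a b X - K * sqrt X / 2 \<ge> 0")
    case True
    assume "((ln X - L) / 2) ^ K / fact K \<le> hinge K (ln X / 2 - ln 2 - \<mu>)"
    from mult_left_mono[OF this True] show ?thesis using pi_K_bound[OF X mu] by simp
  next
    case False
    have "(pi_K K a b X - K * sqrt X / 2) * (((ln X - L) / 2) ^ K / fact K) \<le> 0"
      using False d by (intro mult_nonpos_nonneg) auto
    also have "0 \<le> sing_prod K a b * X" using sing_prod_nonneg X by simp
    finally show ?thesis .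
  qed
  then have "pi_K K a b X - K * sqrt X / 2 \<le> sing_prod K a b * X / (((ln X - L) / 2) ^ K / fact K)"
    using d by (subst pos_le_divide_eq) auto
  also have "\<dots> = 2 ^ K * fact K * sing_prod K a b * X / (ln X - L) ^ K"
    by (simp add: power_divide)
  finally show ?thesis by simp
qed

text \<open>Bernoulli's inequality gives the claim with \<open>K * L\<close> in place of
  \<open>2 * r_K K\<close>, plus the boundary term. Since \<open>K * L <= 20 w\<close> is far below
  \<open>2 * r_K K\<close>, the difference of the two main terms is at least \<open>M / t\<close>,
  and this exceeds \<open>K * sqrt X / 2\<close>.\<close>

theorem pi_K_asymptotic_bound:
  assumes X: "X > exp (2 * r_K K)"
  shows "real (pi_K K a b X) < 2 ^ K * fact K * sing_prod K a b * X / (ln X) ^ K * (ln X / (ln X - 2 * r_K K))"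
proof -
  define t where "t = ln X"
  define w where "w = (real K)\<^sup>2 * ln K"
  define \<mu> where "\<mu> = 6 * K * ln K"
  define L where "L = 2 * ln 2 + 2 + 2 * \<mu>"
  define S where "S = sing_prod K a b"
  have X0: "X > 0" using X by (meson exp_gt_zero less_trans)
  have K: "real K \<ge> 2" using K_ge_2 by simp
  have lnK: "ln (real K) \<ge> 2/3" using ln2_ge_two_thirds ln_mono[of 2 "real K"] K by linarith
  have r: "r_K K = 5.961 * 10 ^ 14 * w" by (simp add: r_K_def w_def)
  have "exp (2 * r_K K) < exp t" using X X0 by (simp add: t_def)
  then have t: "t > 2 * r_K K" by simp
  have K2: "2 * real K \<le> (real K)\<^sup>2" using K by (simp add: power2_eq_square)
  have w1: "w \<ge> 2/3 * (real K)\<^sup>2" unfolding w_def using mult_left_mono[OF lnK, of "(real K)\<^sup>2"] by simp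
  have w2: "K * ln K \<le> w / 2" unfolding w_def using K2 lnK mult_right_mono[of "2 * real K" "(real K)\<^sup>2" "ln K"] by simp
  have mu: "0 \<le> \<mu>" "\<mu> \<le> 3 * w" using w2 lnK K by (simp_all add: \<mu>_def)
  have w: "w \<ge> 1" "real K \<le> w" using w1 K2 K by auto
  have KL: "K * L \<le> 20 * w"
  proof -
    have "K * L = K * (2 * ln 2 + 2) + 12 * w" by (simp add: L_def \<mu>_def w_def power2_eq_square algebra_simps)
    also have "K * (2 * ln 2 + 2) \<le> real K * 4" using ln2_le_25_over_36 K by (intro mult_left_mono) auto
    finally show ?thesis using w by simp
  qed
  have L: "0 \<le> L" "L \<le> 20 * w" "L \<le> K * L"
  proof -
    show L0: "0 \<le> L" using mu by (simp add: L_def)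
    show "L \<le> K * L" using mult_right_mono[of 1 "real K" L] K L0 by simp
    then show "L \<le> 20 * w" using KL by simp
  qed
  have rw: "r_K K \<ge> 10 ^ 14 * w" using r w by simp
  have t0: "t > 0" "K * L + 1 \<le> 2 * r_K K" "K * L < t" "L < t" using t rw KL L w by auto
  have X4: "X \<ge> 4"
  proof -
    have "t \<ge> 4" using t rw w by simp
    then have "exp 4 \<le> X" using X0 by (simp add: t_def ln_ge_iff)
    then show ?thesis using exp_ge_add_one_self[of 4] by simp
  qed
  have mb: "mean_bound \<mu>" unfolding \<mu>_def by (rule mean_bound_general)
  have S: "S \<ge> exp (- 4 - 2 * \<mu>) / fact K" unfolding S_def by (rule sing_prod_lower_bound[OF mb])
  have S0: "S > 0" using S by (smt (verit) divide_pos_pos exp_gt_zero fact_gt_zero)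
  define M where "M = 2 ^ K * fact K * S * X / t ^ K"
  have M0: "M > 0" using S0 X0 t0 by (simp add: M_def)
  have "pi_K K a b X \<le> K * sqrt X / 2 + 2 ^ K * fact K * S * X / (t - L) ^ K"
    using pi_K_upper[OF X4 mb, of L] t0 by (simp add: L_def S_def t_def)
  also have "2 ^ K * fact K * S * X / (t - L) ^ K \<le> M * (t / (t - K * L))"
  proof -
    have "1 - K * L / t \<le> (1 - L / t) ^ K"
      using Bernoulli_inequality[of "- (L / t)" K] t0 by (simp add: divide_le_eq_1)
    also have "\<dots> = (t - L) ^ K / t ^ K" using t0 by (simp add: diff_divide_distrib flip: power_divide)
    finally have "(t - K * L) / t \<le> (t - L) ^ K / t ^ K" using t0 by (simp add: diff_divide_distrib)
    then have "t ^ K / (t - L) ^ K \<le> t / (t - K * L)" using t0 by (simp add: field_simps)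
    then have "M * (t ^ K / (t - L) ^ K) \<le> M * (t / (t - K * L))" using M0 by (intro mult_left_mono) auto
    then show ?thesis using t0 by (simp add: M_def)
  qed
  also have "K * sqrt X / 2 + M * (t / (t - K * L)) < M * (t / (t - 2 * r_K K))"
  proof -
    \<comment> \<open>Equivalent to \<open>K t^(K+1) < 2^(K+1) K! S exp (t / 2)\<close>. One factor
      \<open>exp (t / 4)\<close> beats \<open>t^(K+1)\<close>; the other compensates for the
      smallness of \<open>S\<close>.\<close>
    have e: "K * sqrt X / 2 < M / t"
    proof -
      have expt: "exp t = X" using X0 by (simp add: t_def)
      have sq: "sqrt X = exp (t / 2)" "exp (t / 2) * exp (t / 2) = X" using expt
        by (auto simp: exp_add[symmetric] intro: real_sqrt_unique simp: power2_eq_square)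
      have lt: "(K + 1) * ln t \<le> t / 4"
      proof -
        have "ln (sqrt t) \<le> sqrt t" using ln_le_minus_one[of "sqrt t"] t0 by simp
        then have "ln t \<le> 2 * sqrt t" using t0 by (simp add: ln_sqrt)
        then have "(K + 1) * ln t \<le> (K + 1) * (2 * sqrt t)" by (intro mult_left_mono) auto
        moreover have "8 * (K + 1) \<le> sqrt t"
        proof (rule real_le_rsqrt)
          have "(8 * (real K + 1))\<^sup>2 \<le> (12 * real K)\<^sup>2"
            using K by (intro power_mono) auto
          also have "\<dots> = 64 * (9/4 * (real K)\<^sup>2)" by (simp add: power_mult_distrib)
          also have "\<dots> \<le> t" using w1 t rw w(1) by simp
          finally show "(real (8 * (K + 1)))\<^sup>2 \<le> t" by (simp add: algebra_simps)
        qed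
        then have "(8 * (K + 1)) * sqrt t \<le> sqrt t * sqrt t" using t0 by (intro mult_right_mono) auto
        then have "(K + 1) * (2 * sqrt t) \<le> t / 4" using t0 by (simp add: algebra_simps)
        ultimately show ?thesis by (rule order_trans)
      qed
      have "t ^ (K + 1) = exp ((K + 1) * ln t)" using t0 by (simp only: exp_of_nat_mult exp_ln)
      also have "\<dots> \<le> exp (t / 4)" using lt by simp
      finally have "K * t ^ (K + 1) \<le> K * exp (t / 4)" by (intro mult_left_mono) auto
      also have "\<dots> < 2 ^ (K + 1) * exp (t / 4)"
      proof (rule mult_strict_right_mono)
        have "K < 2 ^ (K + 1)" by (rule less_le_trans[OF less_exp]) simp
        then show "real K < 2 ^ (K + 1)" by (metis of_nat_less_iff of_nat_numeral of_nat_power)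
      qed simp
      also have "exp (t / 4) = exp (- (t / 4)) * exp (t / 2)" by (simp flip: exp_add)
      also have "\<dots> \<le> (fact K * S) * exp (t / 2)"
      proof (rule mult_right_mono)
        have "- (t / 4) \<le> - 4 - 2 * \<mu>" using t rw mu w by simp
        then have "exp (- (t / 4)) \<le> exp (- 4 - 2 * \<mu>)" by simp
        also have "\<dots> \<le> fact K * S" using S by (simp add: field_simps)
        finally show "exp (- (t / 4)) \<le> fact K * S" .
      qed simp
      finally have "K * t ^ (K + 1) < 2 ^ (K + 1) * (fact K * S * exp (t / 2))" by simp
      then have "K * t ^ (K + 1) * exp (t / 2) < 2 ^ (K + 1) * (fact K * S * exp (t / 2)) * exp (t / 2)"
        by (rule mult_strict_right_mono) simp
      also have "\<dots> = 2 * (2 ^ K * fact K * S * X)" using sq(2) by (simp add: mult_ac)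
      finally show ?thesis using t0 unfolding M_def sq(1) by (simp add: field_simps)
    qed
    have "M / t \<le> M * (t / (t - 2 * r_K K)) - M * (t / (t - K * L))"
    proof -
      have "t / (t - 2 * r_K K) - t / (t - K * L) = t * (2 * r_K K - K * L) / ((t - 2 * r_K K) * (t - K * L))"
        using t t0 by (simp add: field_simps)
      \<comment> \<open>Of the gap only \<open>2 * r_K K - K * L >= 1\<close> is used; both factors
        of the denominator are at most \<open>t\<close>.\<close>
      also have "\<dots> \<ge> t * 1 / (t * t)"
        using t t0 rw w L K by (intro frac_le mult_mono mult_pos_pos) auto
      finally have "1 / t \<le> t / (t - 2 * r_K K) - t / (t - K * L)" using t0 by simp
      from mult_left_mono[OF this, of M] M0 show ?thesis by (simp add: right_diff_distrib)
    qed
    with e show ?thesis by linarith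
  qed
  finally show ?thesis by (simp add: M_def S_def t_def)
qed

end

section \<open>The explicit bound for K = 3\<close>

lemma prod_one_minus_ge:
  fixes d :: "'a \<Rightarrow> real"
  assumes "finite A" "\<And>x. x \<in> A \<Longrightarrow> 0 \<le> d x \<and> d x \<le> 1"
  shows "1 - (\<Sum>x\<in>A. d x) \<le> (\<Prod>x\<in>A. 1 - d x)"
  using assms
proof (induction A rule: finite_induct)
  case (insert x A)
  have d: "0 \<le> d x" "d x \<le> 1" and s: "0 \<le> (\<Sum>x\<in>A. d x)" using insert.prems by (auto intro!: sum_nonneg)
  have "1 - (\<Sum>x\<in>insert x A. d x) = (1 - d x) * (1 - (\<Sum>x\<in>A. d x)) - d x * (\<Sum>x\<in>A. d x)"
    using insert.hyps by (simp add: algebra_simps)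
  also have "\<dots> \<le> (1 - d x) * (1 - (\<Sum>x\<in>A. d x))" using d s by simp
  also have "\<dots> \<le> (1 - d x) * (\<Prod>x\<in>A. 1 - d x)"
    using insert d by (intro mult_left_mono insert.IH) auto
  finally show ?case using insert.hyps by simp
qed simp

lemma prime_le_16:
  assumes "prime (p::nat)" "p \<le> 16"
  shows "p \<in> {2, 3, 5, 7, 11, 13}"
proof (cases "p = 2 \<or> p = 3")
  case False
  have "odd p" using prime_odd_nat[OF assms(1)] False prime_ge_2_nat[OF assms(1)] by auto
  moreover have "\<not> 3 dvd p"
  proof
    assume "3 dvd p"
    then have "3 = p" using assms(1) unfolding prime_nat_iff by auto
    then show False using False by simp
  qed
  moreover have "2 \<le> p" by (rule prime_ge_2_nat[OF assms(1)])
  ultimately have "p = 5 \<or> p = 7 \<or> p = 11 \<or> p = 13" using assms(2) False by presburger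
  then show ?thesis by auto
qed auto

text \<open>With \<open>u = 10 t - 125\<close> the difference of the two sides is a polynomial with nonnegative coefficients.\<close>

lemma integer_sieve_inequality:
  fixes u :: real
  assumes "u \<ge> 0"
  defines "p \<equiv> 100 * u ^ 3 + 2951 * u\<^sup>2 - 155520 * u + 74440925"
  shows "(u + 125) ^ 4 * p + 70 * p * (u + 67) ^ 3
    \<le> (u + 125) * (u + 67) ^ 3 * (614269050 + 8481730 * u + 37500 * u ^ 2 + 100 * u ^ 3)"
proof -
  have "(u + 67) ^ 3 = 300763 + 13467 * u + 201 * u ^ 2 + 1 * u ^ 3" "(u + 125) ^ 4 = 244140625 + 7812500 * u + 93750 * u ^ 2 + 500 * u ^ 3 + 1 * u ^ 4"
    by (simp_all add: eval_nat_numeral algebra_simps)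
  then have "(u + 125) * (u + 67) ^ 3 * (614269050 + 8481730 * u + 37500 * u ^ 2 + 100 * u ^ 3) - ((u + 125) ^ 4 * p + 70 * p * (u + 67) ^ 3)
    = 3352386015761375 + 927166918500100 * u + 34497419556855 * u ^ 2 + 527724216920 * u ^ 3 + 3845436485 * u ^ 4 + 12257380 * u ^ 5 + 10149 * u ^ 6"
    unfolding p_def by (simp add: eval_nat_numeral algebra_simps)
  also have "\<dots> \<ge> 0" using assms(1) by (intro add_nonneg_nonneg mult_nonneg_nonneg zero_le_power) auto
  finally show ?thesis by simp
qed

text \<open>\<open>29/5\<close> bounds \<open>2 ln 2 + 2 + 2 (6/5)\<close>, the shift
  \<open>L\<close> for \<mu> = 6/5; \<open>7 / t ^ 4\<close> makes room for the boundary term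
  \<open>3 sqrt X / 2\<close>; \<open>25/2\<close> lies below \<open>ln 437400\<close>.\<close>

lemma cubic_sieve_inequality:
  fixes t :: real
  assumes "t \<ge> 25/2"
  shows "P3 t > 0" "1 / (t - 29/5) ^ 3 + 7 / t ^ 4 \<le> 1 / t ^ 3 * (1 + 34.549 * t\<^sup>2 / P3 t)"
proof -
  define u where "u = 10 * t - 125"
  define p where "p = 100 * u ^ 3 + 2951 * u\<^sup>2 - 155520 * u + 74440925"
  define q where "q = 614269050 + 8481730 * u + 37500 * u ^ 2 + 100 * u ^ 3"
  have u: "u \<ge> 0" "t = (u + 125) / 10" using assms by (auto simp: u_def)
  have "t - 29/5 = (u + 67) / 10" by (simp add: u(2))
  then have "(t - 29/5) ^ 3 = ((u + 67) / 10) ^ 3" by (simp only:)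
  then have c3: "(t - 29/5) ^ 3 = (u + 67) ^ 3 / 1000" unfolding power_divide by simp
  have t4: "t ^ 4 = (u + 125) ^ 4 / 10000" by (simp add: u(2) power_divide)
  have P: "P3 t = p / 100000"
    unfolding P3_def p_def u(2) by (simp add: field_simps eval_nat_numeral)
  have Q: "P3 t + 34.549 * t\<^sup>2 = q / 100000"
    unfolding P3_def q_def u(2) by (simp add: field_simps eval_nat_numeral)
  have "2951 * u\<^sup>2 - 155520 * u + 74440925 = 2951 * (u - 77760 / 2951)\<^sup>2 + (74440925 - 77760\<^sup>2 / 2951)"
    by (simp add: power2_eq_square field_simps)
  also have "\<dots> > 0" by (intro add_nonneg_pos) auto
  finally have p0: "p > 0" using zero_le_power[OF u(1), of 3] unfolding p_def by linarith
  then show P0: "P3 t > 0" by (simp add: P)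
  have d: "t - 29/5 > 0" "t > 0" using assms by auto
  have "(u + 125) ^ 4 * p + 70 * p * (u + 67) ^ 3 \<le> (u + 125) * (u + 67) ^ 3 * q"
    using integer_sieve_inequality[OF u(1)] by (simp only: p_def q_def)
  then have "t ^ 4 * P3 t + 7 * (P3 t * (t - 29/5) ^ 3) \<le> t * (t - 29/5) ^ 3 * (P3 t + 34.549 * t\<^sup>2)"
    unfolding Q unfolding P c3 t4 unfolding u(2) by (simp add: field_simps)
  then have "(t ^ 4 * P3 t + 7 * (P3 t * (t - 29/5) ^ 3)) / (t ^ 4 * P3 t * (t - 29/5) ^ 3)
      \<le> (t * (t - 29/5) ^ 3 * (P3 t + 34.549 * t\<^sup>2)) / (t ^ 4 * P3 t * (t - 29/5) ^ 3)"
    using P0 d by (intro divide_right_mono) auto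
  moreover have "(a * b + 7 * (b * c)) / (a * b * c) = 1 / c + 7 / a" if "a > 0" "b > 0" "c > 0" for a b c :: real
    using that by (simp add: field_simps)
  moreover have "(t * c * (b + u)) / (t ^ 4 * b * c) = 1 / t ^ 3 * (1 + u / b)" if "b > 0" "c > 0" for b c u :: real
    using that d by (simp add: field_simps eval_nat_numeral)
  ultimately show "1 / (t - 29/5) ^ 3 + 7 / t ^ 4 \<le> 1 / t ^ 3 * (1 + 34.549 * t\<^sup>2 / P3 t)"
    using P0 d by simp
qed

context prime_tuple
begin

lemma euler_cubic: "K = 3 \<Longrightarrow> euler p = (1 - rho p / p) / (1 - 1 / p) ^ 3"
  unfolding euler_def by simp

lemma euler_ge_cubic:
  assumes "K = 3" "prime p"
  shows "euler p \<ge> (1 - 3 / p) / (1 - 1 / p) ^ 3"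
proof -
  have p: "real p > 1" using prime_gt_1_nat[OF assms(2)] by simp
  have "1 - 3 / p \<le> 1 - rho p / p" using rho_le[OF assms(2)] assms(1) p by (simp add: divide_right_mono)
  then show ?thesis unfolding euler_cubic[OF assms(1)] using p by (intro divide_right_mono) auto
qed

lemma euler_2: assumes "K = 3" shows "euler 2 = 4"
proof -
  have "rho 2 = 1" using rho_pos[of 2] rho_less[of 2] two_is_prime_nat by simp
  then show ?thesis unfolding euler_cubic[OF assms] by (simp add: power3_eq_cube)
qed

lemma euler_3: assumes "K = 3" shows "euler 3 \<ge> 9/8"
proof -
  have "rho 3 < 3" by (rule rho_less) simp
  then have "rho 3 \<le> 2" by simp
  then show ?thesis unfolding euler_cubic[OF assms] by (simp add: field_simps power3_eq_cube)
qed

text \<open>At 2 and 3 admissibility forces \<open>euler p >= 1\<close>, so there is no defect. The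
  primes from 5 to 13 contribute less than \<open>0.74\<close> and the larger ones at most
  \<open>18/5 * 17/135\<close>, below \<open>0.46\<close>.\<close>

lemma mean_bound_3:
  assumes K3: "K = 3"
  shows "mean_bound (6/5)"
  unfolding mean_bound_def
proof (intro allI impI)
  fix P :: "nat set" assume P: "finite P" "\<forall>p\<in>P. prime p"
  let ?A = "P \<inter> {..16}" and ?B = "P - {..16}" and ?S = "{2, 3, 5, 7, 11, 13} :: nat set"
  have primes: "prime p" if "p \<in> ?S" for p :: nat using that by auto
  \<comment> \<open>The fractions are \<open>1 - (1 - 3 / p) / (1 - 1 / p) ^ 3\<close>, the extreme
    case \<open>rho p = 3\<close>.\<close>
  have d: "defect 2 = 0" "defect 3 = 0" "defect 5 \<le> 7/32" "defect 7 \<le> 5/54" "defect 11 \<le> 4/125" "defect 13 \<le> 19/864"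
  proof -
    show "defect 2 = 0" "defect 3 = 0" using euler_2[OF K3] euler_3[OF K3] by (simp_all add: defect_def)
    have le: "defect p \<le> c" if "0 \<le> c" "1 - c \<le> euler p" for p c using that by (simp add: defect_def)
    show "defect 5 \<le> 7/32" using euler_ge_cubic[OF K3 primes, of 5] by (intro le) (simp_all add: power3_eq_cube)
    show "defect 7 \<le> 5/54" using euler_ge_cubic[OF K3 primes, of 7] by (intro le) (simp_all add: power3_eq_cube)
    show "defect 11 \<le> 4/125" using euler_ge_cubic[OF K3 primes, of 11] by (intro le) (simp_all add: power3_eq_cube)
    show "defect 13 \<le> 19/864" using euler_ge_cubic[OF K3 primes, of 13] by (intro le) (simp_all add: power3_eq_cube)
  qed
  have l: "ln 7 \<le> (25/12::real)" "ln 11 \<le> (25/9::real)" "ln 13 \<le> (25/9::real)"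
  proof -
    have "ln 7 \<le> ln (8::real)" "ln 11 \<le> ln (16::real)" "ln 13 \<le> ln (16::real)" by simp_all
    then show "ln 7 \<le> (25/12::real)" "ln 11 \<le> (25/9::real)" "ln 13 \<le> (25/9::real)"
      using ln_bounds_small by linarith+
  qed
  have "(\<Sum>p\<in>P. defect p * ln p) = (\<Sum>p\<in>?A. defect p * ln p) + (\<Sum>p\<in>?B. defect p * ln p)"
    by (rule sum.Int_Diff[OF P(1)])
  also have "(\<Sum>p\<in>?A. defect p * ln p) \<le> (\<Sum>p\<in>?S. defect p * ln p)"
  proof (rule sum_mono2)
    show "?A \<subseteq> ?S" using P(2) prime_le_16 by blast
    show "0 \<le> defect p * ln p" if "p \<in> ?S - ?A" for p
      using that by (intro mult_nonneg_nonneg defect_nonneg) auto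
  qed simp
  also have "\<dots> = defect 5 * ln 5 + defect 7 * ln 7 + defect 11 * ln 11 + defect 13 * ln 13"
    using d(1,2) by simp
  also have "\<dots> \<le> 7/32 * (25/14) + 5/54 * (25/12) + 4/125 * (25/9) + 19/864 * (25/9)"
    using d l ln_bounds_small(2) defect_nonneg by (intro add_mono mult_mono) auto
  also have "(\<Sum>p\<in>?B. defect p * ln p) \<le> (\<Sum>p\<in>?B. 18/5 * (ln (real p) / (real p)\<^sup>2))"
  proof (rule sum_mono)
    fix p assume p: "p \<in> ?B"
    then have pp: "prime p" "p \<ge> 17" using P by auto
    define x where "x = 1 / real p"
    have x: "0 < x" "x \<le> 1 / 17" using pp by (auto simp: x_def intro: divide_left_mono)
    \<comment> \<open>This yields the denominator \<open>5/6\<close>, and \<open>18/5\<close> is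
      \<open>3 / (5/6)\<close>.\<close>
    have "(16 / 17) ^ 3 \<le> (1 - x) ^ 3" using x by (intro power_mono) auto
    then have c: "5/6 \<le> (1 - x) ^ 3" by (simp add: power3_eq_cube)
    have "1 - euler p \<le> 1 - (1 - 3 * x) / (1 - x) ^ 3" using euler_ge_cubic[OF K3 pp(1)] by (simp add: x_def)
    also have "\<dots> = ((1 - x) ^ 3 - (1 - 3 * x)) / (1 - x) ^ 3" using x by (simp add: diff_divide_distrib)
    also have "(1 - x) ^ 3 - (1 - 3 * x) = 3 * x\<^sup>2 - x ^ 3"
      by (simp add: power2_eq_square power3_eq_cube algebra_simps)
    also have "(3 * x\<^sup>2 - x ^ 3) / (1 - x) ^ 3 \<le> (3 * x\<^sup>2) / (5/6)"
      using c x by (intro frac_le) auto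
    finally have "1 - euler p \<le> 18/5 * x\<^sup>2" by simp
    then have "defect p \<le> 18/5 * x\<^sup>2" unfolding defect_def by (intro max.boundedI) auto
    then have "defect p * ln p \<le> 18/5 * x\<^sup>2 * ln p" using pp by (intro mult_right_mono) auto
    then show "defect p * ln p \<le> 18/5 * (ln (real p) / (real p)\<^sup>2)" by (simp add: x_def power_divide)
  qed
  also have "\<dots> = 18/5 * (\<Sum>p\<in>?B. ln (real p) / (real p)\<^sup>2)" by (rule sum_distrib_left[symmetric])
  also have "\<dots> \<le> 18/5 * (17/135)"
  proof (intro mult_left_mono sum_odd_ln_over_square_le)
    show "odd p \<and> 17 \<le> p" if "p \<in> ?B" for p using that P prime_odd_nat[of p] by auto
  qed (use P in auto)
  finally show "(\<Sum>p\<in>P. defect p * ln p) \<le> 6/5" by simp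
qed

text \<open>The general lower bound is too small for \<open>X\<close> near 437400. Instead the mean
  bound is reused: \<open>ln p >= 4/3\<close> for \<open>p >= 5\<close>, so these defects sum to at
  most \<open>9/10\<close> and their factors multiply to at least \<open>1/10\<close>, while 2 and 3
  contribute at least \<open>4 * (9/8)\<close>.\<close>

lemma sing_prod_ge_3:
  assumes K3: "K = 3"
  shows "sing_prod K a b \<ge> 2/5"
proof -
  have "2/5 \<le> (\<Prod>p | prime p \<and> p \<le> n. euler p)" if n: "n \<ge> 3" for n
  proof -
    let ?P = "{p. prime p \<and> p \<le> n}"
    let ?Q = "?P - {2, 3}"
    have fin: "finite ?P" by simp
    have Q: "prime p" "p \<ge> 5" if "p \<in> ?Q" for p
    proof -
      show "prime p" using that by simp
      then have "p \<ge> 2" "odd p \<or> p = 2" using prime_ge_2_nat[of p] prime_odd_nat[of p] by (auto simp: le_less)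
      then show "p \<ge> 5" using that by (cases "p = 4") auto
    qed
    have "(\<Sum>p\<in>?Q. defect p) * (4/3) = (\<Sum>p\<in>?Q. defect p * (4/3))" by (rule sum_distrib_right)
    also have "\<dots> \<le> (\<Sum>p\<in>?Q. defect p * ln p)"
    proof (rule sum_mono)
      show "defect p * (4/3) \<le> defect p * ln p" if "p \<in> ?Q" for p
        using Q(2)[OF that] by (intro mult_left_mono defect_nonneg ln_ge_four_thirds) simp
    qed
    also have "\<dots> \<le> 6/5" using mean_bound_3[OF K3] fin unfolding mean_bound_def by auto
    finally have "1/10 \<le> 1 - (\<Sum>p\<in>?Q. defect p)" by simp
    also have "\<dots> \<le> (\<Prod>p\<in>?Q. 1 - defect p)"
      using Q defect_nonneg defect_le_1 by (intro prod_one_minus_ge) auto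
    also have "\<dots> \<le> (\<Prod>p\<in>?Q. euler p)"
      using Q defect_le_1 by (intro prod_mono) (auto simp: defect_def)
    finally have Q': "1/10 \<le> (\<Prod>p\<in>?Q. euler p)" .
    have "(\<Prod>p\<in>?P. euler p) = (\<Prod>p\<in>?Q. euler p) * (\<Prod>p\<in>{2, 3}. euler p)"
      using n by (intro prod.subset_diff fin) auto
    also have "\<dots> = euler 2 * euler 3 * (\<Prod>p\<in>?Q. euler p)" by simp
    also have "4 * (9/8) * (1/10) \<le> euler 2 * euler 3 * (\<Prod>p\<in>?Q. euler p)"
      using euler_2[OF K3] euler_3[OF K3] Q' by (intro mult_mono) auto
    finally show ?thesis by simp
  qed
  then have "\<forall>n\<ge>3. 2/5 \<le> (\<Prod>p | prime p \<and> p \<le> n. euler p)" by simp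
  then show ?thesis by (intro LIMSEQ_le_const[OF sing_prod_LIMSEQ]) (rule exI[of _ 3])
qed

theorem pi_K_bound_3:
  assumes K3: "K = 3" and X: "X \<ge> 437400"
  shows "real (pi_K K a b X) \<le> 48 * sing_prod K a b * X / (ln X) ^ 3 * (1 + 34.549 * (ln X)^2 / P3 (ln X))"
proof -
  define t where "t = ln X"
  define S where "S = sing_prod K a b"
  have S: "S \<ge> 2/5" unfolding S_def by (rule sing_prod_ge_3[OF K3])
  have expt: "exp t = X" using X by (simp add: t_def)
  \<comment> \<open>Proved in squared form, \<open>exp 25 <= 2.72 ^ 25 <= 437400^2\<close>, to keep
    the exponent integral.\<close>
  have t: "t \<ge> 25/2"
  proof -
    have "exp (25::real) = exp 1 ^ 25" by (simp flip: exp_of_nat_mult)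
    also have "\<dots> \<le> (272/100) ^ 25" using e_less_272 by (intro power_mono) auto
    also have "\<dots> \<le> 437400\<^sup>2" by (simp add: power_divide)
    also have "\<dots> \<le> X\<^sup>2" using X by (intro power_mono) auto
    also have "\<dots> = exp (2 * t)" by (simp add: expt[symmetric] power2_eq_square flip: exp_add)
    finally show ?thesis by simp
  qed
  have sq: "sqrt X = exp (t / 2)" using expt
    by (intro real_sqrt_unique) (simp_all add: power2_eq_square flip: exp_add)
  have sq2: "sqrt X * sqrt X = X" using X by simp
  \<comment> \<open>The fourth power of \<open>exp (t / 8) >= exp 1 * t / 8\<close>. The constant is
    \<open>224 * 2/5\<close>: absorbing \<open>3 sqrt X / 2\<close> into
    \<open>48 S X * 7 / t^4\<close> needs \<open>224 S\<close>, and \<open>S >= 2/5\<close>.\<close>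
  have "t ^ 4 \<le> 448/5 * sqrt X"
  proof -
    have e27: "exp 1 \<ge> (27/10::real)" using e_approx_32 by (simp add: abs_if split: if_splits)
    have "27/10 * (t / 8) \<le> exp 1 * exp (t / 8 - 1)"
      using e27 exp_ge_add_one_self[of "t / 8 - 1"] t by (intro mult_mono) auto
    also have "\<dots> = exp (t / 8)" by (simp flip: exp_add)
    finally have "(27/10 * (t / 8)) ^ 4 \<le> exp (t / 8) ^ 4" using t by (intro power_mono) auto
    also have "\<dots> = sqrt X" unfolding sq by (simp flip: exp_of_nat_mult)
    finally have "531441/40960000 * t ^ 4 \<le> sqrt X" by (simp add: power_mult_distrib power_divide)
    moreover have "0 \<le> sqrt X" using X by simp
    ultimately show ?thesis by linarith
  qed
  also have "\<dots> \<le> 224 * S * sqrt X" using S X by (intro mult_right_mono) auto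
  finally have "t ^ 4 * sqrt X \<le> 224 * S * sqrt X * sqrt X" using X by (intro mult_right_mono) auto
  then have "t ^ 4 * sqrt X \<le> 224 * S * X" by (simp only: mult.assoc sq2)
  then have small: "3 * sqrt X / 2 \<le> 48 * S * X * (7 / t ^ 4)"
    using t by (simp add: field_simps)
  have "real (pi_K K a b X) \<le> K * sqrt X / 2 + 2 ^ K * fact K * sing_prod K a b * X / (ln X - 29/5) ^ K"
    using X t ln2_le_25_over_36 by (intro pi_K_upper[OF _ mean_bound_3[OF K3]]) (auto simp: t_def)
  also have "\<dots> = 3 * sqrt X / 2 + 48 * S * X * (1 / (t - 29/5) ^ 3)"
    by (simp add: K3 S_def t_def fact_numeral)
  also have "\<dots> \<le> 48 * S * X * (1 / (t - 29/5) ^ 3 + 7 / t ^ 4)"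
    using small by (simp only: distrib_left)
  also have "\<dots> \<le> 48 * S * X * (1 / t ^ 3 * (1 + 34.549 * t\<^sup>2 / P3 t))"
    using S X by (intro mult_left_mono cubic_sieve_inequality t) auto
  finally show ?thesis by (simp add: S_def t_def)
qed

end

theorem theorem1:
  fixes K :: nat and a b :: "nat \<Rightarrow> int"
  assumes "K \<ge> 2"
    and "E_K K a b \<noteq> 0"
    and "\<forall>p. prime p \<longrightarrow> rho_K K a b p < p"
  shows "(\<forall>X::real. X > exp (2 * r_K K) \<longrightarrow>
           real (pi_K K a b X) < 2 ^ K * fact K * sing_prod K a b * X / (ln X) ^ K
                                  * (ln X / (ln X - 2 * r_K K)))
       \<and> (K = 3 \<longrightarrow> (\<forall>X::real. X \<ge> 437400 \<longrightarrow>
           real (pi_K 3 a b X) \<le> 48 * sing_prod 3 a b * X / (ln X) ^ 3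
                                  * (1 + 34.549 * (ln X)^2 / P3 (ln X))))"
proof -
  interpret prime_tuple K a b by unfold_locales (use assms in auto)
  show ?thesis using pi_K_asymptotic_bound pi_K_bound_3 by blast
qed

end
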